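(* There is a polynomial-time algorithm which, given a finite metric space $(V,d)$ and a positive integer $k$, computes a set $\{T_1,\dots,T_t\}$ of at most $k$ trees whose vertex sets cover $V$, such that for every $p\in[1,\infty)$ and every tree cover $\{\hat T_1,\dots,\hat T_k\}$ of $(V,d)$ of size $k$, $$\Big(\sum_{i=1}^t w(T_i)^p\Big)^{1/p}\le 9\Big(\sum_{i=1}^k w(\hat T_i)^p\Big)^{1/p}.$$
   Context: A finite metric space $(V,d)$ is identified with the complete (edge-weighted) graph on $V$ with edge weights $d$. A tree is a tree in this graph on some subset of $V$ (a single vertex is allowed); its weight is $w(T)=\sum_{uv\in E(T)} d(u,v)$. A tree cover of size $k$ is a collection of $k$ trees whose vertex sets together cover $V$; the trees need not be disjoint. *)

theory Defs
  imports
    "HOL-Analysis.Analysis"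
    "HOL-Library.Log_Nat"
    "HOL-Computational_Algebra.Polynomial"
begin

section \<open>Trees and tree covers\<close>

text \<open>
  A graph is a pair of a vertex set and a set of two-element vertex sets.  (The predicate
  \<open>tree\<close> of the entry Graph_Theory speaks about directed cycles, so it is not the
  undirected notion.)
\<close>

definition is_cycle :: "'a set set \<Rightarrow> 'a list \<Rightarrow> bool" where
  "is_cycle E xs \<longleftrightarrow> 3 \<le> length xs \<and> distinct xs \<and>
     (\<forall>i<length xs. {xs ! i, xs ! (Suc i mod length xs)} \<in> E)"

definition is_tree :: "'a set \<times> 'a set set \<Rightarrow> bool" where
  "is_tree T \<longleftrightarrow> (case T of (S, E) \<Rightarrow>
     finite S \<and> S \<noteq> {} \<and> E \<subseteq> {e. e \<subseteq> S \<and> card e = 2} \<and>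
     (\<forall>u\<in>S. \<forall>v\<in>S. (u, v) \<in> {(x, y). {x, y} \<in> E}\<^sup>*) \<and>
     (\<nexists>xs. is_cycle E xs))"

text \<open>An edge is a set of two numbers, so its endpoints are its minimum and its maximum.\<close>

definition tree_weight :: "(nat \<Rightarrow> nat \<Rightarrow> real) \<Rightarrow> nat set \<times> nat set set \<Rightarrow> real" where
  "tree_weight d T = (\<Sum>e\<in>snd T. d (Min e) (Max e))"

definition tree_cover :: "'a set \<Rightarrow> ('a set \<times> 'a set set) set \<Rightarrow> bool" where
  "tree_cover V \<T> \<longleftrightarrow> (\<forall>T\<in>\<T>. is_tree T \<and> fst T \<subseteq> V) \<and> (\<Union>T\<in>\<T>. fst T) = V"


section \<open>Computations\<close>

text \<open>
  The machine model is a random access machine in structured form.  A memory consists of arrays of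
  natural numbers; a program mentions finitely many arrays, and scalar variables are arrays used at
  index 0 only.  The arithmetic operations are addition and truncated subtraction.  A step can
  therefore lengthen the binary representation of the largest number in memory only by a constant
  depending on the program, so that counting every assignment and every test as one step
  is polynomially equivalent to the running time of Turing machines.  (This would fail with
  multiplication as a unit-cost operation.)
\<close>

type_synonym memory = "nat \<Rightarrow> nat \<Rightarrow> nat"

datatype aexp = Num nat | Get nat aexp | Plus aexp aexp | Minus aexp aexp

primrec aval :: "aexp \<Rightarrow> memory \<Rightarrow> nat" where
  "aval (Num m) s = m"
| "aval (Get a e) s = s a (aval e s)"
| "aval (Plus e f) s = aval e s + aval f s"
| "aval (Minus e f) s = aval e s - aval f s"

text \<open>\<open>Assign a e f\<close> writes the value of \<open>f\<close> to index \<open>e\<close> of array \<open>a\<close>; in the conditional and in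
  the loop, a test is true if its value is not 0.\<close>

datatype com =
  Skip
| Assign nat aexp aexp
| Seq com com
| Cond aexp com com
| While aexp com

text \<open>\<open>exec c s t s'\<close>: started in \<open>s\<close>, the program \<open>c\<close> halts in \<open>s'\<close> after \<open>t\<close> steps.\<close>

inductive exec :: "com \<Rightarrow> memory \<Rightarrow> nat \<Rightarrow> memory \<Rightarrow> bool" where
  exec_Skip: "exec Skip s 1 s"
| exec_Assign: "exec (Assign a e f) s 1 (s(a := (s a)(aval e s := aval f s)))"
| exec_Seq: "exec c s t s' \<Longrightarrow> exec c' s' t' s'' \<Longrightarrow> exec (Seq c c') s (t + t') s''"
| exec_Cond_True: "aval b s \<noteq> 0 \<Longrightarrow> exec c s t s' \<Longrightarrow> exec (Cond b c c') s (t + 1) s'"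
| exec_Cond_False: "aval b s = 0 \<Longrightarrow> exec c' s t s' \<Longrightarrow> exec (Cond b c c') s (t + 1) s'"
| exec_While_False: "aval b s = 0 \<Longrightarrow> exec (While b c) s 1 s"
| exec_While_True: "aval b s \<noteq> 0 \<Longrightarrow> exec c s t s' \<Longrightarrow> exec (While b c) s' t' s'' \<Longrightarrow>
    exec (While b c) s (t + t' + 1) s''"

lemma exec_deterministic:
  "exec c s t s' \<Longrightarrow> exec c s u r \<Longrightarrow> u = t \<and> r = s'"
proof (induction arbitrary: u r rule: exec.induct)
  case (exec_Skip s)
  then show ?case by cases simp
next
  case (exec_Assign a e f s)
  then show ?case by cases simp
next
  case (exec_Seq c s t s' c' t' s'')
  from exec_Seq.prems show ?case
    by cases (use exec_Seq.IH in blast)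
next
  case (exec_Cond_True b s c t s' c')
  from exec_Cond_True.prems show ?case
    by cases (use exec_Cond_True.IH exec_Cond_True.hyps in blast)+
next
  case (exec_Cond_False b s c' t s' c)
  from exec_Cond_False.prems show ?case
    by cases (use exec_Cond_False.IH exec_Cond_False.hyps in blast)+
next
  case (exec_While_False b s c)
  from exec_While_False.prems show ?case
    by cases (use exec_While_False.hyps in blast)+
next
  case (exec_While_True b s c t s' t' s'')
  from exec_While_True.prems show ?case
    by cases (use exec_While_True.IH exec_While_True.hyps in blast)+
qed

text \<open>The input is stored in array 0, the output is read off array 1; both lists are preceded by
  their length.  All other cells are 0 initially.\<close>

definition input_memory :: "nat list \<Rightarrow> memory" where
  "input_memory xs = (\<lambda>a i. if a = 0 \<and> i \<le> length xs then (length xs # xs) ! i else 0)"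

definition output_of :: "memory \<Rightarrow> nat list" where
  "output_of s = map (s 1) [1..<Suc (s 1 0)]"

text \<open>The length of the output is charged as well, since entries of the output that are 0
  need not have been written explicitly.\<close>

definition computes_within :: "com \<Rightarrow> nat list \<Rightarrow> nat list \<Rightarrow> nat \<Rightarrow> bool" where
  "computes_within c xs ys T \<longleftrightarrow>
     (\<exists>t s. exec c (input_memory xs) t s \<and> output_of s = ys \<and> t + length ys \<le> T)"

text \<open>Every number contributes the length of its binary representation, plus one for a
  separator.\<close>

definition bit_size :: "nat list \<Rightarrow> nat" where
  "bit_size xs = (\<Sum>x\<leftarrow>xs. floorlog 2 x + 1)"


section \<open>Encoding of instances and solutions\<close>

text \<open>An instance consists of the number \<open>n\<close> of points, the number \<open>k\<close>, and the distances of the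
  points \<open>0, \<dots>, n - 1\<close>, row by row, as fractions in lowest terms.\<close>

definition encode_rat :: "rat \<Rightarrow> nat list" where
  "encode_rat r = (case quotient_of r of (a, b) \<Rightarrow> [nat a, nat b])"

definition encode_instance :: "nat \<Rightarrow> (nat \<Rightarrow> nat \<Rightarrow> rat) \<Rightarrow> nat \<Rightarrow> nat list" where
  "encode_instance n d k =
     n # k # concat (map (\<lambda>u. concat (map (\<lambda>v. encode_rat (d u v)) [0..<n])) [0..<n])"

text \<open>In a solution, a tree is listed by its vertices and its edges.\<close>

type_synonym tree_repr = "nat list \<times> (nat \<times> nat) list"

definition tree_of :: "tree_repr \<Rightarrow> nat set \<times> nat set set" where
  "tree_of T = (set (fst T), (\<lambda>(u, v). {u, v}) ` set (snd T))"

definition encode_tree :: "tree_repr \<Rightarrow> nat list" where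
  "encode_tree T = length (fst T) # fst T @
     length (snd T) # concat (map (\<lambda>(u, v). [u, v]) (snd T))"

definition encode_trees :: "tree_repr list \<Rightarrow> nat list" where
  "encode_trees Ts = length Ts # concat (map encode_tree Ts)"

text \<open>The encoding of solutions is unambiguous.\<close>

lemma concat_pairs_inj:
  fixes es es' :: "(nat \<times> nat) list"
  assumes "length es = length es'"
    and "concat (map (\<lambda>(u, v). [u, v]) es) @ xs = concat (map (\<lambda>(u, v). [u, v]) es') @ ys"
  shows "es = es' \<and> xs = ys"
  using assms by (induction es es' rule: list_induct2) auto

lemma encode_tree_prefix_free:
  assumes "encode_tree T @ xs = encode_tree T' @ ys"
  shows "T = T' \<and> xs = ys"
proof -
  obtain vs es vs' es' where T: "T = (vs, es)" "T' = (vs', es')"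
    by (metis surj_pair)
  have "vs = vs'" and "length es = length es'"
    and "concat (map (\<lambda>(u, v). [u, v]) es) @ xs = concat (map (\<lambda>(u, v). [u, v]) es') @ ys"
    using assms by (auto simp: T encode_tree_def)
  with concat_pairs_inj T show ?thesis by blast
qed

lemma inj_encode_trees: "inj encode_trees"
proof (rule injI)
  fix Ts Ts' :: "tree_repr list"
  assume "encode_trees Ts = encode_trees Ts'"
  then have "length Ts = length Ts'" "concat (map encode_tree Ts) = concat (map encode_tree Ts')"
    by (auto simp: encode_trees_def)
  then show "Ts = Ts'"
    by (induction Ts Ts' rule: list_induct2) (auto dest: encode_tree_prefix_free)
qed

end

theory Submission
  imports Defs
begin

text \<open>
  Vertices are merged as in Kruskal's algorithm, and each component carries a cycle through its
  vertices whose weight is at most twice that of its Kruskal tree.  For a bound \<open>B\<close>, all cycles are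
  cut greedily into paths of weight at most \<open>B\<close>.  As long as there are more than \<open>k\<close> paths, the
  algorithm raises \<open>B\<close> to the next value at which the greedy cuts change, or, if this would exceed
  \<open>6\<close> times the distance of the closest two components, merges these two.

  Put \<open>R = B / 6\<close> at the end.  Edges of the Kruskal trees weigh at most \<open>R\<close> and edges between
  components at least \<open>R\<close>.  Since the previous attempt failed, the components have quotas \<open>m \<ge> 1\<close>
  of sum at least \<open>k\<close> with \<open>3 R (m - 1) \<le> x\<close>, where \<open>x\<close> is the weight of the
  Kruskal tree.  Compare with an arbitrary cover and call its trees lighter than \<open>2 R / 3\<close> small.  If a
  component of quota 1 meets exactly one tree of the cover, in one piece, and this tree is small, then
  \<open>x\<close> is at most its weight.  All other components together are charged to the trees that are not
  small: their paths have total weight at most \<open>9\<close> times the total weight of these trees, and each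
  path weighs at most \<open>6 R\<close>, which is at most \<open>9\<close> times the weight of any of these trees.  This bounds
  every power sum with exponent at least 1.
\<close>

section \<open>Programs and their running times\<close>

text \<open>One output has to serve every exponent \<open>p\<close>. The comparison therefore uses
  only two quantities that do not depend on it: terms of total \<open>S\<close>, each at most
  \<open>M\<close>, have a \<open>p\<close>-th power sum of at most
  \<open>S * M powr (p - 1)\<close>. A cycle weighs at most \<open>2 * x\<close>, so factor
  \<open>9\<close> on the totals means charging \<open>2 / 9 * x\<close> per component; factor
  \<open>9\<close> on the maxima means that a tree which is not small weighs at least
  \<open>6 * R / 9\<close>. This fixes the threshold for small trees. A greedy cut is made only
  after a stretch of cycle whose weight is at least the next bound, so a failure at one bound is
  evidence about the bound that follows, the one at which the output may be produced. A tree of the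
  cover may visit many components, and the quotas must be compared with the number of pieces into
  which the components divide the \<open>k\<close> trees. Each further piece of a tree costs an edge
  of weight at least \<open>R\<close>, which pays for it. The bound moves through weights of parts
  of the tour, so the number of rounds is independent of the magnitude of the distances. Distances
  are made integral beforehand, by a multiplication built from doublings.\<close>

fun tbound :: "nat \<Rightarrow> com \<Rightarrow> nat" where
  "tbound X Skip = 1"
| "tbound X (Assign a e f) = 1"
| "tbound X (Seq c c') = tbound X c + tbound X c'"
| "tbound X (Cond b c c') = tbound X c + tbound X c' + 1"
| "tbound X (While b c) = X * (tbound X c + 1) + 1"

text \<open>One number \<open>X\<close> bounds the rounds of every loop, so nesting of loops only
  raises the degree.\<close>

lemma tbound_poly: "\<exists>q :: nat poly. \<forall>X. tbound X c = poly q X"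
proof (induction c)
  case Skip
  show ?case by (rule exI[of _ 1]) simp
next
  case (Assign a e f)
  show ?case by (rule exI[of _ 1]) simp
next
  case (Seq c c')
  then obtain p q where "\<forall>X. tbound X c = poly p X" "\<forall>X. tbound X c' = poly q X" by blast
  then show ?case by (intro exI[of _ "p + q"]) simp
next
  case (Cond b c c')
  then obtain p q where "\<forall>X. tbound X c = poly p X" "\<forall>X. tbound X c' = poly q X" by blast
  then show ?case by (intro exI[of _ "p + q + 1"]) simp
next
  case (While b c)
  then obtain p where "\<forall>X. tbound X c = poly p X" by blast
  then show ?case by (intro exI[of _ "[:0, 1:] * (p + 1) + 1"]) simp
qed

text \<open>Total correctness including time: the run must end within \<open>tbound X c\<close>, so
  every proof of a postcondition also proves the running time.\<close>

definition wp :: "nat \<Rightarrow> com \<Rightarrow> (memory \<Rightarrow> bool) \<Rightarrow> memory \<Rightarrow> bool" where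
  "wp X c Q s \<longleftrightarrow> (\<exists>t s'. exec c s t s' \<and> t \<le> tbound X c \<and> Q s')"

fun writes :: "com \<Rightarrow> nat set" where
  "writes Skip = {}"
| "writes (Assign a e f) = {a}"
| "writes (Seq c c') = writes c \<union> writes c'"
| "writes (Cond b c c') = writes c \<union> writes c'"
| "writes (While b c) = writes c"

lemma exec_frame: "exec c s t s' \<Longrightarrow> a \<notin> writes c \<Longrightarrow> s' a = s a"
  by (induction rule: exec.induct) auto

lemma wp_frame: "wp X c Q s \<Longrightarrow> wp X c (\<lambda>s'. Q s' \<and> (\<forall>a. a \<notin> writes c \<longrightarrow> s' a = s a)) s"
  unfolding wp_def using exec_frame by blast

lemma wp_mono: "wp X c Q s \<Longrightarrow> (\<And>s'. Q s' \<Longrightarrow> Q' s') \<Longrightarrow> wp X c Q' s"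
  unfolding wp_def by blast

lemma wp_frame_mono:
  "wp X c Q s \<Longrightarrow> (\<And>s'. Q s' \<Longrightarrow> (\<And>a. a \<notin> writes c \<Longrightarrow> s' a = s a) \<Longrightarrow> Q' s') \<Longrightarrow> wp X c Q' s"
  by (drule wp_frame) (erule wp_mono, blast)

lemma wp_Skip [simp]: "wp X Skip Q s \<longleftrightarrow> Q s"
proof
  show "wp X Skip Q s \<Longrightarrow> Q s"
    unfolding wp_def by (auto elim: exec.cases)
  show "Q s \<Longrightarrow> wp X Skip Q s"
    unfolding wp_def by (metis exec_Skip tbound.simps(1) order_refl)
qed

lemma wp_Assign [simp]:
  "wp X (Assign a e f) Q s \<longleftrightarrow> Q (s(a := (s a)(aval e s := aval f s)))"
proof
  show "wp X (Assign a e f) Q s \<Longrightarrow> Q (s(a := (s a)(aval e s := aval f s)))"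
    unfolding wp_def by (auto elim: exec.cases)
  show "Q (s(a := (s a)(aval e s := aval f s))) \<Longrightarrow> wp X (Assign a e f) Q s"
    unfolding wp_def by (metis exec_Assign tbound.simps(2) order_refl)
qed

lemma wp_SeqI: "wp X c (wp X c' Q) s \<Longrightarrow> wp X (Seq c c') Q s"
  unfolding wp_def using exec_Seq by fastforce

lemma wp_CondI:
  "(aval b s \<noteq> 0 \<Longrightarrow> wp X c Q s) \<Longrightarrow> (aval b s = 0 \<Longrightarrow> wp X c' Q s) \<Longrightarrow> wp X (Cond b c c') Q s"
proof (cases "aval b s = 0")
  case True
  assume "aval b s = 0 \<Longrightarrow> wp X c' Q s"
  then obtain t s' where "exec c' s t s'" "t \<le> tbound X c'" "Q s'" using True unfolding wp_def by blast
  then show ?thesis unfolding wp_def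
    by (intro exI[of _ "t + 1"] exI[of _ s']) (simp add: exec_Cond_False[OF True, simplified])
next
  case False
  assume "aval b s \<noteq> 0 \<Longrightarrow> wp X c Q s"
  then obtain t s' where "exec c s t s'" "t \<le> tbound X c" "Q s'" using False unfolding wp_def by blast
  then show ?thesis unfolding wp_def
    by (intro exI[of _ "t + 1"] exI[of _ s']) (simp add: exec_Cond_True[OF False, simplified])
qed

text \<open>The variant \<open>V\<close> starts at no more than \<open>X\<close> and drops in every
  round; this justifies the factor \<open>X\<close> in \<open>tbound\<close>.\<close>

lemma wp_WhileI:
  assumes "I s" and "V s \<le> X"
    and body: "\<And>s. I s \<Longrightarrow> aval b s \<noteq> 0 \<Longrightarrow> wp X c (\<lambda>s'. I s' \<and> V s' < V s) s"
    and exit: "\<And>s. I s \<Longrightarrow> aval b s = 0 \<Longrightarrow> Q s"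
  shows "wp X (While b c) Q s"
proof -
  have "\<exists>t s'. exec (While b c) s t s' \<and> t \<le> V s * (tbound X c + 1) + 1 \<and> Q s'"
    using \<open>I s\<close>
  proof (induction "V s" arbitrary: s rule: less_induct)
    case less
    show ?case
    proof (cases "aval b s = 0")
      case True
      then show ?thesis using exec_While_False[OF True] exit[OF less.prems True] by fastforce
    next
      case False
      from body[OF less.prems False] obtain t s' where
        1: "exec c s t s'" "t \<le> tbound X c" "I s'" "V s' < V s"
        unfolding wp_def by blast
      from less.hyps[OF 1(4) 1(3)] obtain t' s'' where
        2: "exec (While b c) s' t' s''" "t' \<le> V s' * (tbound X c + 1) + 1" "Q s''" by blast
      have "t + t' + 1 \<le> (V s' + 1) * (tbound X c + 1) + 1" using 1 2 by simp
      also have "\<dots> \<le> V s * (tbound X c + 1) + 1"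
        using 1(4) by (intro add_right_mono mult_right_mono) auto
      finally show ?thesis using exec_While_True[OF False 1(1) 2(1)] 2(3) by blast
    qed
  qed
  moreover have "V s * (tbound X c + 1) + 1 \<le> tbound X (While b c)"
    using mult_right_mono[OF \<open>V s \<le> X\<close>, of "tbound X c + 1"] by simp
  ultimately show ?thesis unfolding wp_def using order_trans by blast
qed

abbreviation Var :: "nat \<Rightarrow> aexp" where "Var x \<equiv> Get x (Num 0)"
abbreviation Set_var :: "nat \<Rightarrow> aexp \<Rightarrow> com" (infix "::=" 61) where "x ::= e \<equiv> Assign x (Num 0) e"
abbreviation Seq_infix :: "com \<Rightarrow> com \<Rightarrow> com" (infixr ";;" 60) where "c ;; c' \<equiv> Seq c c'"
abbreviation Neq :: "aexp \<Rightarrow> aexp \<Rightarrow> aexp" where "Neq e f \<equiv> Plus (Minus e f) (Minus f e)"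

abbreviation (input) upd :: "memory \<Rightarrow> nat \<Rightarrow> nat \<Rightarrow> memory" where
  "upd s x a \<equiv> s(x := (s x)(0 := a))"

definition For :: "nat \<Rightarrow> aexp \<Rightarrow> com \<Rightarrow> com" where
  "For i e c = (i ::= Num 0 ;; While (Minus e (Var i)) (c ;; i ::= Plus (Var i) (Num 1)))"

lemma writes_For [simp]: "writes (For i e c) = insert i (writes c)"
  by (auto simp: For_def)

lemma wp_WhileI_frame:
  assumes "I s" and "V s \<le> X"
    and body: "\<And>s'. I s' \<Longrightarrow> (\<And>a. a \<notin> writes c \<Longrightarrow> s' a = s a) \<Longrightarrow> aval b s' \<noteq> 0 \<Longrightarrow>
      wp X c (\<lambda>s''. I s'' \<and> V s'' < V s') s'"
    and exit: "\<And>s'. I s' \<Longrightarrow> (\<And>a. a \<notin> writes c \<Longrightarrow> s' a = s a) \<Longrightarrow> aval b s' = 0 \<Longrightarrow> Q s'"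
  shows "wp X (While b c) Q s"
proof (rule wp_WhileI[where I = "\<lambda>s'. I s' \<and> (\<forall>a. a \<notin> writes c \<longrightarrow> s' a = s a)" and V = V])
  fix s' assume 1: "I s' \<and> (\<forall>a. a \<notin> writes c \<longrightarrow> s' a = s a)" and 2: "aval b s' \<noteq> 0"
  show "wp X c (\<lambda>s''. (I s'' \<and> (\<forall>a. a \<notin> writes c \<longrightarrow> s'' a = s a)) \<and> V s'' < V s') s'"
    by (rule wp_frame_mono, rule body) (use 1 2 in auto)
qed (use assms in auto)

lemma wp_AssignI:
  "wp X c Q (s(a := (s a)(aval e s := aval f s))) \<Longrightarrow> wp X (Assign a e f ;; c) Q s"
  by (rule wp_SeqI) simp

text \<open>The counter is incremented only after the body, so the body establishes
  \<open>I (Suc j)\<close> for the state with the counter advanced by hand. The distance to the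
  fixed limit \<open>m\<close> is the variant.\<close>

lemma wp_ForI:
  assumes init: "I 0 (upd s i 0)"
    and bound: "\<And>j s'. I j s' \<Longrightarrow> (\<And>a. a \<noteq> i \<Longrightarrow> a \<notin> writes c \<Longrightarrow> s' a = s a) \<Longrightarrow> aval e s' = m"
    and "m \<le> X"
    and body: "\<And>j s'. j < m \<Longrightarrow> I j s' \<Longrightarrow> s' i 0 = j \<Longrightarrow>
      (\<And>a. a \<noteq> i \<Longrightarrow> a \<notin> writes c \<Longrightarrow> s' a = s a) \<Longrightarrow>
      wp X c (\<lambda>s''. s'' i 0 = j \<and> I (Suc j) (upd s'' i (Suc j))) s'"
    and exit: "\<And>s'. I m s' \<Longrightarrow> (\<And>a. a \<noteq> i \<Longrightarrow> a \<notin> writes c \<Longrightarrow> s' a = s a) \<Longrightarrow> Q s'"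
  shows "wp X (For i e c) Q s"
  unfolding For_def
proof (rule wp_AssignI, unfold aval.simps, rule wp_WhileI_frame[where
    I = "\<lambda>s. s i 0 \<le> m \<and> I (s i 0) s" and V = "\<lambda>s. m - s i 0"])
  let ?s = "upd s i 0"
  show "?s i 0 \<le> m \<and> I (?s i 0) ?s" using init by simp
  show "m - ?s i 0 \<le> X" using \<open>m \<le> X\<close> by simp
next
  fix s' assume 1: "s' i 0 \<le> m \<and> I (s' i 0) s'" and 2: "aval (Minus e (Var i)) s' \<noteq> 0"
    and fr: "\<And>a. a \<notin> writes (c ;; i ::= Plus (Var i) (Num 1)) \<Longrightarrow> s' a = (upd s i 0) a"
  have fr': "a \<noteq> i \<Longrightarrow> a \<notin> writes c \<Longrightarrow> s' a = s a" for a using fr[of a] by simp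
  have "aval e s' = m" by (rule bound[OF conjunct2[OF 1] fr'])
  then have lt: "s' i 0 < m" using 2 by simp
  show "wp X (c ;; i ::= Plus (Var i) (Num 1))
          (\<lambda>s''. (s'' i 0 \<le> m \<and> I (s'' i 0) s'') \<and> m - s'' i 0 < m - s' i 0) s'"
  proof (rule wp_SeqI, rule wp_mono)
    show "wp X c (\<lambda>s''. s'' i 0 = s' i 0 \<and> I (Suc (s' i 0)) (upd s'' i (Suc (s' i 0)))) s'"
      by (rule body[OF lt conjunct2[OF 1] HOL.refl fr'])
  next
    fix t assume t: "t i 0 = s' i 0 \<and> I (Suc (s' i 0)) (upd t i (Suc (s' i 0)))"
    then show "wp X (i ::= Plus (Var i) (Num 1))
          (\<lambda>s''. (s'' i 0 \<le> m \<and> I (s'' i 0) s'') \<and> m - s'' i 0 < m - s' i 0) t"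
      using lt by simp
  qed
next
  fix s' assume 1: "s' i 0 \<le> m \<and> I (s' i 0) s'" and 2: "aval (Minus e (Var i)) s' = 0"
    and fr: "\<And>a. a \<notin> writes (c ;; i ::= Plus (Var i) (Num 1)) \<Longrightarrow> s' a = (upd s i 0) a"
  have fr': "a \<noteq> i \<Longrightarrow> a \<notin> writes c \<Longrightarrow> s' a = s a" for a using fr[of a] by simp
  have "aval e s' = m" by (rule bound[OF conjunct2[OF 1] fr'])
  then have "s' i 0 = m" using 1 2 by simp
  then have "I m s'" using 1 by simp
  then show "Q s'" by (rule exit[OF _ fr'])
qed

text \<open>Turns loop-free code into a condition that simplification can settle; loops stay as
  \<open>wp\<close>, to be treated with an invariant.\<close>

fun vc :: "nat \<Rightarrow> com \<Rightarrow> (memory \<Rightarrow> bool) \<Rightarrow> memory \<Rightarrow> bool" where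
  "vc X Skip Q s = Q s"
| "vc X (Assign a e f) Q s = Q (s(a := (s a)(aval e s := aval f s)))"
| "vc X (Seq c c') Q s = vc X c (vc X c' Q) s"
| "vc X (Cond b c c') Q s = ((aval b s \<noteq> 0 \<longrightarrow> vc X c Q s) \<and> (aval b s = 0 \<longrightarrow> vc X c' Q s))"
| "vc X (While b c) Q s = wp X (While b c) Q s"

lemma vc_wp: "vc X c Q s \<Longrightarrow> wp X c Q s"
proof (induction c arbitrary: Q s)
  case (Seq c c')
  have "wp X c (vc X c' Q) s" using Seq by simp
  then show ?case by (intro wp_SeqI) (erule wp_mono, rule Seq.IH(2))
next
  case (Cond b c c')
  then show ?case by (auto intro!: wp_CondI)
qed simp_all

section \<open>Trees\<close>

definition edges_in :: "'a set set \<Rightarrow> 'a set \<Rightarrow> 'a set set" where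
  "edges_in E W = {e \<in> E. e \<subseteq> W}"

lemma finite_edges:
  assumes "is_tree (S, E)"
  shows "finite S" "finite E"
proof -
  show "finite S" using assms by (simp add: is_tree_def)
  then show "finite E" using assms by (intro finite_subset[of E "Pow S"]) (auto simp: is_tree_def)
qed

text \<open>If all degrees inside \<open>W\<close> were at least 2, a longest path could be
  prolonged at its head or would close a cycle there.\<close>

lemma acyclic_low_degree:
  fixes E :: "'a set set"
  assumes "finite W" "W \<noteq> {}" and card2: "\<And>e. e \<in> E \<Longrightarrow> card e = 2"
    and acyc: "\<nexists>xs. is_cycle E xs"
  shows "\<exists>v\<in>W. card {e \<in> edges_in E W. v \<in> e} \<le> 1"
proof (rule ccontr)
  assume neg: "\<not> ?thesis"
  have deg: "card {e \<in> edges_in E W. v \<in> e} \<ge> 2" if "v \<in> W" for v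
  proof -
    have "\<not> card {e \<in> edges_in E W. v \<in> e} \<le> 1" using neg that by blast
    then show ?thesis by linarith
  qed
  define walk where "walk xs \<longleftrightarrow> xs \<noteq> [] \<and> distinct xs \<and> set xs \<subseteq> W \<and>
    (\<forall>i. Suc i < length xs \<longrightarrow> {xs ! i, xs ! Suc i} \<in> E)" for xs
  obtain w where "w \<in> W" using \<open>W \<noteq> {}\<close> by blast
  then have "walk [w]" by (simp add: walk_def)
  have "length xs < Suc (card W)" if "walk xs" for xs
    using that distinct_card[of xs] card_mono[OF \<open>finite W\<close>, of "set xs"] by (simp add: walk_def)
  then obtain xs where xs: "walk xs" and max: "\<And>ys. walk ys \<Longrightarrow> length ys \<le> length xs"
    using ex_has_greatest_nat[of walk "[w]" length "Suc (card W)"] \<open>walk [w]\<close> by blast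
  have "xs \<noteq> []" "distinct xs" "set xs \<subseteq> W" using xs by (simp_all add: walk_def)
  \<comment> \<open>Any one vertex \<open>y\<close> can be avoided. This matters for a path of a
    single vertex, where \<open>xs ! 1\<close> below is an unspecified value.\<close>
  have nb: "\<exists>u. {x, u} \<in> E \<and> u \<in> W \<and> u \<noteq> x \<and> u \<noteq> y" if "x \<in> W" for x y
  proof -
    have "\<not> {e \<in> edges_in E W. x \<in> e} \<subseteq> {{x, y}}"
      using deg[OF that] card_mono[of "{{x, y}}" "{e \<in> edges_in E W. x \<in> e}"] by auto
    then obtain e where e: "e \<in> E" "e \<subseteq> W" "x \<in> e" "e \<noteq> {x, y}" by (auto simp: edges_in_def)
    obtain p q where pq: "e = {p, q}" "p \<noteq> q" using card2[OF e(1)] unfolding card_2_iff by blast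
    define u where "u = (if x = p then q else p)"
    have "e = {x, u}" "u \<noteq> x" using pq e(3) by (auto simp: u_def)
    then show ?thesis using e by (intro exI[of _ u]) auto
  qed
  let ?x = "hd xs"
  have "?x \<in> W" using xs by (auto simp: walk_def)
  then obtain u where u: "{?x, u} \<in> E" "u \<in> W" "u \<noteq> ?x" "u \<noteq> xs ! 1" using nb by blast
  have "u \<in> set xs"
  proof (rule ccontr)
    assume "u \<notin> set xs"
    have "{(u # xs) ! i, (u # xs) ! Suc i} \<in> E" if "Suc i < length (u # xs)" for i
    proof (cases i)
      case 0
      then show ?thesis using u(1) xs by (simp add: walk_def hd_conv_nth doubleton_eq_iff insert_commute[of u])
    next
      case (Suc i')
      then show ?thesis using that xs by (simp add: walk_def)
    qed
    then have "walk (u # xs)" using \<open>u \<notin> set xs\<close> xs u by (simp add: walk_def)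
    then show False using max[of "u # xs"] by simp
  qed
  then obtain j where j: "j < length xs" "u = xs ! j" by (auto simp: in_set_conv_nth)
  have "j \<noteq> 0" using u(3) j hd_conv_nth[OF \<open>xs \<noteq> []\<close>] by metis
  moreover have "j \<noteq> 1" using u(4) j by auto
  ultimately have j2: "2 \<le> j" by simp
  let ?c = "take (Suc j) xs"
  have len: "length ?c = Suc j" using j by simp
  have "{?c ! i, ?c ! (Suc i mod length ?c)} \<in> E" if "i < length ?c" for i
  proof (cases "i = j")
    case True
    then have "{?c ! i, ?c ! (Suc i mod length ?c)} = {hd xs, u}"
      using j len \<open>xs \<noteq> []\<close> True by (simp add: hd_conv_nth insert_commute)
    then show ?thesis using u(1) by simp
  next
    case False
    then have "Suc i < length ?c" using that len by simp
    moreover from this have "Suc i < length xs" using len j by simp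
    then have "{xs ! i, xs ! Suc i} \<in> E" using xs unfolding walk_def by blast
    ultimately show ?thesis using len by simp
  qed
  then have "is_cycle E ?c" using xs j2 len by (simp add: is_cycle_def walk_def)
  with acyc show False by blast
qed

text \<open>Removing a vertex of degree at most 1 loses at most one edge.\<close>

lemma acyclic_card_edges:
  fixes E :: "'a set set"
  assumes "finite W" "W \<noteq> {}" and card2: "\<And>e. e \<in> E \<Longrightarrow> card e = 2"
    and acyc: "\<nexists>xs. is_cycle E xs"
  shows "Suc (card (edges_in E W)) \<le> card W"
  using assms(1,2)
proof (induction "card W" arbitrary: W rule: less_induct)
  case less
  have fin: "finite (edges_in E W)" if "finite W" for W
    using that by (rule_tac finite_subset[of _ "Pow W"]) (auto simp: edges_in_def)
  obtain v where v: "v \<in> W" "card {e \<in> edges_in E W. v \<in> e} \<le> 1"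
    using acyclic_low_degree[OF less.prems card2 acyc] by blast
  have split: "edges_in E W = edges_in E (W - {v}) \<union> {e \<in> edges_in E W. v \<in> e}"
    by (auto simp: edges_in_def)
  have le: "card (edges_in E W) \<le> card (edges_in E (W - {v})) + 1"
    using v(2) card_Un_le[of "edges_in E (W - {v})" "{e \<in> edges_in E W. v \<in> e}"]
    unfolding split[symmetric] by linarith
  show ?case
  proof (cases "W = {v}")
    case True
    then have "edges_in E W = {}"
      using card2[of "{}"] card2[of "{v}"] by (auto simp: edges_in_def subset_singleton_iff)
    then show ?thesis using True by (simp add: card_insert_if)
  next
    case False
    then have "W - {v} \<noteq> {}" using v(1) by auto
    moreover have "card (W - {v}) < card W" using card_Diff1_less[OF less.prems(1) v(1)] .
    ultimately have "Suc (card (edges_in E (W - {v}))) \<le> card (W - {v})"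
      using less.hyps[of "W - {v}"] less.prems(1) by blast
    moreover have "Suc (card (W - {v})) = card W" using card_Suc_Diff1[OF less.prems(1) v(1)] .
    ultimately show ?thesis using le by linarith
  qed
qed

lemma rtrancl_leaves:
  assumes "(a, b) \<in> r\<^sup>*" "a \<in> W" "b \<notin> W"
  shows "\<exists>x y. (x, y) \<in> r \<and> x \<in> W \<and> y \<notin> W"
  using assms by (induction rule: rtrancl_induct) auto

text \<open>A vertex set grown from one vertex along edges that leave it gains an edge with every
  new vertex.\<close>

lemma connected_card_edges:
  assumes tree: "is_tree (S, E)"
  shows "card S \<le> Suc (card E)"
proof -
  have fin: "finite S" and finE: "finite E" using finite_edges[OF tree] by auto
  obtain r where r: "r \<in> S" using tree by (auto simp: is_tree_def)
  have "m < card S \<Longrightarrow> \<exists>W. W \<subseteq> S \<and> card W = Suc m \<and> m \<le> card (edges_in E W)" for m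
  proof (induction m)
    case 0
    show ?case using r by (intro exI[of _ "{r}"]) simp
  next
    case (Suc m)
    then obtain W where W: "W \<subseteq> S" "card W = Suc m" "m \<le> card (edges_in E W)" by auto
    then have finW: "finite W" using fin finite_subset by blast
    obtain a where a: "a \<in> W" using W(2) by fastforce
    obtain b where b: "b \<in> S" "b \<notin> W"
      using W(1,2) Suc.prems by (metis nat_neq_iff subset_antisym subsetI)
    have "(a, b) \<in> {(x, y). {x, y} \<in> E}\<^sup>*"
      using tree a b W(1) by (auto simp: is_tree_def)
    then obtain x y where xy: "{x, y} \<in> E" "x \<in> W" "y \<notin> W"
      using rtrancl_leaves[of a b _ W] a b by blast
    have "y \<in> S" using xy(1) tree by (auto simp: is_tree_def)
    have "insert {x, y} (edges_in E W) \<subseteq> edges_in E (insert y W)"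
      using xy by (auto simp: edges_in_def)
    then have "card (insert {x, y} (edges_in E W)) \<le> card (edges_in E (insert y W))"
      using finE by (intro card_mono) (auto simp: edges_in_def)
    moreover have "card (insert {x, y} (edges_in E W)) = Suc (card (edges_in E W))"
      using finE xy by (intro card_insert_disjoint) (auto simp: edges_in_def)
    ultimately show ?case
      using W finW xy \<open>y \<in> S\<close> by (intro exI[of _ "insert y W"]) auto
  qed
  moreover have "card S > 0" using fin r by (auto simp: card_gt_0_iff)
  ultimately obtain W where "card S - 1 \<le> card (edges_in E W)"
    using diff_less[OF zero_less_one] by meson
  also have "\<dots> \<le> card E" using finE by (intro card_mono) (auto simp: edges_in_def)
  finally show ?thesis by simp
qed

section \<open>Paths as trees\<close>

definition path_edges :: "'a list \<Rightarrow> ('a \<times> 'a) list" where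
  "path_edges xs = zip xs (tl xs)"

lemma path_edges_Cons [simp]:
  "path_edges [] = []" "path_edges [a] = []"
  "path_edges (a # b # xs) = (a, b) # path_edges (b # xs)"
  by (simp_all add: path_edges_def)

lemma set_path_edges: "set (path_edges xs) = {(xs ! i, xs ! Suc i) | i. Suc i < length xs}"
proof -
  have "i < min (length xs) (length (tl xs)) \<longleftrightarrow> Suc i < length xs" for i by auto
  then show ?thesis by (auto simp: path_edges_def set_zip nth_tl)
qed

text \<open>For acyclicity, take the vertex of a supposed cycle that comes first on the path: both
  its neighbours on the cycle must be its successor on the path, but in a cycle of length at least 3
  they differ.\<close>

lemma path_is_tree:
  assumes "xs \<noteq> []" "distinct xs"
  shows "is_tree (tree_of (xs, path_edges xs))"
proof -
  let ?E = "(\<lambda>(u, v). {u, v}) ` set (path_edges xs)"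
  have E: "?E = {{xs ! i, xs ! Suc i} | i. Suc i < length xs}"
    by (auto simp: set_path_edges)
  let ?r = "{(x, y). {x, y} \<in> ?E}"
  have "sym ?r" by (auto intro!: symI simp: insert_commute)
  have from_hd: "(xs ! 0, xs ! i) \<in> ?r\<^sup>*" if "i < length xs" for i
    using that
  proof (induction i)
    case (Suc i)
    then have "(xs ! i, xs ! Suc i) \<in> ?r" unfolding E by blast
    with Suc show ?case by (meson Suc_lessD rtrancl.rtrancl_into_rtrancl)
  qed simp
  have conn: "(u, v) \<in> ?r\<^sup>*" if "u \<in> set xs" "v \<in> set xs" for u v
  proof -
    have "(xs ! 0, u) \<in> ?r\<^sup>*" "(xs ! 0, v) \<in> ?r\<^sup>*"
      using that from_hd by (auto simp: in_set_conv_nth)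
    then show ?thesis using sym_rtrancl[OF \<open>sym ?r\<close>] by (meson rtrancl_trans symD)
  qed
  have sub: "?E \<subseteq> {e. e \<subseteq> set xs \<and> card e = 2}"
    unfolding E using \<open>distinct xs\<close> by (auto simp: card_insert_if nth_eq_iff_index_eq)
  have "\<not> is_cycle ?E ys" for ys
  proof
    assume c: "is_cycle ?E ys"
    let ?m = "length ys"
    have m3: "3 \<le> ?m" and dys: "distinct ys" using c by (auto simp: is_cycle_def)
    have adj: "\<exists>p. (ys ! i = xs ! p \<and> ys ! (Suc i mod ?m) = xs ! Suc p \<or>
        ys ! i = xs ! Suc p \<and> ys ! (Suc i mod ?m) = xs ! p) \<and> Suc p < length xs"
      if "i < ?m" for i
    proof -
      have "{ys ! i, ys ! (Suc i mod ?m)} \<in> ?E" using c that by (simp add: is_cycle_def)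
      then obtain p where "{ys ! i, ys ! (Suc i mod ?m)} = {xs ! p, xs ! Suc p}" "Suc p < length xs"
        unfolding E by blast
      then show ?thesis unfolding doubleton_eq_iff by blast
    qed
    have inxs: "ys ! i \<in> set xs" if "i < ?m" for i
      using adj[OF that] by (auto simp: Suc_lessD)
    define pos where "pos i = (THE p. p < length xs \<and> xs ! p = ys ! i)" for i
    have pos_eq: "pos i = p" if "p < length xs" "xs ! p = ys ! i" for i p
      unfolding pos_def using that \<open>distinct xs\<close>
      by (intro the_equality) (simp, metis nth_eq_iff_index_eq)
    have xpos: "pos i < length xs \<and> xs ! pos i = ys ! i" if "i < ?m" for i
      using inxs[OF that] pos_eq unfolding in_set_conv_nth by blast
    have step: "pos (Suc i mod ?m) = Suc (pos i) \<or> pos i = Suc (pos (Suc i mod ?m))"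
      if i: "i < ?m" for i
    proof -
      obtain p where p: "ys ! i = xs ! p \<and> ys ! (Suc i mod ?m) = xs ! Suc p \<or>
        ys ! i = xs ! Suc p \<and> ys ! (Suc i mod ?m) = xs ! p" "Suc p < length xs"
        using adj[OF i] by blast
      from p(1) show ?thesis
        by (elim disjE conjE) (use p(2) pos_eq[of p] pos_eq[of "Suc p"] in simp_all)
    qed
    have inj: "pos i = pos j \<Longrightarrow> i < ?m \<Longrightarrow> j < ?m \<Longrightarrow> i = j" for i j
      using xpos dys by (metis nth_eq_iff_index_eq)
    obtain i where i: "i < ?m" "\<And>j. j < ?m \<Longrightarrow> pos i \<le> pos j"
      using ex_has_least_nat[of "\<lambda>i. i < ?m" 0 pos] m3 by force
    let ?i' = "(if i = 0 then ?m - 1 else i - 1)"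
    have i': "?i' < ?m" "Suc ?i' mod ?m = i" using i(1) m3 by auto
    have i'': "Suc i mod ?m < ?m" using m3 by (intro mod_less_divisor) linarith
    have "pos (Suc i mod ?m) = Suc (pos i)"
      using step[OF i(1)] i(2)[OF i''] by linarith
    moreover have "pos ?i' = Suc (pos i)"
      using step[OF i'(1)] i(2)[OF i'(1)] i'(2) by (metis Suc_n_not_le_n)
    ultimately have "Suc i mod ?m = ?i'" using inj[OF _ i'' i'(1)] by simp
    then show False using i(1) m3 
    proof (cases "Suc i = ?m")
      case True
      then have "?i' = 0" using \<open>Suc i mod ?m = ?i'\<close> by simp
      then show False using True m3 by (simp split: if_splits)
    next
      case False
      then have "Suc i mod ?m = Suc i" using i(1) by simp
      then have "?i' = Suc i" using \<open>Suc i mod ?m = ?i'\<close> by linarith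
      then show False using False m3 by (simp split: if_splits)
    qed
  qed
  then show ?thesis using assms conn sub by (simp add: is_tree_def tree_of_def)
qed

section \<open>Kruskal stages\<close>

text \<open>\<open>map f xs = rotate1 xs\<close> says that \<open>f\<close> sends each entry to the
  cyclically next one. Having \<open>u\<close> at the end prepares the splice in
  \<open>cycle_swap\<close>.\<close>

lemma cycle_rotate_to_last:
  assumes "map f xs = rotate1 xs" "distinct xs" "u \<in> set xs"
  shows "\<exists>ys. map f (ys @ [u]) = rotate1 (ys @ [u]) \<and> distinct (ys @ [u]) \<and> set (ys @ [u]) = set xs"
proof -
  obtain as bs where xs: "xs = as @ u # bs" using assms(3) by (meson split_list)
  let ?m = "Suc (length as)"
  have eq: "rotate ?m xs = bs @ as @ [u]"
    using rotate_append[of "as @ [u]" bs] by (simp add: xs)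
  have "map f (rotate ?m xs) = rotate1 (rotate ?m xs)"
    by (simp only: rotate_map[symmetric] assms(1) rotate1_rotate_swap)
  then show ?thesis
    using assms(2) eq by (intro exI[of _ "bs @ as"]) (auto simp: xs)
qed

text \<open>After the exchange \<open>u\<close> points to the head of the second list and
  \<open>v\<close> to the head of the first, so plain concatenation is the joint cycle.\<close>

lemma cycle_swap:
  assumes "map f (xs @ [u]) = rotate1 (xs @ [u])" "map f (ys @ [v]) = rotate1 (ys @ [v])"
    and "distinct (xs @ [u] @ ys @ [v])"
  shows "map (f(u := f v, v := f u)) (xs @ [u] @ ys @ [v]) = rotate1 (xs @ [u] @ ys @ [v])"
proof -
  have *: "map f zs @ [f w] = tl (zs @ [w]) @ [hd (zs @ [w])]"
    if "map f (zs @ [w]) = rotate1 (zs @ [w])" for zs w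
    using that by (cases zs) auto
  have 1: "map f xs = tl (xs @ [u])" "f u = hd (xs @ [u])" using *[OF assms(1)] by auto
  have 2: "map f ys = tl (ys @ [v])" "f v = hd (ys @ [v])" using *[OF assms(2)] by auto
  have 3: "map (f(u := f v, v := f u)) xs = map f xs" "map (f(u := f v, v := f u)) ys = map f ys"
    using assms(3) by auto
  have "map (f(u := f v, v := f u)) (xs @ [u] @ ys @ [v]) = map f xs @ [f v] @ map f ys @ [f u]"
    using 3 assms(3) by simp
  also have "\<dots> = tl (xs @ [u]) @ (ys @ [v]) @ [hd (xs @ [u])]"
    unfolding 1 2 by (cases ys) simp_all
  also have "\<dots> = rotate1 (xs @ [u] @ ys @ [v])" by (cases xs) simp_all
  finally show ?thesis .
qed

lemma cycle_nth:
  assumes "map f xs = rotate1 xs" "i < length xs" "xs = c # zs"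
  shows "xs ! i = (f ^^ i) c"
  using assms(2)
proof (induction i)
  case (Suc i)
  have "f (xs ! i) = (map f xs) ! i" using Suc.prems by simp
  also have "\<dots> = (zs @ [c]) ! i" using assms(1,3) by simp
  also have "\<dots> = xs ! Suc i" using Suc.prems assms(3) by (simp add: nth_append)
  finally show ?case using Suc by simp
qed (simp add: assms(3))

abbreviation edge_weight :: "(nat \<Rightarrow> nat \<Rightarrow> real) \<Rightarrow> nat set \<Rightarrow> real" where
  "edge_weight d e \<equiv> d (Min e) (Max e)"

definition path_weight :: "(nat \<Rightarrow> nat \<Rightarrow> 'a::comm_monoid_add) \<Rightarrow> nat list \<Rightarrow> 'a" where
  "path_weight d xs = (\<Sum>(u, v)\<leftarrow>path_edges xs. d u v)"

definition label_class :: "nat \<Rightarrow> (nat \<Rightarrow> nat) \<Rightarrow> nat \<Rightarrow> nat set" where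
  "label_class n lab c = {v. v < n \<and> lab v = c}"

definition roots :: "nat \<Rightarrow> (nat \<Rightarrow> nat) \<Rightarrow> nat set" where
  "roots n lab = {c. c < n \<and> lab c = c}"

lemma finite_label_class [simp]: "finite (label_class n lab c)"
  by (simp add: label_class_def)

lemma finite_roots [simp]: "finite (roots n lab)"
  by (simp add: roots_def)

locale weights =
  fixes n :: nat and d :: "nat \<Rightarrow> nat \<Rightarrow> real"
  assumes nonneg: "u < n \<Longrightarrow> v < n \<Longrightarrow> 0 \<le> d u v"
    and sym: "u < n \<Longrightarrow> v < n \<Longrightarrow> d u v = d v u"
    and self: "u < n \<Longrightarrow> d u u = 0"
    and triangle: "u < n \<Longrightarrow> v < n \<Longrightarrow> z < n \<Longrightarrow> d u z \<le> d u v + d v z"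
begin

text \<open>A stage of Kruskal's algorithm: \<open>lab\<close> names the component of a vertex by a root,
  \<open>nx\<close> arranges every component in a cycle, \<open>x\<close> is the weight of the Kruskal tree of a component
  and \<open>w\<close> the weight of the latest edge.  Exchanging the successors of the endpoints of the new edge
  splices two cycles into one.\<close>

inductive kruskal :: "(nat \<Rightarrow> nat) \<Rightarrow> (nat \<Rightarrow> nat) \<Rightarrow> (nat \<Rightarrow> real) \<Rightarrow> real \<Rightarrow> bool" where
  start: "\<forall>v<n. lab v = v \<and> nx v = v \<Longrightarrow> kruskal lab nx (\<lambda>_. 0) 0"
| merge: "kruskal lab nx x w \<Longrightarrow> u < n \<Longrightarrow> v < n \<Longrightarrow> lab u \<noteq> lab v \<Longrightarrow>
    \<forall>u'<n. \<forall>v'<n. lab u' \<noteq> lab v' \<longrightarrow> d u v \<le> d u' v' \<Longrightarrow>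
    \<forall>z<n. lab' z = (if lab z = lab v then lab u else lab z) \<Longrightarrow>
    \<forall>z<n. nx' z = (nx(u := nx v, v := nx u)) z \<Longrightarrow>
    kruskal lab' nx' (x(lab u := x (lab u) + x (lab v) + d u v)) (d u v)"

lemma kruskal_label:
  "kruskal lab nx x w \<Longrightarrow> v < n \<Longrightarrow> lab v \<in> roots n lab"
proof (induction arbitrary: v rule: kruskal.induct)
  case (start lab nx)
  then show ?case by (simp add: roots_def)
next
  case (merge lab nx x w u v lab' nx')
  then show ?case by (fastforce simp: roots_def)
qed

text \<open>A pair that is separated after a merge was separated before it, and the merged pair was
  a closest one.\<close>

lemma kruskal_cross:
  "kruskal lab nx x w \<Longrightarrow> a < n \<Longrightarrow> b < n \<Longrightarrow> lab a \<noteq> lab b \<Longrightarrow> w \<le> d a b"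
proof (induction arbitrary: a b rule: kruskal.induct)
  case (start lab nx)
  then show ?case using nonneg by simp
next
  case (merge lab nx x w u v lab' nx')
  then show ?case by metis
qed

lemma roots_merge:
  assumes "kruskal lab nx x w" "u < n" "v < n" "lab u \<noteq> lab v"
    and "\<forall>z<n. lab' z = (if lab z = lab v then lab u else lab z)"
  shows "roots n lab' = roots n lab - {lab v}"
proof -
  have "lab u \<in> roots n lab" "lab v \<in> roots n lab"
    using assms kruskal_label by blast+
  then show ?thesis using assms(4,5) by (auto simp: roots_def split: if_splits)
qed

lemma label_class_merge:
  assumes "\<forall>z<n. lab' z = (if lab z = lab v then lab u else lab z)" "lab u \<noteq> lab v"
  shows "label_class n lab' (lab u) = label_class n lab (lab u) \<union> label_class n lab (lab v)"
    and "c \<noteq> lab u \<Longrightarrow> c \<noteq> lab v \<Longrightarrow> label_class n lab' c = label_class n lab c"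
  using assms by (auto simp: label_class_def)

lemma kruskal_cycle:
  "kruskal lab nx x w \<Longrightarrow> c \<in> roots n lab \<Longrightarrow>
    \<exists>xs. distinct xs \<and> set xs = label_class n lab c \<and> map nx xs = rotate1 xs"
proof (induction arbitrary: c rule: kruskal.induct)
  case (start lab nx)
  then have "label_class n lab c = {c}" by (auto simp: label_class_def roots_def)
  moreover have "nx c = c" using start by (simp add: roots_def)
  ultimately show ?case by (intro exI[of _ "[c]"]) simp
next
  case (merge lab nx x w u v lab' nx')
  note cls = label_class_merge[OF merge.hyps(6,4)]
  have rts: "roots n lab' = roots n lab - {lab v}"
    using roots_merge[OF merge.hyps(1-4,6)] .
  have uv: "u \<in> label_class n lab (lab u)" "v \<in> label_class n lab (lab v)"
    using merge.hyps by (auto simp: label_class_def)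
  show ?case
  proof (cases "c = lab u")
    case True
    obtain xs where xs: "distinct xs" "set xs = label_class n lab (lab u)" "map nx xs = rotate1 xs"
      using merge.IH[OF kruskal_label[OF merge.hyps(1,2)]] by metis
    obtain ys where ys: "distinct ys" "set ys = label_class n lab (lab v)" "map nx ys = rotate1 ys"
      using merge.IH[OF kruskal_label[OF merge.hyps(1,3)]] by metis
    obtain xs' where xs': "map nx (xs' @ [u]) = rotate1 (xs' @ [u])" "distinct (xs' @ [u])" "set (xs' @ [u]) = set xs"
      using cycle_rotate_to_last[OF xs(3,1), of u] uv(1) unfolding xs(2) by metis
    obtain ys' where ys': "map nx (ys' @ [v]) = rotate1 (ys' @ [v])" "distinct (ys' @ [v])" "set (ys' @ [v]) = set ys"
      using cycle_rotate_to_last[OF ys(3,1), of v] uv(2) unfolding ys(2) by metis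
    let ?zs = "xs' @ [u] @ ys' @ [v]"
    have disj: "set (xs' @ [u]) \<inter> set (ys' @ [v]) = {}"
      unfolding xs'(3) ys'(3) xs(2) ys(2) using merge.hyps(4) by (auto simp: label_class_def)
    then have dist: "distinct ?zs" using xs'(2) ys'(2) by auto
    have set: "set ?zs = label_class n lab' c"
      using xs'(3) ys'(3) unfolding True cls(1) xs(2) ys(2) by auto
    have "map nx' ?zs = map (nx(u := nx v, v := nx u)) ?zs"
      using merge.hyps(7) set by (intro map_cong refl) (auto simp: label_class_def)
    also have "\<dots> = rotate1 ?zs" by (rule cycle_swap[OF xs'(1) ys'(1) dist])
    finally show ?thesis using dist set by blast
  next
    case False
    then have c: "c \<noteq> lab v" "c \<in> roots n lab" using merge.prems rts by auto
    then obtain xs where xs: "distinct xs" "set xs = label_class n lab c" "map nx xs = rotate1 xs"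
      using merge.IH[OF c(2)] by metis
    have "map nx' xs = map nx xs"
      using merge.hyps(7) xs(2) c(1) False by (intro map_cong refl) (auto simp: label_class_def)
    then show ?thesis using xs unfolding cls(2)[OF False c(1)] by auto
  qed
qed

lemma kruskal_nx:
  assumes "kruskal lab nx x w" "v < n"
  shows "nx v < n" "lab (nx v) = lab v"
proof -
  obtain xs where xs: "set xs = label_class n lab (lab v)" "map nx xs = rotate1 xs"
    using kruskal_cycle[OF assms(1) kruskal_label[OF assms]] by blast
  have "v \<in> set xs" using xs(1) assms(2) by (simp add: label_class_def)
  then have "nx v \<in> set (map nx xs)" by simp
  then have "nx v \<in> label_class n lab (lab v)" using xs by simp
  then show "nx v < n" "lab (nx v) = lab v" by (simp_all add: label_class_def)
qed

text \<open>The splice exchanges two edges of the cycles. By the triangle inequality this adds at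
  most \<open>2 * d u v\<close>, which is the growth of \<open>2 * x\<close>.\<close>

lemma kruskal_cycle_weight:
  "kruskal lab nx x w \<Longrightarrow> c \<in> roots n lab \<Longrightarrow>
    (\<Sum>v\<in>label_class n lab c. d v (nx v)) \<le> 2 * x c"
proof (induction arbitrary: c rule: kruskal.induct)
  case (start lab nx)
  then have "label_class n lab c = {c}" by (auto simp: label_class_def roots_def)
  then show ?case using start self by (simp add: roots_def)
next
  case (merge lab nx x w u v lab' nx')
  note cls = label_class_merge[OF merge.hyps(6,4)]
  have rts: "roots n lab' = roots n lab - {lab v}" using roots_merge merge.hyps by blast
  let ?A = "label_class n lab (lab u)" and ?B = "label_class n lab (lab v)"
  let ?g = "\<lambda>z. d z (nx z)" and ?g' = "\<lambda>z. d z (nx' z)"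
  show ?case
  proof (cases "c = lab u")
    case True
    have u: "u \<in> ?A" and v: "v \<in> ?B" using merge.hyps by (auto simp: label_class_def)
    have disj: "?A \<inter> ?B = {}" using merge.hyps(4) by (auto simp: label_class_def)
    have A: "sum ?g' ?A = sum ?g ?A - d u (nx u) + d u (nx v)"
    proof -
      have "sum ?g' (?A - {u}) = sum ?g (?A - {u})"
        using merge.hyps(4,7) by (intro sum.cong refl) (auto simp: label_class_def)
      then show ?thesis using merge.hyps(2,4,7) u
        by (subst (1 2) sum.remove[OF finite_label_class u]) auto
    qed
    have B: "sum ?g' ?B = sum ?g ?B - d v (nx v) + d v (nx u)"
    proof -
      have "sum ?g' (?B - {v}) = sum ?g (?B - {v})"
        using merge.hyps(4,7) by (intro sum.cong refl) (auto simp: label_class_def)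
      then show ?thesis using merge.hyps(3,7) v
        by (subst (1 2) sum.remove[OF finite_label_class v]) auto
    qed
    have nx: "nx u < n" "nx v < n" using kruskal_nx merge.hyps by auto
    have "d u (nx v) \<le> d u v + d v (nx v)" "d v (nx u) \<le> d u v + d u (nx u)"
      using triangle[of u v "nx v"] triangle[of v u "nx u"] sym[of u v] merge.hyps nx by auto
    moreover have "sum ?g ?A \<le> 2 * x (lab u)" "sum ?g ?B \<le> 2 * x (lab v)"
      using merge.IH kruskal_label merge.hyps(1-3) by blast+
    moreover have "sum ?g' (?A \<union> ?B) = sum ?g' ?A + sum ?g' ?B"
      using disj by (intro sum.union_disjoint) auto
    ultimately show ?thesis using A B True cls(1) by simp
  next
    case False
    then have c: "c \<noteq> lab v" "c \<in> roots n lab" using merge.prems rts by auto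
    have "(\<Sum>z\<in>label_class n lab c. d z (nx' z)) = (\<Sum>z\<in>label_class n lab c. d z (nx z))"
      using merge.hyps(7) c(1) False by (intro sum.cong refl) (auto simp: label_class_def)
    then show ?thesis using cls(2)[OF False c(1)] merge.IH[OF c(2)] False by simp
  qed
qed

lemma kruskal_x_nonneg: "kruskal lab nx x w \<Longrightarrow> 0 \<le> x c"
  by (induction arbitrary: c rule: kruskal.induct) (auto simp: nonneg)

end

section \<open>Comparison with an arbitrary cover\<close>

text \<open>Reduces a power sum to the total and the maximum of its terms.\<close>

lemma powr_le_scaled:
  fixes t M p :: real
  assumes "0 \<le> t" "t \<le> M" "1 \<le> p"
  shows "t powr p \<le> t * M powr (p - 1)"
proof (cases "t = 0")
  case False
  then have "t powr p = t * t powr (p - 1)"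
    using assms by (simp add: powr_diff)
  also have "\<dots> \<le> t * M powr (p - 1)"
    using assms by (intro mult_left_mono powr_mono2) auto
  finally show ?thesis .
qed simp

lemma distinct_concat_disjoint:
  "distinct (concat ps) \<Longrightarrow> a < length ps \<Longrightarrow> b < length ps \<Longrightarrow> a \<noteq> b \<Longrightarrow>
    set (ps ! a) \<inter> set (ps ! b) = {}"
proof (induction ps arbitrary: a b)
  case (Cons xs ps)
  have *: "set xs \<inter> set (ps ! i) = {}" if "i < length ps" for i
    using Cons.prems(1) nth_mem[OF that] by auto
  show ?case
  proof (cases a)
    case 0
    then show ?thesis using * Cons.prems by (cases b) auto
  next
    case (Suc a')
    then show ?thesis using *[of a'] Cons by (cases b) auto
  qed
qed simp

text \<open>The charging inequality for one component, in units of \<open>R\<close>: \<open>x\<close> is the weight of its Kruskal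
  tree, \<open>n\<close> its quota of output paths, \<open>m\<close> the number of pieces of optimal trees in it, \<open>s\<close> the
  number of those that come from trees lighter than \<open>2/3\<close>, and \<open>z\<close> the weight of the others.\<close>

lemma component_charge:
  fixes x z R :: real and n m s :: int
  assumes "0 < R" "1 \<le> n" "1 \<le> m" "0 \<le> s" "s \<le> m" "0 \<le> z"
    and "3 * R * (n - 1) \<le> x" and "x + R \<le> z + 2 / 3 * R * s + R * m"
    and "\<not> (n = 1 \<and> m = 1 \<and> s = 1)"
  shows "2 / 9 * x \<le> z + R * (m - n)"
proof -
  define x' z' where "x' = x / R" and "z' = z / R"
  have x: "x = R * x'" and z: "z = R * z'" using \<open>0 < R\<close> by (auto simp: x'_def z'_def)
  have 1: "3 * (n - 1) \<le> x'"
    using assms(1,7) unfolding x by (simp add: mult.commute mult.left_commute)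
  have "R * (x' + 1) \<le> R * (z' + 2 / 3 * s + m)"
    using assms(8) unfolding x z by (simp add: algebra_simps)
  then have 2: "x' + 1 \<le> z' + 2 / 3 * s + m" using \<open>0 < R\<close> by simp
  have 3: "0 \<le> z'" using assms(1,6) by (simp add: z'_def)
  have "2 / 9 * x' \<le> z' + (m - n)"
  proof -
    \<comment> \<open>For \<open>n \<ge> 4\<close> the bounds combine linearly:
      \<open>s \<le> m\<close> gives \<open>z' + m \<ge> 3 / 5 * (x' + 1)\<close>, and
      \<open>x' \<ge> 3 * (n - 1)\<close> does the rest. Smaller \<open>n\<close> need that
      \<open>m\<close> is an integer. Equality occurs, for instance at \<open>n = m = s = 2\<close>,
      \<open>x' = 3\<close>, \<open>z' = 2 / 3\<close>.\<close>
    consider "4 \<le> n" | "n = 1" | "n = 2" | "n = 3" using assms(2) by linarith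
    then show ?thesis
    proof cases
      case 2
      consider "m = 1" | "2 \<le> m" using assms by linarith
      then show ?thesis
        by cases (use 2 1 \<open>x' + 1 \<le> _\<close> 3 assms in auto)
    next
      case 3
      consider "m = 1" | "m = 2" | "3 \<le> m" using assms by linarith
      then show ?thesis
        by cases (use 3 1 \<open>x' + 1 \<le> _\<close> \<open>0 \<le> z'\<close> assms in auto)
    next
      case 4
      consider "m = 1" | "m = 2" | "m = 3" | "m = 4" | "5 \<le> m" using assms by linarith
      then show ?thesis
        by cases (use 4 1 \<open>x' + 1 \<le> _\<close> \<open>0 \<le> z'\<close> assms in auto)
    qed (use 1 2 3 assms in auto)
  qed
  then have "R * (2 / 9 * x') \<le> R * (z' + (m - n))" using \<open>0 < R\<close> by (intro mult_left_mono) auto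
  then show ?thesis unfolding x z by (simp add: algebra_simps)
qed


text \<open>Euler's formula: in a forest, vertices minus edges is the number of connected
  components, here of the part of \<open>T\<close> inside \<open>C\<close>.\<close>

definition pieces :: "nat set \<times> nat set set \<Rightarrow> nat set \<Rightarrow> int" where
  "pieces T C = int (card (fst T \<inter> C)) - int (card (edges_in (snd T) C))"

definition weight_in :: "(nat \<Rightarrow> nat \<Rightarrow> real) \<Rightarrow> nat set \<times> nat set set \<Rightarrow> nat set \<Rightarrow> real" where
  "weight_in d T C = (\<Sum>e\<in>edges_in (snd T) C. edge_weight d e)"

lemma tree_edge:
  assumes "is_tree T" "e \<in> snd T"
  shows "e \<subseteq> fst T" "card e = 2" "Min e \<in> e" "Max e \<in> e" "Min e \<noteq> Max e"
proof -
  obtain S E where T: "T = (S, E)" by (cases T)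
  show "e \<subseteq> fst T" and 2: "card e = 2" using assms by (auto simp: T is_tree_def)
  then have "finite e" "e \<noteq> {}" by (auto simp: card_gt_0_iff intro: ccontr)
  then show "Min e \<in> e" "Max e \<in> e" by auto
  obtain a b where "e = {a, b}" "a \<noteq> b" using 2 by (auto simp: card_2_iff)
  then show "Min e \<noteq> Max e" by (auto simp: min_def max_def)
qed

text \<open>The part of a tree inside \<open>C\<close> is a forest on the vertices that the tree has
  there, so \<open>acyclic_card_edges\<close> applies.\<close>

lemma pieces_nonneg:
  assumes "is_tree T"
  shows "0 \<le> pieces T C" and "fst T \<inter> C \<noteq> {} \<Longrightarrow> 1 \<le> pieces T C"
    and "fst T \<inter> C = {} \<Longrightarrow> edges_in (snd T) C = {}"
proof -
  obtain S E where T: "T = (S, E)" by (cases T)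
  have tr: "finite S" "\<And>e. e \<in> E \<Longrightarrow> card e = 2" "\<nexists>xs. is_cycle E xs" "\<And>e. e \<in> E \<Longrightarrow> e \<subseteq> S"
    using assms by (auto simp: T is_tree_def)
  have eq: "edges_in E C = edges_in E (S \<inter> C)" using tr(4) by (auto simp: edges_in_def)
  show 1: "edges_in (snd T) C = {}" if "fst T \<inter> C = {}"
  proof -
    have "e \<noteq> {}" if "e \<in> E" for e using tr(2)[OF that] by auto
    then show ?thesis using that unfolding T snd_conv eq by (auto simp: T edges_in_def)
  qed
  show 2: "1 \<le> pieces T C" if "fst T \<inter> C \<noteq> {}"
    using acyclic_card_edges[of "S \<inter> C" E] tr that by (simp add: T pieces_def eq)
  show "0 \<le> pieces T C" using 1 2 by (cases "fst T \<inter> C = {}") (auto simp: pieces_def)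
qed

lemma finite_edges_in: "is_tree T \<Longrightarrow> finite (edges_in (snd T) C)"
  using finite_edges[of "fst T" "snd T"] by (simp add: edges_in_def)

lemma tree_weight_alt: "tree_weight d T = (\<Sum>e\<in>snd T. edge_weight d e)"
  by (simp add: tree_weight_def)

locale weighted_cover = weights +
  fixes k :: nat and Us :: "(nat set \<times> nat set set) list"
  assumes length_Us: "length Us = k" and cover: "tree_cover {..<n} (set Us)"
begin

lemma tree: "i < k \<Longrightarrow> is_tree (Us ! i)" "i < k \<Longrightarrow> fst (Us ! i) \<subseteq> {..<n}"
  using length_Us cover by (auto simp: tree_cover_def)

lemma covered: "v < n \<Longrightarrow> \<exists>i<k. v \<in> fst (Us ! i)"
proof -
  assume "v < n"
  then have "v \<in> (\<Union>T\<in>set Us. fst T)" using cover by (simp add: tree_cover_def)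
  then show ?thesis using length_Us by (metis UN_E in_set_conv_nth)
qed

lemma edge_weight_nonneg: "i < k \<Longrightarrow> e \<in> snd (Us ! i) \<Longrightarrow> 0 \<le> edge_weight d e"
  using tree_edge[OF tree(1)] tree(2) by (intro nonneg) (meson lessThan_iff subsetD)+

text \<open>Joining all pieces inside \<open>C\<close> by edges of weight at most \<open>R\<close> gives a connected graph on \<open>C\<close>
  of weight at most \<open>span_bound R C - R\<close>.\<close>

definition span_bound :: "real \<Rightarrow> nat set \<Rightarrow> real" where
  "span_bound R C = (\<Sum>i<k. R * pieces (Us ! i) C + weight_in d (Us ! i) C)"

text \<open>The vertex \<open>v\<close> is covered, so at least one piece meets \<open>C\<close>,
  and every piece is charged the increase of \<open>R\<close>.\<close>

lemma span_bound_mono: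
  assumes "v \<in> C" "v < n" "R \<le> R'"
  shows "span_bound R C + (R' - R) \<le> span_bound R' C"
proof -
  obtain j where j: "j < k" "v \<in> fst (Us ! j)" using covered[OF assms(2)] by blast
  have "1 \<le> pieces (Us ! j) C" using pieces_nonneg(2)[OF tree(1)[OF j(1)]] j assms by blast
  also have "\<dots> \<le> (\<Sum>i<k. pieces (Us ! i) C)"
    using j(1) pieces_nonneg(1)[OF tree(1)] by (intro member_le_sum) auto
  finally have "1 \<le> real_of_int (\<Sum>i<k. pieces (Us ! i) C)" by linarith
  then have "(R' - R) * 1 \<le> (R' - R) * real_of_int (\<Sum>i<k. pieces (Us ! i) C)"
    using assms(3) by (intro mult_left_mono) auto
  also have "\<dots> = span_bound R' C - span_bound R C"
    by (simp add: span_bound_def sum_distrib_left sum_subtractf[symmetric] algebra_simps)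
  finally show ?thesis by simp
qed

text \<open>An edge between \<open>A\<close> and \<open>B\<close> lowers the number of pieces by
  one, hence the bound by \<open>R\<close>, but contributes its own weight, which is at least
  \<open>R\<close>.\<close>

lemma span_bound_Un:
  assumes "A \<inter> B = {}" "finite A" "finite B"
    and cross: "\<And>a b. a \<in> A \<Longrightarrow> b \<in> B \<Longrightarrow> R \<le> d a b \<and> R \<le> d b a"
  shows "span_bound R A + span_bound R B \<le> span_bound R (A \<union> B)"
proof -
  have "R * pieces T A + weight_in d T A + (R * pieces T B + weight_in d T B)
      \<le> R * pieces T (A \<union> B) + weight_in d T (A \<union> B)" if T: "is_tree T" for T
  proof -
    let ?E = "edges_in (snd T)"
    define X where "X = ?E (A \<union> B) - (?E A \<union> ?E B)"
    have fin: "finite (?E C)" for C using finite_edges_in[OF T] .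
    then have finX: "finite X" by (simp add: X_def)
    have disj: "?E A \<inter> ?E B = {}"
    proof (rule ccontr)
      assume "?E A \<inter> ?E B \<noteq> {}"
      then obtain e where "e \<in> snd T" "e \<subseteq> A" "e \<subseteq> B" by (auto simp: edges_in_def)
      then show False using assms(1) tree_edge(3)[OF T] by blast
    qed
    have disjX: "(?E A \<union> ?E B) \<inter> X = {}" by (auto simp: X_def)
    have un: "?E (A \<union> B) = (?E A \<union> ?E B) \<union> X" by (auto simp: edges_in_def X_def)
    have c1: "card (?E (A \<union> B)) = card (?E A) + card (?E B) + card X"
      unfolding un using fin finX disj disjX by (simp add: card_Un_disjoint)
    have c2: "weight_in d T (A \<union> B) = weight_in d T A + weight_in d T B + (\<Sum>e\<in>X. edge_weight d e)"
      unfolding weight_in_def un using fin finX disj disjX by (simp add: sum.union_disjoint)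
    have c3: "card (fst T \<inter> (A \<union> B)) = card (fst T \<inter> A) + card (fst T \<inter> B)"
      using assms(1-3) by (subst Int_Un_distrib, intro card_Un_disjoint) auto
    have "R \<le> edge_weight d e" if "e \<in> X" for e
    proof -
      have e: "e \<in> snd T" "e \<subseteq> A \<union> B" "\<not> e \<subseteq> A" "\<not> e \<subseteq> B" using that by (auto simp: X_def edges_in_def)
      obtain a b where ab: "e = {a, b}" "a \<noteq> b"
        using tree_edge(2)[OF T e(1)] by (auto simp: card_2_iff)
      have "(Min e = a \<and> Max e = b) \<or> (Min e = b \<and> Max e = a)"
        by (simp add: ab(1) min_def max_def)
      moreover have "(a \<in> A \<and> b \<in> B) \<or> (a \<in> B \<and> b \<in> A)"
        using e(2-4) unfolding ab(1) by blast
      ultimately show ?thesis using cross by metis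
    qed
    then have "R * card X \<le> (\<Sum>e\<in>X. edge_weight d e)"
      using sum_mono[of X "\<lambda>_. R"] by (simp add: mult.commute)
    then show ?thesis using c1 c2 c3 by (simp add: pieces_def algebra_simps)
  qed
  then show ?thesis
    unfolding span_bound_def sum.distrib[symmetric] using tree(1) by (intro sum_mono) auto
qed

text \<open>This expresses the minimality of the Kruskal tree. In a merge both sides are first
  raised from \<open>w\<close> to \<open>d u v\<close> and then united; of the two summands
  \<open>d u v\<close> obtained, one is the new edge and the other the new value of
  \<open>w\<close>.\<close>

lemma kruskal_span_bound:
  "kruskal lab nx x w \<Longrightarrow> c \<in> roots n lab \<Longrightarrow> x c + w \<le> span_bound w (label_class n lab c)"
proof (induction arbitrary: c rule: kruskal.induct)
  case (start lab nx)
  have "0 \<le> weight_in d (Us ! i) C" if "i < k" for i C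
    unfolding weight_in_def using edge_weight_nonneg[OF that] by (intro sum_nonneg) (auto simp: edges_in_def)
  then show ?case by (auto simp: span_bound_def intro: sum_nonneg)
next
  case (merge lab nx x w u v lab' nx')
  note cls = label_class_merge[OF merge.hyps(6,4)]
  have rts: "roots n lab' = roots n lab - {lab v}"
    using roots_merge[OF merge.hyps(1-4,6)] .
  have wd: "w \<le> d u v" using kruskal_cross merge.hyps by blast
  have grow: "x b + d u v \<le> span_bound (d u v) (label_class n lab b)" if "b \<in> roots n lab" for b
    using merge.IH[OF that] span_bound_mono[of b "label_class n lab b" w "d u v"] that wd
    by (auto simp: roots_def label_class_def)
  show ?case
  proof (cases "c = lab u")
    case True
    have "span_bound (d u v) (label_class n lab (lab u)) + span_bound (d u v) (label_class n lab (lab v))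
      \<le> span_bound (d u v) (label_class n lab (lab u) \<union> label_class n lab (lab v))"
      using merge.hyps(4,5) by (intro span_bound_Un) (auto simp: label_class_def)
    then show ?thesis
      using grow[OF kruskal_label[OF merge.hyps(1,2)]] grow[OF kruskal_label[OF merge.hyps(1,3)]]
      unfolding True cls(1) by simp
  next
    case False
    then have c: "c \<noteq> lab v" "c \<in> roots n lab" using merge.prems rts by auto
    show ?thesis using grow[OF c(2)] False cls(2)[OF False c(1)] by simp
  qed
qed


text \<open>Of the greedy cutting, only the quotas \<open>m\<close> and the weight limits of the
  paths enter, which separates the comparison from the algorithm.\<close>

theorem kruskal_paths_bound:
  fixes p R :: real and m :: "nat \<Rightarrow> nat"
  assumes kr: "kruskal lab nx x w" and "w \<le> R" and "0 < R"
    and cross: "\<And>u v. u < n \<Longrightarrow> v < n \<Longrightarrow> lab u \<noteq> lab v \<Longrightarrow> R \<le> d u v"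
    and m: "\<And>c. c \<in> roots n lab \<Longrightarrow> 1 \<le> m c \<and> 3 * R * (real (m c) - 1) \<le> x c"
    and sum_m: "k \<le> (\<Sum>c\<in>roots n lab. m c)"
    and dist: "distinct (concat ps)"
    and ps: "\<And>q. q < length ps \<Longrightarrow> lb q \<in> roots n lab \<and> set (ps ! q) \<subseteq> label_class n lab (lb q) \<and>
      0 \<le> path_weight d (ps ! q) \<and> path_weight d (ps ! q) \<le> 6 * R \<and>
      path_weight d (ps ! q) \<le> (\<Sum>v\<in>set (ps ! q). d v (nx v))"
    and p: "1 \<le> p"
  shows "(\<Sum>q<length ps. path_weight d (ps ! q) powr p) \<le> (\<Sum>i<k. (9 * tree_weight d (Us ! i)) powr p)"
proof -
  let ?C = "label_class n lab" and ?rts = "roots n lab"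
  let ?Q = "\<lambda>c. {q. q < length ps \<and> lb q = c}"
  define y where "y i = tree_weight d (Us ! i)" for i
  define Z where "Z i c = weight_in d (Us ! i) (?C c)" for i c
  define M where "M i c = pieces (Us ! i) (?C c)" for i c
  \<comment> \<open>The threshold is \<open>6 * R / 9\<close>, so that \<open>9\<close> times a big
    tree is at least the limit \<open>6 * R\<close> for a path.\<close>
  define big where "big = {i. i < k \<and> 2 / 3 * R \<le> y i}"
  define small where "small = {i. i < k \<and> y i < 2 / 3 * R}"
  define o' where "o' q = path_weight d (ps ! q)" for q
  \<comment> \<open>The number of edges of tree \<open>i\<close> that run between different
    components.\<close>
  define cr where "cr i = int (card (snd (Us ! i))) - (\<Sum>c\<in>?rts. int (card (edges_in (snd (Us ! i)) (?C c))))" for i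
  have split: "{..<k} = big \<union> small" "big \<inter> small = {}" "finite big" "finite small"
    by (auto simp: big_def small_def)
  have disjC: "?C c \<inter> ?C c' = {}" if "c \<noteq> c'" for c c' using that by (auto simp: label_class_def)
  have UnC: "(\<Union>c\<in>?rts. ?C c) = {..<n}"
    using kruskal_label[OF kr] by (auto simp: label_class_def)
  have Z0: "0 \<le> Z i c" if "i < k" for i c
    unfolding Z_def weight_in_def using edge_weight_nonneg[OF that]
    by (intro sum_nonneg) (auto simp: edges_in_def)
  have M0: "0 \<le> M i c" if "i < k" for i c
    unfolding M_def by (rule pieces_nonneg(1)[OF tree(1)[OF that]])
  have touch: "1 \<le> M i c" if "i < k" "Z i c \<noteq> 0" for i c
  proof -
    have "edges_in (snd (Us ! i)) (?C c) \<noteq> {}" using that(2) by (auto simp: Z_def weight_in_def)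
    then show ?thesis using pieces_nonneg(2,3)[OF tree(1)[OF that(1)]] unfolding M_def by blast
  qed
  \<comment> \<open>A crossing edge weighs at least \<open>R\<close> and accounts for at most one
    additional piece of its tree.\<close>
  have cross_bound: "(\<Sum>c\<in>?rts. Z i c) + R * cr i \<le> y i" "0 \<le> cr i" "(\<Sum>c\<in>?rts. M i c) \<le> 1 + cr i"
    if i: "i < k" for i
  proof -
    let ?E = "edges_in (snd (Us ! i))"
    have T: "is_tree (Us ! i)" using tree(1)[OF i] .
    have finE: "finite (snd (Us ! i))" "finite (fst (Us ! i))"
      using finite_edges[of "fst (Us ! i)" "snd (Us ! i)"] T by auto
    define I where "I = (\<Union>c\<in>?rts. ?E (?C c))"
    have sub: "I \<subseteq> snd (Us ! i)" by (auto simp: I_def edges_in_def)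
    have disjE: "?E (?C c) \<inter> ?E (?C c') = {}" if "c \<noteq> c'" for c c'
    proof (rule ccontr)
      assume "?E (?C c) \<inter> ?E (?C c') \<noteq> {}"
      then obtain e where "e \<in> snd (Us ! i)" "e \<subseteq> ?C c" "e \<subseteq> ?C c'" by (auto simp: edges_in_def)
      then show False using tree_edge(3)[OF T] disjC[OF that] by blast
    qed
    have cardI: "card I = (\<Sum>c\<in>?rts. card (?E (?C c)))"
      unfolding I_def using finite_edges_in[OF T] disjE by (intro card_UN_disjoint) auto
    have sumI: "(\<Sum>e\<in>I. edge_weight d e) = (\<Sum>c\<in>?rts. Z i c)"
      unfolding I_def Z_def weight_in_def using finite_edges_in[OF T] disjE
      by (intro sum.UNION_disjoint) auto
    have cr: "cr i = card (snd (Us ! i) - I)"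
      using card_Diff_subset[OF finite_subset[OF sub finE(1)] sub] card_mono[OF finE(1) sub]
      by (simp add: cr_def cardI of_nat_diff)
    then show "0 \<le> cr i" by simp
    have "R \<le> edge_weight d e" if e: "e \<in> snd (Us ! i) - I" for e
    proof -
      have e': "e \<in> snd (Us ! i)" using e by blast
      have lt: "Min e < n" "Max e < n"
        using tree_edge(1,3,4)[OF T e'] tree(2)[OF i] by blast+
      have "lab (Min e) \<noteq> lab (Max e)"
      proof
        assume eq: "lab (Min e) = lab (Max e)"
        obtain a b where ab: "e = {a, b}" "a \<noteq> b"
          using tree_edge(2)[OF T e'] by (auto simp: card_2_iff)
        have "(Min e = a \<and> Max e = b) \<or> (Min e = b \<and> Max e = a)"
          by (simp add: ab(1) min_def max_def)
        then have "e \<subseteq> ?C (lab (Min e))"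
          using ab(1) lt eq by (auto simp: label_class_def)
        then have "e \<in> I" using e' kruskal_label[OF kr lt(1)] by (auto simp: I_def edges_in_def)
        then show False using e by blast
      qed
      then show ?thesis using cross lt by blast
    qed
    then have "R * cr i \<le> (\<Sum>e\<in>snd (Us ! i) - I. edge_weight d e)"
      using sum_mono[of "snd (Us ! i) - I" "\<lambda>_. R"] by (simp add: cr mult.commute)
    then show "(\<Sum>c\<in>?rts. Z i c) + R * cr i \<le> y i"
      using sum.subset_diff[OF sub finE(1), of "edge_weight d"] sumI
      by (simp add: y_def tree_weight_alt)
    have "fst (Us ! i) = (\<Union>c\<in>?rts. fst (Us ! i) \<inter> ?C c)"
      using UnC tree(2)[OF i] by blast
    then have "card (fst (Us ! i)) = card (\<Union>c\<in>?rts. fst (Us ! i) \<inter> ?C c)" by metis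
    also have "\<dots> = (\<Sum>c\<in>?rts. card (fst (Us ! i) \<inter> ?C c))"
      using disjC by (intro card_UN_disjoint) auto
    finally have "card (fst (Us ! i)) = (\<Sum>c\<in>?rts. card (fst (Us ! i) \<inter> ?C c))" .
    then have "(\<Sum>c\<in>?rts. M i c) = int (card (fst (Us ! i))) - int (\<Sum>c\<in>?rts. card (?E (?C c)))"
      by (simp add: M_def pieces_def sum_subtractf)
    also have "\<dots> \<le> 1 + cr i"
      using connected_card_edges[of "fst (Us ! i)" "snd (Us ! i)"] T by (simp add: cr_def)
    finally show "(\<Sum>c\<in>?rts. M i c) \<le> 1 + cr i" .
  qed
  have y0: "0 \<le> y i" if "i < k" for i
    using cross_bound(1,2)[OF that] sum_nonneg[of ?rts "Z i"] Z0[OF that] \<open>0 < R\<close>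
    by (smt (verit) mult_nonneg_nonneg of_int_0_le_iff)
  have Zy: "Z i c \<le> y i" if "i < k" "c \<in> ?rts" for i c
    using cross_bound(1,2)[OF that(1)] member_le_sum[of c ?rts "Z i"] Z0[OF that(1)] that \<open>0 < R\<close>
    by (smt (verit) mult_nonneg_nonneg of_int_0_le_iff finite_roots)
  \<comment> \<open>A small tree cannot afford a crossing edge, since \<open>2 / 3 * R < R\<close>;
    it has at most one piece in all.\<close>
  have small_cr: "cr i = 0" "(\<Sum>c\<in>?rts. M i c) \<le> 1" if "i \<in> small" for i
  proof -
    have i: "i < k" "y i < 2 / 3 * R" using that by (auto simp: small_def)
    have "R * cr i \<le> y i"
      using cross_bound(1)[OF i(1)] sum_nonneg[of ?rts "Z i"] Z0[OF i(1)] by auto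
    then have "R * cr i < R * 1" using i(2) \<open>0 < R\<close> by linarith
    then have "cr i < 1" using \<open>0 < R\<close> by (simp del: mult_1_right)
    then show "cr i = 0" using cross_bound(2)[OF i(1)] by linarith
    then show "(\<Sum>c\<in>?rts. M i c) \<le> 1" using cross_bound(3)[OF i(1)] by simp
  qed
  define T where "T c = {i \<in> small. 1 \<le> M i c}" for c
  define Mt where "Mt c = (\<Sum>i<k. M i c)" for c
  define Zb where "Zb c = (\<Sum>i\<in>big. Z i c)" for c
  have finT: "finite (T c)" for c using split(4) by (simp add: T_def)
  have Zb0: "0 \<le> Zb c" for c unfolding Zb_def using Z0 by (intro sum_nonneg) (auto simp: big_def)
  have T_le: "int (card (T c)) \<le> Mt c" for c
  proof -
    have "int (card (T c)) = (\<Sum>i\<in>T c. 1)" by simp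
    also have "\<dots> \<le> (\<Sum>i\<in>T c. M i c)" by (intro sum_mono) (simp add: T_def)
    also have "\<dots> \<le> Mt c" unfolding Mt_def
      using M0 by (intro sum_mono2) (auto simp: T_def small_def)
    finally show ?thesis .
  qed
  have Mt1: "1 \<le> Mt c" if c: "c \<in> ?rts" for c
  proof -
    obtain i where i: "i < k" "c \<in> fst (Us ! i)" using covered[of c] c by (auto simp: roots_def)
    then have "1 \<le> M i c" unfolding M_def
      using pieces_nonneg(2)[OF tree(1)[OF i(1)], of "?C c"] c by (auto simp: roots_def label_class_def)
    also have "\<dots> \<le> Mt c" unfolding Mt_def using i(1) M0 by (intro member_le_sum) auto
    finally show ?thesis .
  qed
  have lower: "x c + R \<le> R * Mt c + (\<Sum>i<k. Z i c)" if c: "c \<in> ?rts" for c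
  proof -
    have "x c + R \<le> span_bound R (?C c)"
      using kruskal_span_bound[OF kr c] span_bound_mono[of c "?C c" w R] c \<open>w \<le> R\<close>
      by (auto simp: roots_def label_class_def)
    also have "\<dots> = R * Mt c + (\<Sum>i<k. Z i c)"
      by (simp add: span_bound_def M_def Z_def Mt_def sum.distrib sum_distrib_left)
    finally show ?thesis .
  qed
  \<comment> \<open>A small tree without a piece in the component has no edge there, and every other
    one weighs less than \<open>2 / 3 * R\<close>.\<close>
  have small_Z: "(\<Sum>i\<in>small. Z i c) \<le> 2 / 3 * R * card (T c)" if c: "c \<in> ?rts" for c
  proof -
    have "Z i c = 0" if "i \<in> small - T c" for i
      using touch[of i c] that by (auto simp: T_def small_def)
    then have "(\<Sum>i\<in>small. Z i c) = (\<Sum>i\<in>T c. Z i c)"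
      using split(4) by (intro sum.mono_neutral_right) (auto simp: T_def)
    also have "\<dots> \<le> (\<Sum>i\<in>T c. 2 / 3 * R)"
      using Zy[OF _ c] by (intro sum_mono) (fastforce simp: T_def small_def)
    finally show ?thesis by (simp add: mult.commute)
  qed
  have sum_k: "(\<Sum>i<k. f i) = (\<Sum>i\<in>big. f i) + (\<Sum>i\<in>small. f i)" for f :: "nat \<Rightarrow> real"
    unfolding split(1) using split by (intro sum.union_disjoint) auto
  \<comment> \<open>These are the components excluded in \<open>component_charge\<close>: their only
    piece comes from a small tree, so no big tree is available to be charged.\<close>
  define G where "G = {c \<in> ?rts. m c = 1 \<and> Mt c = 1 \<and> card (T c) = 1}"
  have charge: "2 / 9 * x c \<le> Zb c + R * (Mt c - int (m c))" if c: "c \<in> ?rts - G" for c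
  proof (rule component_charge)
    show "x c + R \<le> Zb c + 2 / 3 * R * int (card (T c)) + R * Mt c"
      using lower[of c] small_Z[of c] c sum_k[of "\<lambda>i. Z i c"] by (simp add: Zb_def)
    show "3 * R * (int (m c) - 1) \<le> x c" using m[of c] c by simp
    show "\<not> (int (m c) = 1 \<and> Mt c = 1 \<and> int (card (T c)) = 1)" using c by (auto simp: G_def)
    show "1 \<le> int (m c)" using m[of c] c by simp
  qed (use c Mt1 T_le Zb0 \<open>0 < R\<close> in auto)
  \<comment> \<open>The charges are summed. Components in \<open>G\<close> have
    \<open>Mt c = m c\<close> and contribute nonnegative terms, so the sum may run over all roots.
    The quotas, of sum at least \<open>k\<close>, then cancel one piece per tree, and only the
    crossing edges remain, all of which belong to big trees.\<close>
  have bad: "2 / 9 * (\<Sum>c\<in>?rts - G. x c) \<le> (\<Sum>i\<in>big. y i)"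
  proof -
    have fin: "finite G" "G \<subseteq> ?rts" by (auto simp: G_def)
    have "2 / 9 * (\<Sum>c\<in>?rts - G. x c) \<le> (\<Sum>c\<in>?rts - G. Zb c + R * (Mt c - int (m c)))"
      unfolding sum_distrib_left using charge by (intro sum_mono) auto
    also have "\<dots> \<le> (\<Sum>c\<in>?rts. Zb c + R * (Mt c - int (m c)))"
      using Zb0 by (intro sum_mono2) (auto simp: G_def)
    also have "\<dots> = (\<Sum>c\<in>?rts. Zb c) + R * ((\<Sum>c\<in>?rts. Mt c) - int (\<Sum>c\<in>?rts. m c))"
      by (simp add: sum.distrib sum_distrib_left[symmetric] sum_subtractf)
    also have "\<dots> \<le> (\<Sum>c\<in>?rts. Zb c) + R * (\<Sum>i\<in>big. cr i)"
    proof -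
      have "(\<Sum>c\<in>?rts. Mt c) = (\<Sum>i<k. \<Sum>c\<in>?rts. M i c)" unfolding Mt_def by (rule sum.swap)
      also have "\<dots> \<le> (\<Sum>i<k. 1 + cr i)" using cross_bound(3) by (intro sum_mono) auto
      also have "\<dots> = k + (\<Sum>i<k. cr i)" by (simp add: sum.distrib)
      also have "(\<Sum>i<k. cr i) = (\<Sum>i\<in>big. cr i) + (\<Sum>i\<in>small. cr i)"
        unfolding split(1) using split by (intro sum.union_disjoint) auto
      finally have "(\<Sum>c\<in>?rts. Mt c) - int (\<Sum>c\<in>?rts. m c) \<le> (\<Sum>i\<in>big. cr i)"
        using of_nat_mono[OF sum_m, where ?'a = int] small_cr(1) by simp
      then show ?thesis using \<open>0 < R\<close> by (simp only: add_le_cancel_left mult_le_cancel_left_pos of_int_le_iff)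
    qed
    also have "(\<Sum>c\<in>?rts. Zb c) = (\<Sum>i\<in>big. \<Sum>c\<in>?rts. Z i c)" unfolding Zb_def by (rule sum.swap)
    also have "\<dots> + R * (\<Sum>i\<in>big. cr i) = (\<Sum>i\<in>big. (\<Sum>c\<in>?rts. Z i c) + R * cr i)"
      by (simp add: sum.distrib sum_distrib_left)
    also have "\<dots> \<le> (\<Sum>i\<in>big. y i)" using cross_bound(1) by (intro sum_mono) (auto simp: big_def)
    finally show ?thesis .
  qed
  define g where "g c = (SOME i. i \<in> T c)" for c
  have g: "g c \<in> T c" if "c \<in> G" for c
  proof -
    have "\<exists>i. i \<in> T c" using that by (auto simp: G_def card_1_singleton_iff)
    then show ?thesis unfolding g_def by (rule someI_ex)
  qed
  \<comment> \<open>A small tree has at most one piece and cannot serve two components.\<close>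
  have inj: "inj_on g G"
  proof (rule inj_onI, rule ccontr)
    fix c c' assume c: "c \<in> G" "c' \<in> G" "g c = g c'" "c \<noteq> c'"
    have t: "g c \<in> small" "1 \<le> M (g c) c" "1 \<le> M (g c) c'"
      using g[OF c(1)] g[OF c(2)] c(3) by (auto simp: T_def)
    have "(\<Sum>b\<in>{c, c'}. M (g c) b) \<le> (\<Sum>b\<in>?rts. M (g c) b)"
      using c M0 t(1) by (intro sum_mono2) (auto simp: G_def small_def)
    then show False using small_cr(2)[OF t(1)] t c(4) by simp
  qed
  \<comment> \<open>With a single piece, \<open>lower\<close> reads
    \<open>x c + R \<le> R + Z (g c) c\<close>.\<close>
  have gx: "x c \<le> y (g c)" if c: "c \<in> G" for c
  proof -
    have t: "g c \<in> small" "1 \<le> M (g c) c" using g[OF c] by (auto simp: T_def)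
    then have k: "g c < k" by (simp add: small_def)
    have "Z i c = 0" if "i < k" "i \<noteq> g c" for i
    proof (rule ccontr)
      assume "Z i c \<noteq> 0"
      then have "1 \<le> M i c" using touch that by blast
      moreover have "(\<Sum>i\<in>{i, g c}. M i c) \<le> Mt c"
        unfolding Mt_def using that k M0 by (intro sum_mono2) auto
      ultimately show False using t that c by (simp add: G_def)
    qed
    then have "(\<Sum>i<k. Z i c) = (\<Sum>i\<in>{g c}. Z i c)"
      using k by (intro sum.mono_neutral_right) auto
    then show ?thesis using lower[of c] Zy[OF k, of c] c by (simp add: G_def)
  qed
  have o0: "0 \<le> o' q" if "q < length ps" for q using ps[OF that] by (simp add: o'_def)
  have osum: "(\<Sum>q\<in>?Q c. o' q) \<le> 2 * x c" if c: "c \<in> ?rts" for c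
  proof -
    have nx0: "0 \<le> d v (nx v)" if "v \<in> ?C c" for v
      using that kruskal_nx[OF kr] nonneg by (simp add: label_class_def)
    have "(\<Sum>q\<in>?Q c. o' q) \<le> (\<Sum>q\<in>?Q c. \<Sum>v\<in>set (ps ! q). d v (nx v))"
      using ps by (intro sum_mono) (auto simp: o'_def)
    also have "\<dots> = (\<Sum>v\<in>(\<Union>q\<in>?Q c. set (ps ! q)). d v (nx v))"
    proof (rule sum.UNION_disjoint[symmetric])
      have "set (ps ! a) \<inter> set (ps ! b) = {}" if "a < length ps" "b < length ps" "a \<noteq> b" for a b
        by (rule distinct_concat_disjoint[OF dist that])
      then show "\<forall>a\<in>?Q c. \<forall>b\<in>?Q c. a \<noteq> b \<longrightarrow> set (ps ! a) \<inter> set (ps ! b) = {}" by blast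
    qed auto
    also have "\<dots> \<le> (\<Sum>v\<in>?C c. d v (nx v))"
      using ps nx0 by (intro sum_mono2) auto
    also have "\<dots> \<le> 2 * x c" by (rule kruskal_cycle_weight[OF kr c])
    finally show ?thesis .
  qed
  have per: "(\<Sum>q\<in>?Q c. o' q powr p) \<le> 2 * x c * B powr (p - 1)"
    if c: "c \<in> ?rts" and B: "\<And>q. q < length ps \<Longrightarrow> lb q = c \<Longrightarrow> o' q \<le> B" for c B
  proof -
    have "(\<Sum>q\<in>?Q c. o' q powr p) \<le> (\<Sum>q\<in>?Q c. o' q * B powr (p - 1))"
      using o0 B p by (intro sum_mono powr_le_scaled) auto
    also have "\<dots> \<le> 2 * x c * B powr (p - 1)"
      unfolding sum_distrib_right[symmetric] using osum[OF c] by (intro mult_right_mono) auto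
    finally show ?thesis .
  qed
  have all: "(\<Sum>q<length ps. o' q powr p) = (\<Sum>c\<in>?rts. \<Sum>q\<in>?Q c. o' q powr p)"
    using sum.group[of "{..<length ps}" ?rts lb "\<lambda>q. o' q powr p"] ps by (simp add: subset_eq image_iff)
  have good: "(\<Sum>c\<in>G. \<Sum>q\<in>?Q c. o' q powr p) \<le> (\<Sum>i\<in>small. (9 * y i) powr p)"
  proof -
    have "(\<Sum>q\<in>?Q c. o' q powr p) \<le> (9 * y (g c)) powr p" if c: "c \<in> G" for c
    proof -
      have cr: "c \<in> ?rts" using c by (simp add: G_def)
      have gk: "g c < k" using g[OF c] by (simp add: T_def small_def)
      have "o' q \<le> 9 * y (g c)" if "q < length ps" "lb q = c" for q
      proof -
        have "o' q \<le> (\<Sum>q\<in>?Q c. o' q)"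
          using that o0 by (intro member_le_sum) auto
        then show ?thesis using osum[OF cr] gx[OF c] y0[OF gk] by linarith
      qed
      then have "(\<Sum>q\<in>?Q c. o' q powr p) \<le> 2 * x c * (9 * y (g c)) powr (p - 1)"
        using per[OF cr] by blast
      also have "\<dots> \<le> 9 * y (g c) * (9 * y (g c)) powr (p - 1)"
        using gx[OF c] y0[OF gk] by (intro mult_right_mono) auto
      also have "\<dots> = (9 * y (g c)) powr p"
        using y0[OF gk] p by (cases "y (g c) = 0") (auto simp: powr_diff)
      finally show ?thesis .
    qed
    then have "(\<Sum>c\<in>G. \<Sum>q\<in>?Q c. o' q powr p) \<le> (\<Sum>c\<in>G. (9 * y (g c)) powr p)"
      by (rule sum_mono)
    also have "\<dots> = (\<Sum>i\<in>g ` G. (9 * y i) powr p)" by (simp add: sum.reindex[OF inj])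
    also have "\<dots> \<le> (\<Sum>i\<in>small. (9 * y i) powr p)"
      using g split(4) by (intro sum_mono2) (auto simp: T_def)
    finally show ?thesis .
  qed
  have bad': "(\<Sum>c\<in>?rts - G. \<Sum>q\<in>?Q c. o' q powr p) \<le> (\<Sum>i\<in>big. (9 * y i) powr p)"
  proof -
    have "(\<Sum>c\<in>?rts - G. \<Sum>q\<in>?Q c. o' q powr p)
        \<le> (\<Sum>c\<in>?rts - G. 2 * x c * (6 * R) powr (p - 1))"
      using ps by (intro sum_mono per) (auto simp: o'_def)
    also have "\<dots> = 2 * (\<Sum>c\<in>?rts - G. x c) * (6 * R) powr (p - 1)"
      by (simp add: sum_distrib_left sum_distrib_right)
    also have "\<dots> \<le> 9 * (\<Sum>i\<in>big. y i) * (6 * R) powr (p - 1)"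
      using bad by (intro mult_right_mono) auto
    also have "\<dots> = (\<Sum>i\<in>big. 9 * y i * (6 * R) powr (p - 1))"
      by (simp add: sum_distrib_left sum_distrib_right)
    also have "\<dots> \<le> (\<Sum>i\<in>big. (9 * y i) powr p)"
    proof (rule sum_mono)
      fix i assume "i \<in> big"
      then have i: "2 / 3 * R \<le> y i" by (simp add: big_def)
      then have "0 < y i" using \<open>0 < R\<close> by linarith
      have "9 * y i * (6 * R) powr (p - 1) \<le> 9 * y i * (9 * y i) powr (p - 1)"
        using i \<open>0 < R\<close> \<open>0 < y i\<close> p by (intro mult_left_mono powr_mono2) auto
      also have "\<dots> = (9 * y i) powr p" using \<open>0 < y i\<close> by (simp add: powr_diff)
      finally show "9 * y i * (6 * R) powr (p - 1) \<le> (9 * y i) powr p" .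
    qed
    finally show ?thesis .
  qed
  have "(\<Sum>q<length ps. o' q powr p) = (\<Sum>c\<in>?rts - G. \<Sum>q\<in>?Q c. o' q powr p)
      + (\<Sum>c\<in>G. \<Sum>q\<in>?Q c. o' q powr p)"
    unfolding all by (intro sum.subset_diff) (auto simp: G_def)
  also have "\<dots> \<le> (\<Sum>i<k. (9 * y i) powr p)"
    using good bad' sum_k[of "\<lambda>i. (9 * y i) powr p"] by linarith
  finally show ?thesis by (simp add: o'_def y_def)
qed

end

section \<open>Cutting the cycles\<close>

lemma path_weight_simps [simp]:
  "path_weight d [] = 0" "path_weight d [u] = 0"
  "path_weight d (u # v # xs) = d u v + path_weight d (v # xs)"
  by (simp_all add: path_weight_def)

lemma path_weight_snoc:
  "xs \<noteq> [] \<Longrightarrow> path_weight d (xs @ [v]) = path_weight d xs + d (last xs) v"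
proof (induction xs rule: induct_list012)
  case (3 a b xs)
  then show ?case by (simp add: add.assoc)
qed simp_all

lemma of_nat_path_weight:
  "real (path_weight w xs) = path_weight (\<lambda>u v. real (w u v)) xs"
  by (induction xs rule: induct_list012) simp_all

lemma path_weight_cong:
  "(\<And>u v. u \<in> set xs \<Longrightarrow> v \<in> set xs \<Longrightarrow> d u v = d' u v) \<Longrightarrow> path_weight d xs = path_weight d' xs"
  by (induction xs rule: induct_list012) simp_all

section \<open>Greedy cutting of a tour\<close>

type_synonym chop_state = "nat list list \<times> nat"

text \<open>The second component of the state is the least weight of a rejected extension, with 0
  standing for none: the smallest larger bound at which the cuts would change.\<close>

fun chop_step :: "(nat \<Rightarrow> nat \<Rightarrow> nat) \<Rightarrow> nat \<Rightarrow> bool \<times> nat \<Rightarrow> chop_state \<Rightarrow> chop_state" where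
  "chop_step w B (fl, v) (ps, nb) =
    (if fl then (ps @ [[v]], nb)
     else let e = path_weight w (last ps) + w (last (last ps)) v in
       if B < e then (ps @ [[v]], if nb = 0 \<or> e < nb then e else nb)
       else (butlast ps @ [last ps @ [v]], nb))"

definition chop :: "(nat \<Rightarrow> nat \<Rightarrow> nat) \<Rightarrow> nat \<Rightarrow> (bool \<times> nat) list \<Rightarrow> chop_state" where
  "chop w B L = fold (chop_step w B) L ([], 0)"

lemma chop_Nil [simp]: "chop w B [] = ([], 0)"
  by (simp add: chop_def)

lemma chop_snoc: "chop w B (L @ [a]) = chop_step w B a (chop w B L)"
  by (simp add: chop_def)

definition sublist_weights :: "(nat \<Rightarrow> nat \<Rightarrow> nat) \<Rightarrow> nat list \<Rightarrow> nat set" where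
  "sublist_weights w xs = {path_weight w ys | as ys bs. xs = as @ ys @ bs}"

lemma sublist_weights_snoc: "sublist_weights w xs \<subseteq> sublist_weights w (xs @ [v])"
proof -
  have "\<exists>bs'. xs @ [v] = as @ ys @ bs'" if "xs = as @ ys @ bs" for as ys bs
    using that by (intro exI[of _ "bs @ [v]"]) simp
  then show ?thesis unfolding sublist_weights_def by blast
qed

text \<open>A contiguous part is fixed by its start and its length, so the number of candidates for
  the next bound does not depend on the size of the weights.\<close>

lemma card_sublist_weights:
  "finite (sublist_weights w xs)" "card (sublist_weights w xs) \<le> (length xs + 1)\<^sup>2"
proof -
  let ?I = "{..length xs} \<times> {..length xs}"
  have "sublist_weights w xs \<subseteq> (\<lambda>(i, j). path_weight w (take j (drop i xs))) ` ?I"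
  proof
    fix b assume "b \<in> sublist_weights w xs"
    then obtain as ys bs where "xs = as @ ys @ bs" "b = path_weight w ys"
      by (auto simp: sublist_weights_def)
    then show "b \<in> (\<lambda>(i, j). path_weight w (take j (drop i xs))) ` ?I"
      by (intro image_eqI[of _ _ "(length as, length ys)"]) auto
  qed
  moreover have fin: "finite ((\<lambda>(i, j). path_weight w (take j (drop i xs))) ` ?I)" by simp
  ultimately show "finite (sublist_weights w xs)" by (rule finite_subset)
  have "card (sublist_weights w xs) \<le> card ((\<lambda>(i, j). path_weight w (take j (drop i xs))) ` ?I)"
    using \<open>_ \<subseteq> _\<close> fin by (rule card_mono[rotated])
  also have "\<dots> \<le> card ?I" by (rule card_image_le) simp
  finally show "card (sublist_weights w xs) \<le> (length xs + 1)\<^sup>2"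
    by (simp add: power2_eq_square)
qed

text \<open>A flagged vertex opens a new cycle; every other vertex is the successor of the vertex before it.\<close>

definition walk :: "(nat \<Rightarrow> nat) \<Rightarrow> (bool \<times> nat) list \<Rightarrow> bool" where
  "walk nx L \<longleftrightarrow> (L \<noteq> [] \<longrightarrow> fst (hd L)) \<and>
    (\<forall>i. Suc i < length L \<and> \<not> fst (L ! Suc i) \<longrightarrow> snd (L ! Suc i) = nx (snd (L ! i)))"

lemma walk_snoc:
  "walk nx (L @ [(fl, v)]) \<longleftrightarrow> walk nx L \<and> (\<not> fl \<longrightarrow> L \<noteq> [] \<and> v = nx (snd (last L)))"
proof (cases "L = []")
  case False
  let ?M = "L @ [(fl, v)]"
  define P where "P i \<longleftrightarrow> Suc i < length ?M \<and> \<not> fst (?M ! Suc i) \<longrightarrow> snd (?M ! Suc i) = nx (snd (?M ! i))" for i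
  define Q where "Q i \<longleftrightarrow> Suc i < length L \<and> \<not> fst (L ! Suc i) \<longrightarrow> snd (L ! Suc i) = nx (snd (L ! i))" for i
  have 1: "P i \<longleftrightarrow> Q i" if "Suc i \<noteq> length L" for i
    using that by (auto simp: P_def Q_def nth_append)
  have 2: "P (length L - 1) \<longleftrightarrow> (\<not> fl \<longrightarrow> v = nx (snd (last L)))" "Q (length L - 1)"
    using False by (auto simp: P_def Q_def nth_append last_conv_nth)
  have "(\<forall>i. P i) \<longleftrightarrow> (\<forall>i. Q i) \<and> (\<not> fl \<longrightarrow> v = nx (snd (last L)))"
  proof
    assume P: "\<forall>i. P i"
    have "Q i" for i using 1[of i] 2(2) P by (cases "i = length L - 1") auto
    then show "(\<forall>i. Q i) \<and> (\<not> fl \<longrightarrow> v = nx (snd (last L)))" using 2(1) P by blast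
  next
    assume Q: "(\<forall>i. Q i) \<and> (\<not> fl \<longrightarrow> v = nx (snd (last L)))"
    have "P i" for i using 1[of i] 2(1) Q by (cases "i = length L - 1") auto
    then show "\<forall>i. P i" by blast
  qed
  then show ?thesis using False unfolding walk_def P_def Q_def by simp
qed (simp add: walk_def)

definition nx_path :: "(nat \<Rightarrow> nat) \<Rightarrow> nat list \<Rightarrow> bool" where
  "nx_path nx xs \<longleftrightarrow> xs \<noteq> [] \<and> (\<forall>i. Suc i < length xs \<longrightarrow> xs ! Suc i = nx (xs ! i))"

lemma nx_path_snoc: "nx_path nx xs \<Longrightarrow> v = nx (last xs) \<Longrightarrow> nx_path nx (xs @ [v])"
proof -
  assume xs: "nx_path nx xs" and v: "v = nx (last xs)"
  have "(xs @ [v]) ! Suc i = nx ((xs @ [v]) ! i)" if "Suc i < length (xs @ [v])" for i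
  proof (cases "Suc i = length xs")
    case True
    then have "last xs = xs ! i" by (metis diff_Suc_1 last_conv_nth list.size(3) nat.distinct(1))
    then show ?thesis using True v by (simp add: nth_append)
  next
    case False
    then show ?thesis using that xs by (simp add: nth_append nx_path_def)
  qed
  then show ?thesis by (simp add: nx_path_def)
qed

lemma chop_basic:
  assumes "walk nx L" "chop w B L = (ps, nb)"
  shows "concat ps = map snd L" "\<And>xs. xs \<in> set ps \<Longrightarrow> nx_path nx xs \<and> path_weight w xs \<le> B"
    and "nb = 0 \<or> B < nb \<and> nb \<in> sublist_weights w (map snd L)" "L \<noteq> [] \<Longrightarrow> ps \<noteq> []"
proof -
  have "concat ps = map snd L \<and> (\<forall>xs\<in>set ps. nx_path nx xs \<and> path_weight w xs \<le> B) \<and>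
    (nb = 0 \<or> B < nb \<and> nb \<in> sublist_weights w (map snd L)) \<and> (L \<noteq> [] \<longrightarrow> ps \<noteq> [])"
    using assms
  proof (induction L arbitrary: ps nb rule: rev_induct)
    case (snoc a L)
    obtain fl v where a: "a = (fl, v)" by (cases a)
    obtain qs mb where q: "chop w B L = (qs, mb)" by (cases "chop w B L")
    have wk: "walk nx L" "\<not> fl \<Longrightarrow> L \<noteq> [] \<and> v = nx (snd (last L))"
      using snoc.prems(1) by (auto simp: a walk_snoc)
    have IH: "concat qs = map snd L" "\<And>xs. xs \<in> set qs \<Longrightarrow> nx_path nx xs \<and> path_weight w xs \<le> B"
      "mb = 0 \<or> B < mb \<and> mb \<in> sublist_weights w (map snd L)" "L \<noteq> [] \<Longrightarrow> qs \<noteq> []"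
      using snoc.IH[OF wk(1) q] by auto
    have st: "chop_step w B (fl, v) (qs, mb) = (ps, nb)"
      using snoc.prems(2) by (simp add: chop_snoc q a)
    have single: "nx_path nx [v]" by (simp add: nx_path_def)
    have mb: "mb = 0 \<or> B < mb \<and> mb \<in> sublist_weights w (map snd L @ [v])"
      using IH(3) sublist_weights_snoc by blast
    show ?case
    proof (cases fl)
      case True
      then show ?thesis using st IH mb single by (auto simp: a)
    next
      case False
      then have L: "L \<noteq> []" "v = nx (snd (last L))" "qs \<noteq> []" using wk(2) IH(4) by auto
      obtain rs xs where qs: "qs = rs @ [xs]" using L(3) by (metis rev_exhaust)
      have xs: "nx_path nx xs" "path_weight w xs \<le> B" using IH(2) qs by auto
      then have "xs \<noteq> []" by (simp add: nx_path_def)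
      have "last xs = last (concat qs)" using \<open>xs \<noteq> []\<close> by (simp add: qs)
      also have "\<dots> = snd (last L)" using IH(1) L(1) by (simp add: last_map)
      finally have v: "v = nx (last xs)" using L(2) by simp
      let ?e = "path_weight w xs + w (last xs) v"
      have e: "?e = path_weight w (xs @ [v])" using \<open>xs \<noteq> []\<close> by (simp add: path_weight_snoc)
      \<comment> \<open>The extended path is a final part of what has been read, so its weight is a
        candidate even if the extension is rejected.\<close>
      have "map snd L @ [v] = concat rs @ (xs @ [v]) @ []" using IH(1) by (simp add: qs flip: IH(1))
      then have "?e \<in> sublist_weights w (map snd L @ [v])"
        unfolding e sublist_weights_def by blast
      then show ?thesis
        using False st IH mb single nx_path_snoc[OF xs(1) v]
        by (auto simp: a qs e Let_def split: if_splits)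
    qed
  qed simp
  then show "concat ps = map snd L" "\<And>xs. xs \<in> set ps \<Longrightarrow> nx_path nx xs \<and> path_weight w xs \<le> B"
    "nb = 0 \<or> B < nb \<and> nb \<in> sublist_weights w (map snd L)" "L \<noteq> [] \<Longrightarrow> ps \<noteq> []" by auto
qed

text \<open>\<open>N c\<close> counts the cuts inside the cycle \<open>c\<close>; every cut is paid for by \<open>nb\<close> units of the
  cycle.\<close>

lemma chop_count:
  fixes lab :: "nat \<Rightarrow> nat" and n :: nat
  assumes "walk nx L" "chop w B L = (ps, nb)" "\<And>v. v \<in> snd ` set L \<Longrightarrow> lab v < n \<and> lab (nx v) = lab v"
  shows "\<exists>N. length ps = length (filter fst L) + (\<Sum>c<n. N c) \<and> (nb = 0 \<longrightarrow> (\<forall>c. N c = 0)) \<and>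
    (\<forall>c. nb * N c \<le> (\<Sum>v\<leftarrow>filter (\<lambda>v. lab v = c) (map snd L). w v (nx v)))"
proof -
  let ?S = "\<lambda>c xs. (\<Sum>v\<leftarrow>filter (\<lambda>v. lab v = c) xs. w v (nx v))"
  \<comment> \<open>Strengthened for the induction: the weight of the open path is kept as a credit
    of its component, and the edge that leaves the last vertex is not spent yet, hence
    \<open>butlast\<close>.\<close>
  have "\<exists>N. length ps = length (filter fst L) + (\<Sum>c<n. N c) \<and> (nb = 0 \<longrightarrow> (\<forall>c. N c = 0)) \<and>
    (\<forall>c. nb * N c + (if ps \<noteq> [] \<and> lab (last (last ps)) = c then path_weight w (last ps) else 0)
      \<le> ?S c (butlast (map snd L)))"
    using assms
  proof (induction L arbitrary: ps nb rule: rev_induct)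
    case (snoc a L)
    obtain fl v where a: "a = (fl, v)" by (cases a)
    obtain qs mb where q: "chop w B L = (qs, mb)" by (cases "chop w B L")
    have wk: "walk nx L" "\<not> fl \<Longrightarrow> L \<noteq> [] \<and> v = nx (snd (last L))"
      using snoc.prems(1) by (auto simp: a walk_snoc)
    obtain N where N: "length qs = length (filter fst L) + (\<Sum>c<n. N c)" "mb = 0 \<Longrightarrow> \<forall>c. N c = 0"
      "\<And>c. mb * N c + (if qs \<noteq> [] \<and> lab (last (last qs)) = c then path_weight w (last qs) else 0)
        \<le> ?S c (butlast (map snd L))"
      using snoc.IH[OF wk(1) q] snoc.prems(3) by auto
    have st: "chop_step w B (fl, v) (qs, mb) = (ps, nb)"
      using snoc.prems(2) by (simp add: chop_snoc q a)
    note bas = chop_basic[OF wk(1) q]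
    have S: "?S c (map snd L) = ?S c (butlast (map snd L)) +
        (if lab (snd (last L)) = c then w (snd (last L)) (nx (snd (last L))) else 0)" if "L \<noteq> []" for c
    proof -
      have "map snd L = butlast (map snd L) @ [snd (last L)]"
        using that by (metis append_butlast_last_id last_map map_is_Nil_conv)
      then have "?S c (map snd L) = ?S c (butlast (map snd L) @ [snd (last L)])" by simp
      then show ?thesis by simp
    qed
    have S_mono: "?S c (butlast (map snd L)) \<le> ?S c (map snd L)" for c
      using S[of c] by (cases "L = []") auto
    show ?case
    proof (cases fl)
      case True
      have "mb * N c + (if lab v = c then 0 else 0) \<le> ?S c (map snd L)" for c
        using N(3)[of c] S_mono[of c] by simp
      then show ?thesis using True st N(1,2) by (intro exI[of _ N]) (auto simp: a)
    next
      case False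
      then have L: "L \<noteq> []" "v = nx (snd (last L))" "qs \<noteq> []" using wk(2) bas(4) by auto
      obtain rs xs where qs: "qs = rs @ [xs]" using L(3) by (metis rev_exhaust)
      have "xs \<noteq> []" using bas(2)[of xs] by (simp add: nx_path_def qs)
      have "last xs = last (concat qs)" using \<open>xs \<noteq> []\<close> by (simp add: qs)
      also have "\<dots> = snd (last L)" using bas(1) L(1) by (simp add: last_map)
      finally have u: "last xs = snd (last L)" .
      let ?c = "lab (last xs)"
      have cn: "?c < n" using snoc.prems(3)[of "last xs"] u L(1) by auto
      let ?e = "path_weight w xs + w (last xs) v"
      have bound: "mb * N c + (if ?c = c then ?e else 0) \<le> ?S c (map snd L)" for c
        using N(3)[of c] S[OF L(1), of c] L(2) u by (auto simp: qs)
      show ?thesis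
      proof (cases "B < ?e")
        case True
        \<comment> \<open>The cut is paid for by the whole rejected path, of weight
          \<open>?e \<ge> nb\<close>; the fresh path starts without credit.\<close>
        let ?N = "N(?c := N ?c + 1)"
        have ps: "ps = qs @ [[v]]" "nb = (if mb = 0 \<or> ?e < mb then ?e else mb)"
          using st False True by (auto simp: qs Let_def split: if_splits)
        have "(\<Sum>c<n. ?N c) = (\<Sum>c<n. N c) + 1"
        proof -
          have "?N = (\<lambda>c. N c + (if c = ?c then 1 else 0))" by auto
          moreover have "(\<Sum>c<n. if c = ?c then 1 else (0::nat)) = 1"
            using cn by (subst sum.delta) auto
          ultimately show ?thesis by (simp only: sum.distrib)
        qed
        moreover have "nb * ?N c \<le> ?S c (map snd L)" for c
        proof (cases "mb = 0")
          case True
          then show ?thesis using N(2) bound[of c] ps(2) by auto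
        next
          case False
          then have "nb \<le> mb" "nb \<le> ?e" using ps(2) by auto
          have "nb * ?N c = nb * N c + (if ?c = c then nb else 0)" by auto
          also have "\<dots> \<le> mb * N c + (if ?c = c then ?e else 0)"
            using \<open>nb \<le> ?e\<close> by (intro add_mono mult_le_mono1 \<open>nb \<le> mb\<close>) simp
          also have "\<dots> \<le> ?S c (map snd L)" by (rule bound)
          finally show ?thesis .
        qed
        moreover have "nb \<noteq> 0" using ps(2) True by (auto split: if_splits)
        ultimately show ?thesis using N(1) False ps(1) by (intro exI[of _ ?N]) (auto simp: a)
      next
        case nB: False
        have ps: "ps = rs @ [xs @ [v]]" "nb = mb"
          using st False nB by (auto simp: qs Let_def split: if_splits)
        have lv: "lab v = ?c" using snoc.prems(3)[of "last xs"] u L by auto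
        have "mb * N c + (if lab v = c then path_weight w (xs @ [v]) else 0) \<le> ?S c (map snd L)" for c
          using bound[of c] lv \<open>xs \<noteq> []\<close> by (simp add: path_weight_snoc split: if_splits)
        then show ?thesis using N(1,2) False
          by (intro exI[of _ N]) (simp add: a ps qs cong: if_cong split del: if_split)
      qed
    qed
  qed (auto intro: exI[of _ "\<lambda>_. 0"])
  then obtain N where N: "length ps = length (filter fst L) + (\<Sum>c<n. N c)" "nb = 0 \<Longrightarrow> \<forall>c. N c = 0"
    "\<And>c. nb * N c \<le> ?S c (butlast (map snd L))"
  proof -
    obtain N where "length ps = length (filter fst L) + (\<Sum>c<n. N c)" "nb = 0 \<longrightarrow> (\<forall>c. N c = 0)"
      and "\<forall>c. nb * N c + (if ps \<noteq> [] \<and> lab (last (last ps)) = c then path_weight w (last ps) else 0)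
        \<le> ?S c (butlast (map snd L))"
      using \<open>\<exists>N. _\<close> by blast
    then show ?thesis using that[of N] add_leD1 by blast
  qed
  have "?S c (butlast xs) \<le> ?S c xs" for c xs
    by (induction xs) auto
  then have "nb * N c \<le> ?S c (map snd L)" for c
    using N(3)[of c] order_trans by blast
  then show ?thesis using N(1,2) by (intro exI[of _ N]) simp
qed


section \<open>The tour through all component cycles\<close>

definition cycle_list :: "nat \<Rightarrow> (nat \<Rightarrow> nat) \<Rightarrow> (nat \<Rightarrow> nat) \<Rightarrow> nat \<Rightarrow> nat list" where
  "cycle_list n lab nx c = map (\<lambda>i. (nx ^^ i) c) [0..<card (label_class n lab c)]"

definition flag_first :: "nat list \<Rightarrow> (bool \<times> nat) list" where
  "flag_first xs = zip (map (\<lambda>i. i = 0) [0..<length xs]) xs"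

text \<open>For a Kruskal stage, a number that is not a root has an empty class and contributes
  nothing, so the program may run over all numbers below \<open>n\<close>.\<close>

definition tour :: "nat \<Rightarrow> (nat \<Rightarrow> nat) \<Rightarrow> (nat \<Rightarrow> nat) \<Rightarrow> (bool \<times> nat) list" where
  "tour n lab nx = concat (map (\<lambda>c. flag_first (cycle_list n lab nx c)) [0..<n])"

lemma length_flag_first [simp]: "length (flag_first xs) = length xs"
  by (simp add: flag_first_def)

lemma map_snd_flag_first [simp]: "map snd (flag_first xs) = xs"
  by (simp add: flag_first_def)

lemma nth_flag_first: "i < length xs \<Longrightarrow> flag_first xs ! i = (i = 0, xs ! i)"
  by (simp add: flag_first_def)

lemma filter_flag_first: "length (filter fst (flag_first xs)) = (if xs = [] then 0 else 1)"
proof -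
  have "{i. i < length xs \<and> fst (flag_first xs ! i)} = (if xs = [] then {} else {0})"
    by (auto simp: nth_flag_first)
  then show ?thesis by (simp add: length_filter_conv_card)
qed

lemma walk_append:
  assumes "walk nx L" "walk nx M"
  shows "walk nx (L @ M)"
proof (cases "M = []")
  case False
  then have hd: "fst (M ! 0)" using assms(2) by (simp add: walk_def hd_conv_nth)
  have "snd ((L @ M) ! Suc i) = nx (snd ((L @ M) ! i))"
    if i: "Suc i < length (L @ M)" "\<not> fst ((L @ M) ! Suc i)" for i
  proof -
    consider "Suc i < length L" | "Suc i = length L" | "length L \<le> i" by linarith
    then show ?thesis
    proof cases
      case 1
      then show ?thesis using i assms(1) by (simp add: walk_def nth_append)
    next
      case 2
      then show ?thesis using i hd by (simp add: nth_append)
    next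
      case 3
      then have "Suc (i - length L) < length M" "Suc i - length L = Suc (i - length L)" using i by auto
      then show ?thesis using i assms(2) 3 by (simp add: walk_def nth_append)
    qed
  qed
  moreover have "fst (hd (L @ M))" using assms False by (cases L) (auto simp: walk_def)
  ultimately show ?thesis unfolding walk_def by blast
qed (use assms in simp)

context weights
begin

text \<open>A root lies on its own cycle; iterating \<open>nx\<close> from it as often as the class
  has elements meets every element once.\<close>

lemma cycle_list_facts:
  assumes kr: "kruskal lab nx x wt" and c: "c < n"
  shows "distinct (cycle_list n lab nx c)" "set (cycle_list n lab nx c) = label_class n lab c"
    and "walk nx (flag_first (cycle_list n lab nx c))"
proof -
  let ?xs = "cycle_list n lab nx c"
  show "walk nx (flag_first ?xs)"
  proof -
    have "flag_first ?xs \<noteq> [] \<Longrightarrow> fst (hd (flag_first ?xs))"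
      by (cases ?xs) (auto simp: hd_conv_nth nth_flag_first simp flip: length_0_conv)
    moreover have "snd (flag_first ?xs ! Suc i) = nx (snd (flag_first ?xs ! i))"
      if "Suc i < length (flag_first ?xs)" for i
      using that by (simp add: nth_flag_first cycle_list_def)
    ultimately show ?thesis by (simp add: walk_def)
  qed
  have "distinct ?xs \<and> set ?xs = label_class n lab c"
  proof (cases "c \<in> roots n lab")
    case False
    then have "label_class n lab c = {}"
      using kruskal_label[OF kr] by (auto simp: label_class_def)
    then show ?thesis by (simp add: cycle_list_def)
  next
    case True
    then have cc: "c \<in> label_class n lab c" by (simp add: roots_def label_class_def)
    obtain ys where ys: "distinct ys" "set ys = label_class n lab c" "map nx ys = rotate1 ys"
      using kruskal_cycle[OF kr True] by metis
    obtain zs where zs: "map nx (zs @ [c]) = rotate1 (zs @ [c])" "distinct (zs @ [c])"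
      "set (zs @ [c]) = set ys"
      using cycle_rotate_to_last[OF ys(3,1), of c] cc unfolding ys(2) by metis
    have "map nx (rotate (length zs) (zs @ [c])) = rotate1 (rotate (length zs) (zs @ [c]))"
      by (simp only: rotate_map[symmetric] zs(1) rotate1_rotate_swap)
    then have rot: "map nx (c # zs) = rotate1 (c # zs)"
      by (simp only: rotate_append) simp
    have len: "length (c # zs) = card (label_class n lab c)"
      using zs(2,3) ys(2) distinct_card[OF zs(2)] by simp
    have "?xs = c # zs"
    proof (rule nth_equalityI)
      show "length ?xs = length (c # zs)" unfolding len by (simp add: cycle_list_def)
      show "?xs ! i = (c # zs) ! i" if "i < length ?xs" for i
        using that cycle_nth[OF rot, of i c zs] len by (simp add: cycle_list_def)
    qed
    then show ?thesis using zs(2,3) ys(2) by auto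
  qed
  then show "distinct ?xs" "set ?xs = label_class n lab c" by auto
qed

lemma tour_facts:
  assumes kr: "kruskal lab nx x wt"
  shows "distinct (map snd (tour n lab nx))" "snd ` set (tour n lab nx) = {..<n}"
    and "walk nx (tour n lab nx)" "length (filter fst (tour n lab nx)) = card (roots n lab)"
proof -
  let ?T = "\<lambda>m. concat (map (\<lambda>c. flag_first (cycle_list n lab nx c)) [0..<m])"
  note cl = cycle_list_facts[OF kr]
  have snd_flag: "snd ` set (flag_first xs) = set xs" for xs :: "nat list"
    by (metis image_set map_snd_flag_first)
  have set: "m \<le> n \<Longrightarrow> snd ` set (?T m) = {v. v < n \<and> lab v < m}" for m
  proof (induction m)
    case (Suc m)
    then show ?case using cl(2)[of m]
      by (auto simp: image_Un snd_flag label_class_def less_Suc_eq)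
  qed simp
  have "m \<le> n \<Longrightarrow> distinct (map snd (?T m)) \<and> walk nx (?T m) \<and>
    length (filter fst (?T m)) = card {c. c < m \<and> lab c = c}" for m
  proof (induction m)
    case 0
    show ?case by (simp add: walk_def)
  next
    case (Suc m)
    have "(cycle_list n lab nx m = []) \<longleftrightarrow> lab m \<noteq> m"
    proof
      assume "cycle_list n lab nx m = []"
      then have "label_class n lab m = {}" using cl(2)[of m] Suc.prems by simp
      then show "lab m \<noteq> m" using Suc.prems by (auto simp: label_class_def)
    next
      assume "lab m \<noteq> m"
      then have "label_class n lab m = {}"
        using kruskal_label[OF kr] by (auto simp: label_class_def roots_def)
      then show "cycle_list n lab nx m = []" using cl(2)[of m] Suc.prems by simp
    qed
    moreover have "{c. c < Suc m \<and> lab c = c} = {c. c < m \<and> lab c = c} \<union> (if lab m = m then {m} else {})"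
      by (auto simp: less_Suc_eq)
    moreover have "snd ` set (?T m) \<inter> set (cycle_list n lab nx m) = {}"
      using set[of m] cl(2)[of m] Suc.prems by (auto simp: label_class_def)
    ultimately show ?case
      using Suc cl[of m] by (auto simp: walk_append filter_flag_first)
  qed
  from this[of n] show "distinct (map snd (tour n lab nx))" "walk nx (tour n lab nx)"
    "length (filter fst (tour n lab nx)) = card (roots n lab)"
    by (auto simp: tour_def roots_def)
  have "{v. v < n \<and> lab v < n} = {..<n}"
    using kruskal_label[OF kr] by (auto simp: roots_def)
  then show "snd ` set (tour n lab nx) = {..<n}"
    using set[of n] by (simp add: tour_def)
qed

end

section \<open>The loop invariant\<close>

locale nat_weights =
  fixes n k :: nat and w :: "nat \<Rightarrow> nat \<Rightarrow> nat"
  assumes w_sym: "u < n \<Longrightarrow> v < n \<Longrightarrow> w u v = w v u"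
    and w_self: "u < n \<Longrightarrow> w u u = 0"
    and w_triangle: "u < n \<Longrightarrow> v < n \<Longrightarrow> z < n \<Longrightarrow> w u z \<le> w u v + w v z"
    and k_pos: "1 \<le> k"
begin

sublocale weights n "\<lambda>u v. real (w u v)"
proof
  fix u v z assume "u < n" "v < n" "z < n"
  then show "real (w u z) \<le> real (w u v) + real (w v z)" using w_triangle[of u v z] by linarith
qed (auto simp: w_self, metis w_sym)

text \<open>The quotas record the last failed attempt, already transferred to the present bound. For
  \<open>B = 0\<close> none are required, since all paths then weigh 0.\<close>

definition loop_inv :: "(nat \<Rightarrow> nat) \<Rightarrow> (nat \<Rightarrow> nat) \<Rightarrow> nat \<Rightarrow> bool" where
  "loop_inv lab nx B \<longleftrightarrow> (\<exists>x wt. kruskal lab nx x wt \<and> 6 * wt \<le> real B \<and>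
    (\<forall>u<n. \<forall>v<n. lab u \<noteq> lab v \<longrightarrow> B \<le> 6 * w u v) \<and>
    (B = 0 \<or> (\<exists>m. (\<forall>c\<in>roots n lab. 1 \<le> m c \<and> real B * (real (m c) - 1) \<le> 2 * x c) \<and>
      k \<le> (\<Sum>c\<in>roots n lab. m c))))"

abbreviation cuts :: "(nat \<Rightarrow> nat) \<Rightarrow> (nat \<Rightarrow> nat) \<Rightarrow> nat set" where
  "cuts lab nx \<equiv> sublist_weights w (map snd (tour n lab nx))"

text \<open>Between two merges, \<open>B\<close> increases within the weights of contiguous parts of the tour.\<close>

definition loop_measure :: "(nat \<Rightarrow> nat) \<Rightarrow> (nat \<Rightarrow> nat) \<Rightarrow> nat \<Rightarrow> nat" where
  "loop_measure lab nx B = card (roots n lab) * ((n + 1)\<^sup>2 + 1) +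
    card {b \<in> cuts lab nx. B < b}"

lemma loop_measure_le:
  "loop_measure lab nx B \<le> n * ((n + 1)\<^sup>2 + 1) + (length (tour n lab nx) + 1)\<^sup>2"
proof -
  have "card (roots n lab) \<le> card {..<n}" by (intro card_mono) (auto simp: roots_def)
  moreover have "card {b \<in> cuts lab nx. B < b}
      \<le> card (cuts lab nx)"
    using card_sublist_weights(1) by (intro card_mono) auto
  ultimately show ?thesis
    using card_sublist_weights(2)[of w "map snd (tour n lab nx)"]
    by (auto simp: loop_measure_def intro!: add_mono mult_right_mono)
qed

lemma length_tour:
  assumes "kruskal lab nx x wt"
  shows "length (tour n lab nx) = n"
proof -
  have "length (map snd (tour n lab nx)) = card (snd ` set (tour n lab nx))"
    using distinct_card[OF tour_facts(1)[OF assms]] by simp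
  then show ?thesis using tour_facts(2)[OF assms] by simp
qed

text \<open>Every root opens one path and every cut adds one. The cuts of a component are paid from
  its cycle, of weight at most \<open>2 * x c\<close>.\<close>

lemma chop_tour_count:
  assumes kr: "kruskal lab nx x wt" and ch: "chop w B (tour n lab nx) = (ps, nb)"
  shows "\<exists>N. length ps = (\<Sum>c\<in>roots n lab. 1 + N c) \<and> (nb = 0 \<longrightarrow> (\<forall>c. N c = 0)) \<and>
    (\<forall>c\<in>roots n lab. real nb * real (N c) \<le> 2 * x c)"
proof -
  note tf = tour_facts[OF kr]
  have "lab v < n \<and> lab (nx v) = lab v" if "v \<in> snd ` set (tour n lab nx)" for v
    using that kruskal_label[OF kr] kruskal_nx[OF kr] unfolding tf(2) by (auto simp: roots_def)
  then obtain N where N: "length ps = card (roots n lab) + (\<Sum>c<n. N c)" "nb = 0 \<longrightarrow> (\<forall>c. N c = 0)"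
    "\<And>c. nb * N c \<le> (\<Sum>v\<leftarrow>filter (\<lambda>v. lab v = c) (map snd (tour n lab nx)). w v (nx v))"
    using chop_count[OF tf(3) ch, of lab n] tf(4) by auto
  have sum: "(\<Sum>v\<leftarrow>filter (\<lambda>v. lab v = c) (map snd (tour n lab nx)). w v (nx v)) =
      (\<Sum>v\<in>label_class n lab c. w v (nx v))" for c
  proof -
    have "set (filter (\<lambda>v. lab v = c) (map snd (tour n lab nx))) = label_class n lab c"
      using tf(2) by (auto simp: label_class_def)
    then show ?thesis
      by (subst sum_list_distinct_conv_sum_set) (use tf(1) in \<open>auto simp: distinct_map_filter\<close>)
  qed
  have "N c = 0" if "c < n" "c \<notin> roots n lab" for c
  proof -
    have "label_class n lab c = {}"
      using that kruskal_label[OF kr] by (auto simp: label_class_def)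
    then have "nb * N c = 0" using N(3)[of c] unfolding sum by simp
    then show ?thesis using N(2) by auto
  qed
  then have "(\<Sum>c<n. N c) = (\<Sum>c\<in>roots n lab. N c)"
    by (intro sum.mono_neutral_right) (auto simp: roots_def)
  moreover have "real nb * real (N c) \<le> 2 * x c" if "c \<in> roots n lab" for c
  proof -
    have "real (nb * N c) \<le> real (\<Sum>v\<in>label_class n lab c. w v (nx v))"
      using N(3)[of c] unfolding sum by linarith
    also have "\<dots> \<le> 2 * x c" using kruskal_cycle_weight[OF kr that] by simp
    finally show ?thesis by simp
  qed
  ultimately show ?thesis using N(1,2) by (intro exI[of _ N]) (auto simp: sum_Suc)
qed

lemma loop_inv_start:
  assumes "\<forall>v<n. lab v = v \<and> nx v = v"
  shows "loop_inv lab nx 0"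
  unfolding loop_inv_def using kruskal.start[OF assms] by fastforce

text \<open>Each cut of the failed attempt consumed weight at least \<open>nb\<close>, so the
  numbers \<open>1 + N c\<close> are quotas for the bound \<open>nb\<close>. The candidate
  \<open>nb\<close> no longer lies above the bound, which lowers the measure.\<close>

lemma loop_inv_raise:
  assumes inv: "loop_inv lab nx B" and ch: "chop w B (tour n lab nx) = (ps, nb)"
    and "k < length ps" "nb \<noteq> 0" and cross: "\<forall>u<n. \<forall>v<n. lab u \<noteq> lab v \<longrightarrow> nb \<le> 6 * w u v"
  shows "loop_inv lab nx nb" "loop_measure lab nx nb < loop_measure lab nx B"
proof -
  obtain x wt where kr: "kruskal lab nx x wt" "6 * wt \<le> real B"
    using inv unfolding loop_inv_def by blast
  have nb: "B < nb" "nb \<in> cuts lab nx"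
    using chop_basic(3)[OF tour_facts(3)[OF kr(1)] ch] assms(4) by auto
  obtain N where N: "length ps = (\<Sum>c\<in>roots n lab. 1 + N c)"
    "\<forall>c\<in>roots n lab. real nb * real (N c) \<le> 2 * x c"
    using chop_tour_count[OF kr(1) ch] by blast
  have "(\<forall>c\<in>roots n lab. 1 \<le> 1 + N c \<and> real nb * (real (1 + N c) - 1) \<le> 2 * x c) \<and>
      k \<le> (\<Sum>c\<in>roots n lab. 1 + N c)"
    using N assms(3) by simp
  then have "\<exists>m. (\<forall>c\<in>roots n lab. 1 \<le> m c \<and> real nb * (real (m c) - 1) \<le> 2 * x c) \<and>
      k \<le> (\<Sum>c\<in>roots n lab. m c)"
    by (rule exI[of _ "\<lambda>c. 1 + N c"])
  moreover have "6 * wt \<le> real nb" using kr(2) nb(1) by linarith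
  ultimately show "loop_inv lab nx nb" using kr cross unfolding loop_inv_def by blast
  have "card {b \<in> cuts lab nx. nb < b}
      < card {b \<in> cuts lab nx. B < b}"
    using nb card_sublist_weights(1) by (intro psubset_card_mono) auto
  then show "loop_measure lab nx nb < loop_measure lab nx B" by (simp add: loop_measure_def)
qed

text \<open>Without cuts every component is a single path, so more than \<open>k \<ge> 1\<close>
  paths require two components.\<close>

lemma loop_cross_exists:
  assumes inv: "loop_inv lab nx B" and ch: "chop w B (tour n lab nx) = (ps, 0)" and "k < length ps"
  shows "\<exists>u<n. \<exists>v<n. lab u \<noteq> lab v"
proof (rule ccontr)
  assume neg: "\<not> ?thesis"
  obtain x wt where kr: "kruskal lab nx x wt" using inv unfolding loop_inv_def by blast
  obtain N where N: "length ps = (\<Sum>c\<in>roots n lab. 1 + N c)" "\<forall>c. N c = (0::nat)"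
    using chop_tour_count[OF kr ch] by blast
  have "c = c'" if "c \<in> roots n lab" "c' \<in> roots n lab" for c c'
  proof -
    have "lab c = lab c'" using that neg unfolding roots_def by blast
    then show ?thesis using that by (simp add: roots_def)
  qed
  then have "card (roots n lab) \<le> 1" by (simp add: card_le_Suc0_iff_eq)
  then show False using N assms(3) k_pos by simp
qed

text \<open>Because of \<open>6 * w u v \<le> nb\<close>, the cuts of the failed attempt also
  justify quotas for the new bound; if \<open>nb = 0\<close> there are no cuts to justify.\<close>

lemma loop_inv_merge:
  assumes inv: "loop_inv lab nx B" and ch: "chop w B (tour n lab nx) = (ps, nb)"
    and "k < length ps" and uv: "u < n" "v < n" "lab u \<noteq> lab v"
    and min: "\<forall>u'<n. \<forall>v'<n. lab u' \<noteq> lab v' \<longrightarrow> w u v \<le> w u' v'"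
    and nb: "nb = 0 \<or> 6 * w u v \<le> nb"
    and lab': "\<forall>z<n. lab' z = (if lab z = lab v then lab u else lab z)"
    and nx': "\<forall>z<n. nx' z = (nx(u := nx v, v := nx u)) z"
  shows "loop_inv lab' nx' (6 * w u v)" "loop_measure lab' nx' (6 * w u v) < loop_measure lab nx B"
proof -
  obtain x wt where kr: "kruskal lab nx x wt" using inv unfolding loop_inv_def by blast
  let ?x = "x(lab u := x (lab u) + x (lab v) + real (w u v))"
  have kr': "kruskal lab' nx' ?x (real (w u v))"
    using kruskal.merge[OF kr uv _ lab' nx'] min by simp
  have rts: "roots n lab' = roots n lab - {lab v}" by (rule roots_merge[OF kr uv lab'])
  have ru: "lab u \<in> roots n lab" "lab v \<in> roots n lab" using kruskal_label[OF kr] uv by auto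
  obtain N where N: "length ps = (\<Sum>c\<in>roots n lab. 1 + N c)" "nb = 0 \<longrightarrow> (\<forall>c. N c = 0)"
    "\<And>c. c \<in> roots n lab \<Longrightarrow> real nb * real (N c) \<le> 2 * x c"
    using chop_tour_count[OF kr ch] by blast
  let ?B = "6 * w u v"
  have NB: "real ?B * real (N c) \<le> 2 * x c" if "c \<in> roots n lab" for c
  proof (cases "nb = 0")
    case True
    then show ?thesis using N(2) kruskal_x_nonneg[OF kr, of c] by simp
  next
    case False
    then have "real ?B * real (N c) \<le> real nb * real (N c)"
      using nb by (intro mult_right_mono) auto
    then show ?thesis using N(3)[OF that] by linarith
  qed
  \<comment> \<open>The quota of the joint component is one less than the sum of the two old quotas.
    The loss is absorbed because the attempt failed with strictly more than \<open>k\<close> paths,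
    while the invariant asks only for \<open>k\<close>.\<close>
  let ?m = "\<lambda>c. if c = lab u then 1 + N (lab u) + N (lab v) else 1 + N c"
  have "1 \<le> ?m c \<and> real ?B * (real (?m c) - 1) \<le> 2 * ?x c" if c: "c \<in> roots n lab'" for c
  proof (cases "c = lab u")
    case True
    then show ?thesis using NB[OF ru(1)] NB[OF ru(2)] by (simp add: algebra_simps)
  next
    case False
    then show ?thesis using NB[of c] c rts by simp
  qed
  moreover have "k \<le> (\<Sum>c\<in>roots n lab'. ?m c)"
  proof -
    let ?R = "roots n lab - {lab v} - {lab u}"
    have "(\<Sum>c\<in>roots n lab'. ?m c) = ?m (lab u) + (\<Sum>c\<in>?R. ?m c)"
      unfolding rts using ru uv(3) by (subst sum.remove[of _ "lab u"]) auto
    also have "(\<Sum>c\<in>?R. ?m c) = (\<Sum>c\<in>?R. 1 + N c)" by (intro sum.cong) auto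
    finally have 1: "(\<Sum>c\<in>roots n lab'. ?m c) = 1 + N (lab u) + N (lab v) + (\<Sum>c\<in>?R. 1 + N c)" by simp
    have "length ps = (1 + N (lab v)) + (\<Sum>c\<in>roots n lab - {lab v}. 1 + N c)"
      unfolding N(1) using ru by (subst sum.remove[of _ "lab v"]) auto
    also have "(\<Sum>c\<in>roots n lab - {lab v}. 1 + N c) = (1 + N (lab u)) + (\<Sum>c\<in>?R. 1 + N c)"
      using ru uv(3) by (subst sum.remove[of _ "lab u"]) auto
    finally show ?thesis using 1 assms(3) by linarith
  qed
  ultimately have "\<exists>m. (\<forall>c\<in>roots n lab'. 1 \<le> m c \<and> real ?B * (real (m c) - 1) \<le> 2 * ?x c) \<and>
      k \<le> (\<Sum>c\<in>roots n lab'. m c)"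
    by (intro exI[of _ ?m]) blast
  moreover have "\<forall>a<n. \<forall>b<n. lab' a \<noteq> lab' b \<longrightarrow> ?B \<le> 6 * w a b"
  proof (intro allI impI)
    fix a b assume "a < n" "b < n" "lab' a \<noteq> lab' b"
    then have "lab a \<noteq> lab b" using lab' by metis
    then show "?B \<le> 6 * w a b" using min \<open>a < n\<close> \<open>b < n\<close> by simp
  qed
  ultimately show "loop_inv lab' nx' ?B"
    using kr' unfolding loop_inv_def by (intro exI[of _ ?x] exI[of _ "real (w u v)"]) simp
  have "card (roots n lab) = Suc (card (roots n lab'))"
    unfolding rts using ru(2) by (simp add: card_Suc_Diff1 del: card_Diff_insert)
  \<comment> \<open>The new tour may bring up to \<open>(n + 1)\<^sup>2\<close> candidates; the loss
    of one root outweighs them.\<close>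
  moreover have "card {b \<in> cuts lab' nx'. ?B < b} \<le> (n + 1)\<^sup>2"
  proof -
    have "card {b \<in> cuts lab' nx'. ?B < b}
        \<le> card (cuts lab' nx')"
      using card_sublist_weights(1) by (intro card_mono) auto
    then show ?thesis
      using card_sublist_weights(2)[of w "map snd (tour n lab' nx')"] length_tour[OF kr'] by simp
  qed
  ultimately show "loop_measure lab' nx' ?B < loop_measure lab nx B"
    by (simp add: loop_measure_def)
qed

lemma chop_result:
  assumes inv: "loop_inv lab nx B" and ch: "chop w B (tour n lab nx) = (ps, nb)"
  shows "distinct (concat ps)" "set (concat ps) = {..<n}" "[] \<notin> set ps"
    and "length ps \<le> k \<Longrightarrow> length Us = k \<Longrightarrow> tree_cover {..<n} (set Us) \<Longrightarrow> 1 \<le> (p :: real) \<Longrightarrow>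
      (\<Sum>q<length ps. real (path_weight w (ps ! q)) powr p) \<le>
      (\<Sum>i<k. (9 * tree_weight (\<lambda>u v. real (w u v)) (Us ! i)) powr p)"
proof -
  let ?d = "\<lambda>u v. real (w u v)"
  obtain x wt where kr: "kruskal lab nx x wt" and wt: "6 * wt \<le> real B"
    and cross: "\<And>u v. u < n \<Longrightarrow> v < n \<Longrightarrow> lab u \<noteq> lab v \<Longrightarrow> B \<le> 6 * w u v"
    and quota: "B = 0 \<or> (\<exists>m. (\<forall>c\<in>roots n lab. 1 \<le> m c \<and> real B * (real (m c) - 1) \<le> 2 * x c) \<and>
      k \<le> (\<Sum>c\<in>roots n lab. m c))"
    using inv unfolding loop_inv_def by blast
  note tf = tour_facts[OF kr] and bas = chop_basic[OF tour_facts(3)[OF kr] ch]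
  show dist: "distinct (concat ps)" using tf(1) bas(1) by simp
  show set: "set (concat ps) = {..<n}" using tf(2) bas(1) by simp
  show "[] \<notin> set ps" using bas(2) by (auto simp: nx_path_def)
  have "\<exists>c. c \<in> roots n lab \<and> set xs \<subseteq> label_class n lab c \<and>
      path_weight ?d xs \<le> (\<Sum>v\<in>set xs. real (w v (nx v)))" if xs: "xs \<in> set ps" for xs
  proof -
    have path: "nx_path nx xs" using bas(2)[OF xs] by simp
    then have "xs \<noteq> []" by (simp add: nx_path_def)
    have lt: "v < n" if "v \<in> set xs" for v using set xs that by fastforce
    have "distinct xs" using dist xs by (simp add: distinct_concat_iff)
    have lab: "i < length xs \<Longrightarrow> lab (xs ! i) = lab (hd xs)" for i
    proof (induction i)
      case 0
      then show ?case by (simp add: hd_conv_nth \<open>xs \<noteq> []\<close>)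
    next
      case (Suc i)
      then have "xs ! Suc i = nx (xs ! i)" "xs ! i < n" using path lt by (auto simp: nx_path_def)
      then show ?case using Suc kruskal_nx(2)[OF kr] by simp
    qed
    have "set xs \<subseteq> label_class n lab (lab (hd xs))"
      using lab lt by (auto simp: label_class_def in_set_conv_nth)
    moreover have "lab (hd xs) \<in> roots n lab"
      using kruskal_label[OF kr] lt \<open>xs \<noteq> []\<close> by simp
    moreover have "path_weight w ys \<le> (\<Sum>v\<leftarrow>ys. w v (nx v))" if "nx_path nx ys" for ys
      using that
    proof (induction ys rule: induct_list012)
      case (3 a b ys)
      have "b = nx a" using 3(3) by (force simp: nx_path_def)
      have "nx_path nx (b # ys)" unfolding nx_path_def
      proof (intro conjI allI impI)
        fix i assume "Suc i < length (b # ys)"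
        then show "(b # ys) ! Suc i = nx ((b # ys) ! i)"
          using 3(3) unfolding nx_path_def by (metis Suc_less_eq length_Cons nth_Cons_Suc)
      qed simp
      then show ?case using 3(2) \<open>b = nx a\<close> by simp
    qed simp_all
    then have "real (path_weight w xs) \<le> real (\<Sum>v\<leftarrow>xs. w v (nx v))" using path of_nat_mono by blast
    then have "path_weight ?d xs \<le> (\<Sum>v\<in>set xs. real (w v (nx v)))"
      using \<open>distinct xs\<close> by (simp add: of_nat_path_weight sum_list_distinct_conv_sum_set)
    ultimately show ?thesis by blast
  qed
  then have "\<exists>c. c \<in> roots n lab \<and> set (ps ! q) \<subseteq> label_class n lab c \<and>
      path_weight ?d (ps ! q) \<le> (\<Sum>v\<in>set (ps ! q). real (w v (nx v)))" if "q < length ps" for q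
    using that nth_mem by blast
  then obtain lb where lb: "\<And>q. q < length ps \<Longrightarrow> lb q \<in> roots n lab \<and>
      set (ps ! q) \<subseteq> label_class n lab (lb q) \<and>
      path_weight ?d (ps ! q) \<le> (\<Sum>v\<in>set (ps ! q). real (w v (nx v)))"
    by metis
  have le_B: "path_weight w (ps ! q) \<le> B" if "q < length ps" for q using bas(2) that by simp
  show "(\<Sum>q<length ps. real (path_weight w (ps ! q)) powr p) \<le> (\<Sum>i<k. (9 * tree_weight ?d (Us ! i)) powr p)"
    if "length ps \<le> k" "length Us = k" "tree_cover {..<n} (set Us)" "1 \<le> p"
  \<comment> \<open>The comparison needs \<open>R > 0\<close>; for \<open>B = 0\<close> all output
    paths weigh 0.\<close>
  proof (cases "B = 0")
    case True
    then have "(\<Sum>q<length ps. real (path_weight w (ps ! q)) powr p) = 0"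
      using le_B by (intro sum.neutral) auto
    then show ?thesis by (simp add: sum_nonneg)
  next
    case False
    interpret weighted_cover n ?d k Us
      using weights_axioms that(2,3) by (simp add: weighted_cover_def weighted_cover_axioms_def)
    obtain m where m: "\<And>c. c \<in> roots n lab \<Longrightarrow> 1 \<le> m c \<and> real B * (real (m c) - 1) \<le> 2 * x c"
      "k \<le> (\<Sum>c\<in>roots n lab. m c)" using quota False by blast
    show ?thesis unfolding of_nat_path_weight
    proof (rule kruskal_paths_bound[OF kr, where R = "real B / 6" and m = m and lb = lb])
      show "wt \<le> real B / 6" using wt by simp
      show "0 < real B / 6" using False by simp
      show "real B / 6 \<le> real (w u v)" if "u < n" "v < n" "lab u \<noteq> lab v" for u v
        using cross[OF that] by linarith
      show "1 \<le> m c \<and> 3 * (real B / 6) * (real (m c) - 1) \<le> x c" if "c \<in> roots n lab" for c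
        using m(1)[OF that] by (simp add: field_simps)
      show "lb q \<in> roots n lab \<and> set (ps ! q) \<subseteq> label_class n lab (lb q) \<and>
        0 \<le> path_weight ?d (ps ! q) \<and> path_weight ?d (ps ! q) \<le> 6 * (real B / 6) \<and>
        path_weight ?d (ps ! q) \<le> (\<Sum>v\<in>set (ps ! q). real (w v (nx v)))" if "q < length ps" for q
        using lb[OF that] le_B[OF that] by (simp flip: of_nat_path_weight)
    qed (use m(2) dist that in auto)
  qed
qed

end

section \<open>The main loop as a program\<close>

text \<open>The paths are stored one after the other in \<open>vORD\<close>, their lengths in \<open>vSL\<close>; \<open>vNB\<close> is the least
  bound above \<open>vB\<close> at which the greedy cuts change, or 0 if there is none.\<close>

abbreviation "vN \<equiv> 2 :: nat"
abbreviation "vK \<equiv> 3 :: nat"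
abbreviation "vOFF \<equiv> 5 :: nat"
abbreviation "vW \<equiv> 6 :: nat"
abbreviation "vLAB \<equiv> 7 :: nat"
abbreviation "vNX \<equiv> 8 :: nat"
abbreviation "vB \<equiv> 9 :: nat"
abbreviation "vGO \<equiv> 10 :: nat"
abbreviation "vPOS \<equiv> 11 :: nat"
abbreviation "vCNT \<equiv> 12 :: nat"
abbreviation "vNB \<equiv> 13 :: nat"
abbreviation "vR \<equiv> 14 :: nat"
abbreviation "vT \<equiv> 15 :: nat"
abbreviation "vFL \<equiv> 16 :: nat"
abbreviation "vCUR \<equiv> 17 :: nat"
abbreviation "vSL \<equiv> 18 :: nat"
abbreviation "vLN \<equiv> 19 :: nat"
abbreviation "vU \<equiv> 20 :: nat"
abbreviation "vORD \<equiv> 21 :: nat"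
abbreviation "vE \<equiv> 22 :: nat"

text \<open>The machine cannot multiply, so the row offsets \<open>u * n\<close> are tabulated in
  \<open>vOFF\<close>.\<close>

definition graph_data :: "nat \<Rightarrow> nat \<Rightarrow> (nat \<Rightarrow> nat \<Rightarrow> nat) \<Rightarrow> memory \<Rightarrow> bool" where
  "graph_data n k w s \<longleftrightarrow> s vN 0 = n \<and> s vK 0 = k \<and> (\<forall>u<n. s vOFF u = u * n) \<and>
    (\<forall>u<n. \<forall>v<n. s vW (u * n + v) = w u v)"

abbreviation "Incr x \<equiv> x ::= Plus (Var x) (Num 1)"

text \<open>The machine version of \<open>chop_step\<close>: \<open>vLN\<close> carries the weight
  of the open path, so no path is summed again.\<close>

definition visit_c :: com where
  "visit_c =
    Cond (Var vFL)
      (Assign vSL (Var vCNT) (Num 1) ;; Incr vCNT ;; vLN ::= Num 0 ;; vFL ::= Num 0)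
      (vE ::= Plus (Var vLN) (Get vW (Plus (Get vOFF (Var vU)) (Var vCUR))) ;;
       Cond (Minus (Var vE) (Var vB))
        (Cond (Var vNB) (Cond (Minus (Var vNB) (Var vE)) (vNB ::= Var vE) Skip) (vNB ::= Var vE) ;;
         Assign vSL (Var vCNT) (Num 1) ;; Incr vCNT ;; vLN ::= Num 0)
        (Assign vSL (Minus (Var vCNT) (Num 1)) (Plus (Get vSL (Minus (Var vCNT) (Num 1))) (Num 1)) ;;
         vLN ::= Var vE)) ;;
    Assign vORD (Var vPOS) (Var vCUR) ;; Incr vPOS ;; vU ::= Var vCUR ;; vCUR ::= Get vNX (Var vCUR)"

definition visit_if_c :: com where
  "visit_if_c = Cond (Neq (Get vLAB (Var vT)) (Var vR)) Skip visit_c"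

definition chop_c :: com where
  "chop_c = vPOS ::= Num 0 ;; vCNT ::= Num 0 ;; vNB ::= Num 0 ;;
    For vR (Var vN)
      (vFL ::= Num 1 ;; vCUR ::= Var vR ;;
       For vT (Var vN) visit_if_c)"

definition chop_rep :: "memory \<Rightarrow> chop_state \<Rightarrow> bool" where
  "chop_rep s = (\<lambda>(ps, nb). s vCNT 0 = length ps \<and> s vNB 0 = nb \<and> s vPOS 0 = length (concat ps) \<and>
    (\<forall>i<length ps. s vSL i = length (ps ! i)) \<and>
    (\<forall>i<length (concat ps). s vORD i = concat ps ! i))"

definition visit_rep :: "(nat \<Rightarrow> nat \<Rightarrow> nat) \<Rightarrow> nat \<Rightarrow> nat \<Rightarrow> memory \<Rightarrow> chop_state \<Rightarrow> bool" where
  "visit_rep w v u s = (\<lambda>(ps, nb). chop_rep s (ps, nb) \<and> s vFL 0 = 0 \<and> s vCUR 0 = u \<and>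
    ps \<noteq> [] \<and> last ps \<noteq> [] \<and> last (last ps) = v \<and> s vU 0 = v \<and> s vLN 0 = path_weight w (last ps))"

lemma wp_visit:
  assumes data: "graph_data n k w s" and rep: "chop_rep s (ps, nb)" and B: "s vB 0 = B"
    and v: "s vCUR 0 = v" "v < n" and fl: "s vFL 0 = (if fl then 1 else 0)"
    and u: "\<not> fl \<Longrightarrow> ps \<noteq> [] \<and> last ps \<noteq> [] \<and> last (last ps) < n \<and>
      s vU 0 = last (last ps) \<and> s vLN 0 = path_weight w (last ps)"
  shows "wp X visit_c (\<lambda>s'. visit_rep w v (s vNX v) s' (chop_step w B (fl, v) (ps, nb))) s"
proof (cases fl)
  case True
  show ?thesis
    unfolding visit_c_def
    by (rule vc_wp) (use True rep v fl in \<open>auto simp: visit_rep_def chop_rep_def nth_append less_Suc_eq\<close>)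
next
  case False
  then obtain rs xs where ps: "ps = rs @ [xs]" "xs \<noteq> []" using u by (metis append_butlast_last_id)
  have U: "last xs < n" "s vU 0 = last xs" "s vLN 0 = path_weight w xs" using u False ps by auto
  have W: "s vW (s vOFF (last xs) + v) = w (last xs) v"
    using data U(1) v(2) by (simp add: graph_data_def)
  show ?thesis
    unfolding visit_c_def
    by (rule vc_wp)
      (use False rep v fl U W B ps in \<open>auto simp: visit_rep_def chop_rep_def nth_append less_Suc_eq path_weight_snoc Let_def\<close>)
qed


definition tour_upto :: "nat \<Rightarrow> (nat \<Rightarrow> nat) \<Rightarrow> (nat \<Rightarrow> nat) \<Rightarrow> nat \<Rightarrow> (bool \<times> nat) list" where
  "tour_upto n lab nx m = concat (map (\<lambda>c. flag_first (cycle_list n lab nx c)) [0..<m])"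

text \<open>The inner loop of \<open>chop_c\<close> runs over all vertices merely to count: each
  vertex of the class triggers one step along the cycle, usually at another vertex. This is the
  number of steps made after \<open>t\<close> rounds.\<close>

definition class_upto :: "(nat \<Rightarrow> nat) \<Rightarrow> nat \<Rightarrow> nat \<Rightarrow> nat" where
  "class_upto lab r t = card {v. v < t \<and> lab v = r}"

lemma class_upto_Suc: "class_upto lab r (Suc t) = class_upto lab r t + (if lab t = r then 1 else 0)"
proof -
  have "{v. v < Suc t \<and> lab v = r} = {v. v < t \<and> lab v = r} \<union> (if lab t = r then {t} else {})"
    by (auto simp: less_Suc_eq)
  then show ?thesis by (auto simp: class_upto_def)
qed

lemma class_upto_less: "t < n \<Longrightarrow> lab t = r \<Longrightarrow> class_upto lab r t < card (label_class n lab r)"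
  unfolding class_upto_def label_class_def by (intro psubset_card_mono) auto

lemma writes_visit: "writes visit_c = {11, 12, 13, 16, 17, 18, 19, 20, 21, 22}"
  by (auto simp: visit_c_def)

lemma writes_visit_if: "writes visit_if_c = {11, 12, 13, 16, 17, 18, 19, 20, 21, 22}"
  by (simp add: visit_if_c_def writes_visit)

lemma graph_data_cong:
  "graph_data n k w s \<Longrightarrow> s' vN = s vN \<Longrightarrow> s' vK = s vK \<Longrightarrow> s' vOFF = s vOFF \<Longrightarrow> s' vW = s vW \<Longrightarrow>
    graph_data n k w s'"
  by (simp add: graph_data_def)

lemma chop_rep_upd [simp]:
  "x \<notin> {11, 12, 13, 18, 21} \<Longrightarrow> chop_rep (s(x := f)) st \<longleftrightarrow> chop_rep s st"
  by (simp add: chop_rep_def)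

lemma funpow_less: "\<forall>v<n. f v < n \<Longrightarrow> v < n \<Longrightarrow> (f ^^ i) v < (n :: nat)"
  by (induction i) auto

lemma wp_chop_inner:
  assumes data: "graph_data n k w s" and B: "s vB 0 = B" and lab: "s vLAB = lab" and nx: "s vNX = nx"
    and nx_less: "\<forall>v<n. nx v < n" and r: "r < n" "s vR 0 = r" and "n \<le> X"
    and start: "s vFL 0 = 1" "s vCUR 0 = r" and rep: "chop_rep s (chop w B (tour_upto n lab nx r))"
  shows "wp X (For vT (Var vN) visit_if_c)
    (\<lambda>s'. chop_rep s' (chop w B (tour_upto n lab nx (Suc r)))) s"
proof -
  let ?F = "flag_first (cycle_list n lab nx r)"
  let ?j = "class_upto lab r"
  define P where "P j = tour_upto n lab nx r @ take j ?F" for j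
  \<comment> \<open>\<open>vCUR\<close> is the vertex to be visited next and \<open>vU\<close> the
    one visited last; the latter is meaningful only after the first step.\<close>
  define I where "I t s' \<longleftrightarrow> chop_rep s' (chop w B (P (?j t))) \<and> s' vCUR 0 = (nx ^^ ?j t) r \<and>
    s' vFL 0 = (if ?j t = 0 then 1 else 0) \<and>
    (?j t \<noteq> 0 \<longrightarrow> (let ps = fst (chop w B (P (?j t))) in ps \<noteq> [] \<and> last ps \<noteq> [] \<and>
      last (last ps) < n \<and> s' vU 0 = last (last ps) \<and> s' vLN 0 = path_weight w (last ps)))" for t s'
  show ?thesis
  proof (rule wp_ForI[where I = I and m = n])
    show "I 0 (upd s vT 0)"
      using start rep by (simp add: I_def class_upto_def P_def)
    show "n \<le> X" by fact
    show "aval (Var vN) s' = n" if "\<And>a. a \<noteq> vT \<Longrightarrow> a \<notin> writes visit_if_c \<Longrightarrow> s' a = s a" for s'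
      using that[of vN] data by (simp add: writes_visit_if graph_data_def)
  next
    fix t s' assume t: "t < n" and I: "I t s'" and T: "s' vT 0 = t"
      and fr: "\<And>a. a \<noteq> vT \<Longrightarrow> a \<notin> writes visit_if_c \<Longrightarrow> s' a = s a"
    have fr': "s' vN = s vN" "s' vK = s vK" "s' vOFF = s vOFF" "s' vW = s vW" "s' vB = s vB"
      "s' vLAB = lab" "s' vNX = nx" "s' vR = s vR"
      using fr lab nx by (simp_all add: writes_visit_if)
    show "wp X visit_if_c
        (\<lambda>s''. s'' vT 0 = t \<and> I (Suc t) (upd s'' vT (Suc t))) s'"
      unfolding visit_if_c_def
    proof (rule wp_CondI)
      assume "aval (Neq (Get vLAB (Var vT)) (Var vR)) s' \<noteq> 0"
      then have "lab t \<noteq> r" using T fr' r by auto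
      then have "?j (Suc t) = ?j t" by (simp add: class_upto_Suc)
      then show "wp X Skip (\<lambda>s''. s'' vT 0 = t \<and> I (Suc t) (upd s'' vT (Suc t))) s'"
        using I T by (simp add: I_def)
    next
      assume "aval (Neq (Get vLAB (Var vT)) (Var vR)) s' = 0"
      then have lt: "lab t = r" using T fr' r by auto
      have j: "?j t < card (label_class n lab r)" by (rule class_upto_less[of t n lab r, OF t lt])
      have j': "?j (Suc t) = Suc (?j t)" using lt by (simp add: class_upto_Suc)
      let ?v = "(nx ^^ ?j t) r"
      have len: "length ?F = card (label_class n lab r)" by (simp add: cycle_list_def)
      have item: "?F ! ?j t = (?j t = 0, ?v)"
        using j by (subst nth_flag_first) (simp_all add: cycle_list_def)
      have P: "P (Suc (?j t)) = P (?j t) @ [(?j t = 0, ?v)]"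
        using j len by (simp add: P_def take_Suc_conv_app_nth item)
      obtain ps nb where st: "chop w B (P (?j t)) = (ps, nb)" by (cases "chop w B (P (?j t))")
      have st': "chop w B (P (Suc (?j t))) = chop_step w B (?j t = 0, ?v) (ps, nb)"
        unfolding P chop_snoc st ..
      have vn: "?v < n" by (rule funpow_less[OF nx_less r(1)])
      have "graph_data n k w s'" using graph_data_cong[OF data] fr' by simp
      then have "wp X visit_c (\<lambda>s''. visit_rep w ?v (s' vNX ?v) s'' (chop_step w B (?j t = 0, ?v) (ps, nb))) s'"
        by (rule wp_visit) (use I vn B fr' st in \<open>auto simp: I_def Let_def\<close>)
      then show "wp X visit_c (\<lambda>s''. s'' vT 0 = t \<and> I (Suc t) (upd s'' vT (Suc t))) s'"
      proof (rule wp_frame_mono)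
        fix s'' assume *: "visit_rep w ?v (s' vNX ?v) s'' (chop_step w B (?j t = 0, ?v) (ps, nb))"
          and fr2: "\<And>a. a \<notin> writes visit_c \<Longrightarrow> s'' a = s' a"
        obtain ps' nb' where st2: "chop w B (P (Suc (?j t))) = (ps', nb')" by (cases "chop w B (P (Suc (?j t)))")
        have c: "chop_rep s'' (ps', nb')" "s'' vFL 0 = 0" "s'' vCUR 0 = nx ?v" "ps' \<noteq> []" "last ps' \<noteq> []"
          "last (last ps') = ?v" "s'' vU 0 = ?v" "s'' vLN 0 = path_weight w (last ps')"
          using * fr'(7) unfolding st'[symmetric] st2 visit_rep_def by auto
        have "s'' vT 0 = t" using fr2[of vT] T by (simp add: writes_visit)
        then show "s'' vT 0 = t \<and> I (Suc t) (upd s'' vT (Suc t))"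
          using c vn by (simp add: I_def j' st2)
      qed
    qed
  next
    fix s' assume I: "I n s'"
    have "?j n = length ?F" by (simp add: class_upto_def cycle_list_def label_class_def)
    then have "P (?j n) = tour_upto n lab nx (Suc r)" by (simp add: P_def tour_upto_def)
    then show "chop_rep s' (chop w B (tour_upto n lab nx (Suc r)))" using I by (simp add: I_def)
  qed
qed

lemma wp_chop:
  assumes data: "graph_data n k w s" and nx_less: "\<forall>v<n. s vNX v < n" and "n \<le> X"
  shows "wp X chop_c (\<lambda>s'. chop_rep s' (chop w (s vB 0) (tour n (s vLAB) (s vNX)))) s"
proof -
  let ?B = "s vB 0" and ?L = "tour_upto n (s vLAB) (s vNX)"
  let ?s = "s(vPOS := (s vPOS)(0 := 0), vCNT := (s vCNT)(0 := 0), vNB := (s vNB)(0 := 0))"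
  let ?in = "For vT (Var vN) visit_if_c"
  let ?body = "vFL ::= Num 1 ;; vCUR ::= Var vR ;; ?in"
  have "wp X (For vR (Var vN) ?body) (\<lambda>s'. chop_rep s' (chop w ?B (tour n (s vLAB) (s vNX)))) ?s"
  proof (rule wp_ForI[where I = "\<lambda>r s'. chop_rep s' (chop w ?B (?L r))" and m = n])
    show "chop_rep (upd ?s vR 0) (chop w ?B (?L 0))"
      by (simp add: tour_upto_def chop_rep_def)
    show "n \<le> X" by fact
    show "aval (Var vN) s' = n" if "\<And>a. a \<noteq> vR \<Longrightarrow> a \<notin> writes ?body \<Longrightarrow> s' a = ?s a" for s'
      using that[of vN] data by (simp add: writes_visit_if graph_data_def)
    show "chop_rep s' (chop w ?B (tour n (s vLAB) (s vNX)))" if "chop_rep s' (chop w ?B (?L n))" for s'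
      using that by (simp add: tour_upto_def tour_def)
  next
    fix r s' assume r: "r < n" and rep: "chop_rep s' (chop w ?B (?L r))" and R: "s' vR 0 = r"
      and fr: "\<And>a. a \<noteq> vR \<Longrightarrow> a \<notin> writes ?body \<Longrightarrow> s' a = ?s a"
    let ?s' = "s'(vFL := (s' vFL)(0 := 1), vCUR := (s' vCUR)(0 := r))"
    have fr': "s' vN = s vN" "s' vK = s vK" "s' vOFF = s vOFF" "s' vW = s vW" "s' vB = s vB"
      "s' vLAB = s vLAB" "s' vNX = s vNX"
      using fr by (simp_all add: writes_visit_if)
    have "wp X ?in (\<lambda>s''. chop_rep s'' (chop w ?B (?L (Suc r)))) ?s'"
    proof (rule wp_chop_inner)
      show "graph_data n k w ?s'" by (rule graph_data_cong[OF data]) (simp_all add: fr')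
    qed (use r R rep fr' nx_less \<open>n \<le> X\<close> in simp_all)
    then have "wp X ?in (\<lambda>s''. s'' vR 0 = r \<and> chop_rep (upd s'' vR (Suc r)) (chop w ?B (?L (Suc r)))) ?s'"
      by (rule wp_frame_mono) (use R in \<open>simp_all add: writes_visit_if\<close>)
    then show "wp X ?body (\<lambda>s''. s'' vR 0 = r \<and> chop_rep (upd s'' vR (Suc r)) (chop w ?B (?L (Suc r)))) s'"
      using R by (intro wp_SeqI) (simp only: wp_Assign aval.simps, rule wp_SeqI, simp)
  qed
  then show ?thesis
    unfolding chop_c_def by (intro wp_AssignI) simp
qed


section \<open>Search for the closest two components\<close>

abbreviation "vFF \<equiv> 23 :: nat"
abbreviation "vFU \<equiv> 24 :: nat"
abbreviation "vFV \<equiv> 25 :: nat"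
abbreviation "vFW \<equiv> 26 :: nat"
abbreviation "vX \<equiv> 27 :: nat"
abbreviation "vY \<equiv> 28 :: nat"
abbreviation "vC1 \<equiv> 29 :: nat"
abbreviation "vC2 \<equiv> 30 :: nat"
abbreviation "vTMP \<equiv> 31 :: nat"
abbreviation "vMG \<equiv> 32 :: nat"

definition record_c :: com where
  "record_c = vFF ::= Num 1 ;; vFU ::= Var vX ;; vFV ::= Var vY ;;
    vFW ::= Get vW (Plus (Get vOFF (Var vX)) (Var vY))"

definition test_c :: com where
  "test_c = Cond (Neq (Get vLAB (Var vX)) (Get vLAB (Var vY)))
    (Cond (Var vFF)
      (Cond (Minus (Var vFW) (Get vW (Plus (Get vOFF (Var vX)) (Var vY)))) record_c Skip)
      record_c) Skip"

definition find_c :: com where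
  "find_c = vFF ::= Num 0 ;; For vX (Var vN) (For vY (Var vN) test_c)"

text \<open>\<open>P\<close> is the set of pairs inspected so far; \<open>vFF\<close> is 0 as long
  as no separated pair has been met.\<close>

definition min_cross :: "nat \<Rightarrow> (nat \<Rightarrow> nat \<Rightarrow> nat) \<Rightarrow> (nat \<Rightarrow> nat) \<Rightarrow> (nat \<times> nat) set \<Rightarrow> memory \<Rightarrow> bool" where
  "min_cross n w lab P s \<longleftrightarrow> (if s vFF 0 = 0 then \<forall>(a, b)\<in>P. lab a = lab b
     else s vFU 0 < n \<and> s vFV 0 < n \<and> lab (s vFU 0) \<noteq> lab (s vFV 0) \<and>
       s vFW 0 = w (s vFU 0) (s vFV 0) \<and> (\<forall>(a, b)\<in>P. lab a \<noteq> lab b \<longrightarrow> s vFW 0 \<le> w a b))"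

lemma min_cross_upd [simp]:
  "x \<notin> {23, 24, 25, 26} \<Longrightarrow> min_cross n w lab P (s(x := f)) \<longleftrightarrow> min_cross n w lab P s"
  by (simp add: min_cross_def cong: if_cong)

lemma writes_test: "writes test_c = {23, 24, 25, 26}"
  by (auto simp: test_c_def record_c_def)

lemma wp_test:
  assumes data: "graph_data n k w s" and "s vX 0 = a" "s vY 0 = b" "a < n" "b < n"
    and mc: "min_cross n w (s vLAB) P s"
  shows "wp X test_c (min_cross n w (s vLAB) (insert (a, b) P)) s"
proof -
  have W: "s vW (s vOFF a + b) = w a b" using assms(1,4,5) by (simp add: graph_data_def)
  show ?thesis
    unfolding test_c_def record_c_def
    by (rule vc_wp) (use assms(2-5) mc W in \<open>auto simp: min_cross_def split: if_splits\<close>)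
qed

lemma wp_find:
  assumes data: "graph_data n k w s" and "n \<le> X"
  shows "wp X find_c (min_cross n w (s vLAB) ({..<n} \<times> {..<n})) s"
proof -
  let ?s = "upd s vFF 0"
  let ?mc = "min_cross n w (s vLAB)"
  have "wp X (For vX (Var vN) (For vY (Var vN) test_c)) (?mc ({..<n} \<times> {..<n})) ?s"
  proof (rule wp_ForI[where I = "\<lambda>a. ?mc ({..<a} \<times> {..<n})" and m = n])
    show "?mc ({..<0} \<times> {..<n}) (upd ?s vX 0)" by (simp add: min_cross_def)
    show "aval (Var vN) s' = n" if "\<And>a. a \<noteq> vX \<Longrightarrow> a \<notin> writes (For vY (Var vN) test_c) \<Longrightarrow> s' a = ?s a" for s'
      using that[of vN] data by (simp add: writes_test graph_data_def)
  next
    fix a s' assume a: "a < n" "?mc ({..<a} \<times> {..<n}) s'" "s' vX 0 = a"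
      and fr: "\<And>b. b \<noteq> vX \<Longrightarrow> b \<notin> writes (For vY (Var vN) test_c) \<Longrightarrow> s' b = ?s b"
    have data': "graph_data n k w s'" by (rule graph_data_cong[OF data]) (simp_all add: fr writes_test)
    have lab': "s' vLAB = s vLAB" by (simp add: fr writes_test)
    let ?P = "\<lambda>b. {..<a} \<times> {..<n} \<union> {a} \<times> {..<b}"
    show "wp X (For vY (Var vN) test_c)
      (\<lambda>s''. s'' vX 0 = a \<and> ?mc ({..<Suc a} \<times> {..<n}) (upd s'' vX (Suc a))) s'"
    proof (rule wp_ForI[where I = "\<lambda>b. ?mc (?P b)" and m = n])
      show "?mc (?P 0) (upd s' vY 0)"
        using a by simp
      show "aval (Var vN) s'' = n" if "\<And>b. b \<noteq> vY \<Longrightarrow> b \<notin> writes test_c \<Longrightarrow> s'' b = s' b" for s''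
        using that[of vN] data' by (simp add: writes_test graph_data_def)
    next
      fix b s'' assume b: "b < n" "?mc (?P b) s''" "s'' vY 0 = b"
        and fr': "\<And>b. b \<noteq> vY \<Longrightarrow> b \<notin> writes test_c \<Longrightarrow> s'' b = s' b"
      have eq: "insert (a, b) (?P b) = ?P (Suc b)" by auto
      have data'': "graph_data n k w s''" by (rule graph_data_cong[OF data']) (simp_all add: fr' writes_test)
      have lab'': "s'' vLAB = s vLAB" and x'': "s'' vX 0 = a"
        using lab' a(3) by (simp_all add: fr' writes_test)
      have "wp X test_c (min_cross n w (s'' vLAB) (insert (a, b) (?P b))) s''"
        by (rule wp_test[OF data'' x'' b(3) a(1) b(1)]) (simp add: lab'' b(2))
      then show "wp X test_c (\<lambda>s. s vY 0 = b \<and>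
          ?mc (?P (Suc b)) (upd s vY (Suc b))) s''"
        by (rule wp_frame_mono) (use b(3) eq in \<open>simp_all add: writes_test lab''\<close>)
    next
      fix s'' assume *: "?mc (?P n) s''"
        and fr': "\<And>b. b \<noteq> vY \<Longrightarrow> b \<notin> writes test_c \<Longrightarrow> s'' b = s' b"
      have eq: "?P n = {..<Suc a} \<times> {..<n}" by auto
      show "s'' vX 0 = a \<and> ?mc ({..<Suc a} \<times> {..<n}) (upd s'' vX (Suc a))"
        using fr'[of vX] a(3) * eq by (simp add: writes_test)
    qed (use \<open>n \<le> X\<close> in simp_all)
  qed (use \<open>n \<le> X\<close> in simp_all)
  then show ?thesis unfolding find_c_def by (intro wp_AssignI) simp
qed

section \<open>Merging, and one round of the main loop\<close>

definition merge_c :: com where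
  "merge_c = vC1 ::= Get vLAB (Var vFU) ;; vC2 ::= Get vLAB (Var vFV) ;;
    vB ::= Plus (Plus (Plus (Var vFW) (Var vFW)) (Plus (Var vFW) (Var vFW))) (Plus (Var vFW) (Var vFW)) ;;
    vTMP ::= Get vNX (Var vFU) ;; Assign vNX (Var vFU) (Get vNX (Var vFV)) ;;
    Assign vNX (Var vFV) (Var vTMP) ;;
    For vX (Var vN) (Cond (Neq (Get vLAB (Var vX)) (Var vC2)) Skip (Assign vLAB (Var vX) (Var vC1)))"

lemma wp_merge:
  assumes data: "graph_data n k w s" and "n \<le> X"
    and uv: "s vFU 0 = u" "s vFV 0 = v" "s vFW 0 = fw" "u \<noteq> v"
  shows "wp X merge_c (\<lambda>s'. s' vB 0 = 6 * fw \<and>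
    (\<forall>z<n. s' vLAB z = (if s vLAB z = s vLAB v then s vLAB u else s vLAB z)) \<and>
    s' vNX = (s vNX)(u := s vNX v, v := s vNX u)) s"
proof -
  let ?c = "Cond (Neq (Get vLAB (Var vX)) (Var vC2)) Skip (Assign vLAB (Var vX) (Var vC1))"
  let ?lab = "s vLAB"
  define t where "t = s(vC1 := (s vC1)(0 := ?lab u), vC2 := (s vC2)(0 := ?lab v),
    vB := (s vB)(0 := fw + fw + (fw + fw) + (fw + fw)), vTMP := (s vTMP)(0 := s vNX u), vNX := (s vNX)(u := s vNX v, v := s vNX u))"
  define I where "I j s' \<longleftrightarrow> (\<forall>z. s' vLAB z = (if z < j \<and> ?lab z = ?lab v then ?lab u else ?lab z))"
    for j and s' :: memory
  have "wp X (For vX (Var vN) ?c) (\<lambda>s'. s' vB 0 = 6 * fw \<and>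
    (\<forall>z<n. s' vLAB z = (if s vLAB z = s vLAB v then s vLAB u else s vLAB z)) \<and>
    s' vNX = (s vNX)(u := s vNX v, v := s vNX u)) t"
  proof (rule wp_ForI[where I = I and m = n])
    show "I 0 (upd t vX 0)" by (simp add: I_def t_def)
    show "aval (Var vN) s' = n" if "\<And>a. a \<noteq> vX \<Longrightarrow> a \<notin> writes ?c \<Longrightarrow> s' a = t a" for s'
      using that[of vN] data by (simp add: graph_data_def t_def)
  next
    fix j s' assume j: "j < n" "I j s'" "s' vX 0 = j" and fr: "\<And>a. a \<noteq> vX \<Longrightarrow> a \<notin> writes ?c \<Longrightarrow> s' a = t a"
    have "s' vC1 0 = ?lab u" "s' vC2 0 = ?lab v" by (simp_all add: fr t_def)
    then show "wp X ?c (\<lambda>s''. s'' vX 0 = j \<and> I (Suc j) (upd s'' vX (Suc j))) s'"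
      by (intro vc_wp) (use j in \<open>auto simp: I_def less_Suc_eq\<close>)
  next
    fix s' assume I: "I n s'" and fr: "\<And>a. a \<noteq> vX \<Longrightarrow> a \<notin> writes ?c \<Longrightarrow> s' a = t a"
    have "s' vB = t vB" "s' vNX = t vNX" by (simp_all add: fr)
    then show "s' vB 0 = 6 * fw \<and>
      (\<forall>z<n. s' vLAB z = (if s vLAB z = s vLAB v then s vLAB u else s vLAB z)) \<and>
      s' vNX = (s vNX)(u := s vNX v, v := s vNX u)"
      using I by (simp add: I_def t_def)
  qed (use \<open>n \<le> X\<close> in simp_all)
  then have "wp X (For vX (Var vN) ?c) (\<lambda>s'. s' vB 0 = 6 * fw \<and>
    (\<forall>z<n. s' vLAB z = (if s vLAB z = s vLAB v then s vLAB u else s vLAB z)) \<and>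
    s' vNX = (s vNX)(u := s vNX v, v := s vNX u)) (t(vNX := (t vNX)(v := s vNX u)))"
    by (simp add: t_def split del: if_split)
  then show ?thesis
    unfolding merge_c_def by (intro wp_AssignI) (simp add: uv t_def split del: if_split)
qed

text \<open>\<open>vMG\<close> ends as 0 if the bound is to be raised. The truncated subtraction
  leaves it nonzero just when \<open>6\<close> times the closest distance is below
  \<open>vNB\<close>, so a tie raises the bound.\<close>

definition choose_c :: com where
  "choose_c = vMG ::= Num 1 ;;
    Cond (Var vNB)
      (vMG ::= Num 0 ;; Cond (Var vFF)
        (vMG ::= Minus (Var vNB)
          (Plus (Plus (Plus (Var vFW) (Var vFW)) (Plus (Var vFW) (Var vFW))) (Plus (Var vFW) (Var vFW)))) Skip)
      Skip ;;
    Cond (Var vMG) merge_c (vB ::= Var vNB)"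

definition step_c :: com where
  "step_c = find_c ;; choose_c"

definition loop_c :: com where
  "loop_c = vGO ::= Num 1 ;;
    While (Var vGO) (chop_c ;; Cond (Minus (Var vCNT) (Var vK)) step_c (vGO ::= Num 0))"


lemma writes_chop: "writes chop_c = {11, 12, 13, 14, 15, 16, 17, 18, 19, 20, 21, 22}"
  by (auto simp: chop_c_def writes_visit_if)

lemma writes_find: "writes find_c = {23, 24, 25, 26, 27, 28}"
  by (auto simp: find_c_def writes_test)

lemma writes_merge: "writes merge_c = {7, 8, 9, 27, 29, 30, 31}"
  by (auto simp: merge_c_def)

lemma writes_step: "writes step_c = {7, 8, 9, 23, 24, 25, 26, 27, 28, 29, 30, 31, 32}"
  by (auto simp: step_c_def choose_c_def writes_find writes_merge)

context nat_weights
begin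

lemma wp_step:
  assumes data: "graph_data n k w s" and "n \<le> X" and inv: "loop_inv (s vLAB) (s vNX) (s vB 0)"
    and ch: "chop w (s vB 0) (tour n (s vLAB) (s vNX)) = (ps, nb)" and "k < length ps" and nb: "s vNB 0 = nb"
  shows "wp X step_c (\<lambda>s'. loop_inv (s' vLAB) (s' vNX) (s' vB 0) \<and>
    loop_measure (s' vLAB) (s' vNX) (s' vB 0) < loop_measure (s vLAB) (s vNX) (s vB 0)) s"
    (is "wp X step_c ?Q s")
  unfolding step_c_def
proof (rule wp_SeqI, rule wp_frame_mono[OF wp_find[OF data \<open>n \<le> X\<close>]])
  fix t assume mc: "min_cross n w (s vLAB) ({..<n} \<times> {..<n}) t" and fr: "\<And>a. a \<notin> writes find_c \<Longrightarrow> t a = s a"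
  have eq: "t vLAB = s vLAB" "t vNX = s vNX" "t vB = s vB" "t vNB = s vNB" "t vN = s vN" "t vK = s vK"
    "t vOFF = s vOFF" "t vW = s vW"
    by (simp_all add: fr writes_find)
  have no_cross: "s vLAB a = s vLAB b" if "t vFF 0 = 0" "a < n" "b < n" for a b
  proof -
    have "\<forall>(a, b)\<in>{..<n} \<times> {..<n}. s vLAB a = s vLAB b" using mc that(1) unfolding min_cross_def by presburger
    then show ?thesis using that by blast
  qed
  let ?fw = "t vFW 0" and ?u = "t vFU 0" and ?v = "t vFV 0"
  have merge: "wp X merge_c ?Q (t(vMG := f))" if ff: "t vFF 0 \<noteq> 0" and le: "nb = 0 \<or> 6 * ?fw \<le> nb" for f
  proof -
    let ?t = "t(vMG := f)"
    have uv: "?u < n" "?v < n" "s vLAB ?u \<noteq> s vLAB ?v" "?fw = w ?u ?v"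
      and min: "\<forall>a<n. \<forall>b<n. s vLAB a \<noteq> s vLAB b \<longrightarrow> w ?u ?v \<le> w a b"
      using mc ff by (auto simp: min_cross_def)
    have "?u \<noteq> ?v" using uv(3) by auto
    have "graph_data n k w ?t" by (rule graph_data_cong[OF data]) (simp_all add: eq)
    then have "wp X merge_c (\<lambda>s'. s' vB 0 = 6 * ?fw \<and>
      (\<forall>z<n. s' vLAB z = (if ?t vLAB z = ?t vLAB ?v then ?t vLAB ?u else ?t vLAB z)) \<and>
      s' vNX = (?t vNX)(?u := ?t vNX ?v, ?v := ?t vNX ?u)) ?t"
      by (rule wp_merge) (use \<open>n \<le> X\<close> \<open>?u \<noteq> ?v\<close> in simp_all)
    then show ?thesis
    proof (rule wp_mono)
      fix s' assume "s' vB 0 = 6 * ?fw \<and>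
        (\<forall>z<n. s' vLAB z = (if ?t vLAB z = ?t vLAB ?v then ?t vLAB ?u else ?t vLAB z)) \<and>
        s' vNX = (?t vNX)(?u := ?t vNX ?v, ?v := ?t vNX ?u)"
      then have s': "s' vB 0 = 6 * w ?u ?v"
        "\<forall>z<n. s' vLAB z = (if s vLAB z = s vLAB ?v then s vLAB ?u else s vLAB z)"
        "\<forall>z<n. s' vNX z = ((s vNX)(?u := s vNX ?v, ?v := s vNX ?u)) z"
        using eq uv(4) by (simp_all cong: if_cong split del: if_split)
      have "nb = 0 \<or> 6 * w ?u ?v \<le> nb" using le uv(4) by simp
      then show "?Q s'"
        using loop_inv_merge[OF inv ch \<open>k < length ps\<close> uv(1-3) min _ s'(2,3)] unfolding s'(1) by blast
    qed
  qed
  have raise: "?Q (t(vMG := f, vB := (t vB)(0 := nb)))"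
    if "nb \<noteq> 0" and le: "t vFF 0 = 0 \<or> nb \<le> 6 * ?fw" for f
  proof -
    have "\<forall>u<n. \<forall>v<n. s vLAB u \<noteq> s vLAB v \<longrightarrow> nb \<le> 6 * w u v"
    proof (intro allI impI)
      fix u v assume uv: "u < n" "v < n" "s vLAB u \<noteq> s vLAB v"
      then have "t vFF 0 \<noteq> 0" using no_cross by blast
      then have "?fw \<le> w u v" "nb \<le> 6 * ?fw" using mc uv le by (auto simp: min_cross_def)
      then show "nb \<le> 6 * w u v" by linarith
    qed
    then show ?thesis using loop_inv_raise[OF inv ch \<open>k < length ps\<close> that(1)] eq by simp
  qed
  have found: "t vFF 0 \<noteq> 0" if nb0: "nb = 0"
  proof -
    obtain u v where "u < n" "v < n" "s vLAB u \<noteq> s vLAB v"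
      using loop_cross_exists[OF inv ch[unfolded nb0] \<open>k < length ps\<close>] by blast
    then show ?thesis using no_cross by blast
  qed
  have NB: "t vNB 0 = nb" using nb eq by simp
  have fin: "wp X (Cond (Var vMG) merge_c (vB ::= Var vNB)) ?Q (t(vMG := f))"
    if "f 0 \<noteq> 0 \<Longrightarrow> t vFF 0 \<noteq> 0" "f 0 \<noteq> 0 \<Longrightarrow> nb = 0 \<or> 6 * ?fw \<le> nb"
      and "f 0 = 0 \<Longrightarrow> nb \<noteq> 0" "f 0 = 0 \<Longrightarrow> t vFF 0 = 0 \<or> nb \<le> 6 * ?fw" for f
    by (rule wp_CondI) (use that merge raise NB in simp_all)
  show "wp X choose_c ?Q t"
    unfolding choose_c_def
    by (rule wp_AssignI, rule wp_SeqI, rule vc_wp) (auto simp: NB intro!: fin dest: found)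
qed


definition solution :: "nat list list \<Rightarrow> bool" where
  "solution ps \<longleftrightarrow> (\<exists>lab nx B nb. loop_inv lab nx B \<and> chop w B (tour n lab nx) = (ps, nb) \<and> length ps \<le> k)"

lemma wp_loop:
  assumes data: "graph_data n k w s" and "n \<le> X" and "n * ((n + 1)\<^sup>2 + 1) + (n + 1)\<^sup>2 + 1 \<le> X"
    and start: "\<forall>v<n. s vLAB v = v \<and> s vNX v = v" "s vB 0 = 0"
  shows "wp X loop_c (\<lambda>s'. \<exists>ps nb. solution ps \<and> chop_rep s' (ps, nb)) s"
proof -
  let ?c = "chop_c ;; Cond (Minus (Var vCNT) (Var vK)) step_c (vGO ::= Num 0)"
  let ?Q = "\<lambda>s'. \<exists>ps nb. solution ps \<and> chop_rep s' (ps, nb)"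
  let ?s = "upd s vGO 1"
  define I where "I s' \<longleftrightarrow> (s' vGO 0 = 1 \<and> loop_inv (s' vLAB) (s' vNX) (s' vB 0)) \<or> (s' vGO 0 = 0 \<and> ?Q s')" for s'
  \<comment> \<open>The additional 1 pays for the last round, which only clears \<open>vGO\<close>
    and does not lower the measure.\<close>
  define V where "V s' = (if s' vGO 0 = 0 then 0 else Suc (loop_measure (s' vLAB) (s' vNX) (s' vB 0)))" for s' :: memory
  have inv0: "loop_inv (s vLAB) (s vNX) 0" by (rule loop_inv_start[OF start(1)])
  have "wp X (While (Var vGO) ?c) ?Q ?s"
  proof (rule wp_WhileI_frame[where I = I and V = V])
    show "I ?s" using inv0 start(2) by (simp add: I_def)
    show "V ?s \<le> X"
    proof -
      obtain x wt where "kruskal (s vLAB) (s vNX) x wt" using inv0 unfolding loop_inv_def by blast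
      then have "length (tour n (s vLAB) (s vNX)) = n" by (rule length_tour)
      then show ?thesis using loop_measure_le[of "s vLAB" "s vNX" "s vB 0"] assms(3) by (simp add: V_def)
    qed
  next
    fix s' assume "I s'" "aval (Var vGO) s' = 0"
    then show "?Q s'" by (simp add: I_def)
  next
    fix s' assume I: "I s'" and go: "aval (Var vGO) s' \<noteq> 0" and fr: "\<And>a. a \<notin> writes ?c \<Longrightarrow> s' a = ?s a"
    have inv: "loop_inv (s' vLAB) (s' vNX) (s' vB 0)" and GO: "s' vGO 0 = 1" using I go by (auto simp: I_def)
    have data': "graph_data n k w s'"
      by (rule graph_data_cong[OF data]) (simp_all add: fr writes_chop writes_step)
    obtain x wt where kr: "kruskal (s' vLAB) (s' vNX) x wt" using inv unfolding loop_inv_def by blast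
    obtain ps nb where ch: "chop w (s' vB 0) (tour n (s' vLAB) (s' vNX)) = (ps, nb)" by (metis surj_pair)
    have "wp X chop_c (\<lambda>t. chop_rep t (ps, nb)) s'"
      using wp_chop[OF data' _ \<open>n \<le> X\<close>] kruskal_nx(1)[OF kr] ch by simp
    then show "wp X ?c (\<lambda>s''. I s'' \<and> V s'' < V s') s'"
    proof (intro wp_SeqI, rule wp_frame_mono)
      fix t assume rep: "chop_rep t (ps, nb)" and fr2: "\<And>a. a \<notin> writes chop_c \<Longrightarrow> t a = s' a"
      have eq: "t vLAB = s' vLAB" "t vNX = s' vNX" "t vB = s' vB" "t vGO = s' vGO"
        by (simp_all add: fr2 writes_chop)
      have data'': "graph_data n k w t"
        by (rule graph_data_cong[OF data']) (simp_all add: fr2 writes_chop)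
      have cnt: "t vCNT 0 = length ps" "t vK 0 = k" "t vNB 0 = nb"
        using rep data'' by (simp_all add: chop_rep_def graph_data_def)
      show "wp X (Cond (Minus (Var vCNT) (Var vK)) step_c (vGO ::= Num 0)) (\<lambda>s''. I s'' \<and> V s'' < V s') t"
      proof (rule wp_CondI)
        assume "aval (Minus (Var vCNT) (Var vK)) t \<noteq> 0"
        then have "k < length ps" using cnt by simp
        have "wp X step_c (\<lambda>u. loop_inv (u vLAB) (u vNX) (u vB 0) \<and>
          loop_measure (u vLAB) (u vNX) (u vB 0) < loop_measure (t vLAB) (t vNX) (t vB 0)) t"
          by (rule wp_step[OF data'' \<open>n \<le> X\<close> _ _ \<open>k < length ps\<close> cnt(3)]) (use inv ch in \<open>simp_all add: eq\<close>)
        then show "wp X step_c (\<lambda>s''. I s'' \<and> V s'' < V s') t"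
        proof (rule wp_frame_mono)
          fix u assume u: "loop_inv (u vLAB) (u vNX) (u vB 0) \<and>
            loop_measure (u vLAB) (u vNX) (u vB 0) < loop_measure (t vLAB) (t vNX) (t vB 0)"
            and fr3: "\<And>a. a \<notin> writes step_c \<Longrightarrow> u a = t a"
          have "u vGO 0 = 1" using GO eq by (simp add: fr3 writes_step)
          then show "I u \<and> V u < V s'" using u GO eq by (simp add: I_def V_def)
        qed
      next
        assume "aval (Minus (Var vCNT) (Var vK)) t = 0"
        then have le: "length ps \<le> k" using cnt by simp
        let ?t = "upd t vGO 0"
        have "chop_rep ?t (ps, nb)" using rep by simp
        then have "?Q ?t" using inv ch le unfolding solution_def by blast
        then show "wp X (vGO ::= Num 0) (\<lambda>s''. I s'' \<and> V s'' < V s') t"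
          using GO by (simp add: I_def V_def)
      qed
    qed
  qed
  then show ?thesis unfolding loop_c_def by (intro wp_AssignI) simp
qed

end

section \<open>Output\<close>

abbreviation "vM \<equiv> 4 :: nat"
abbreviation "vO \<equiv> 41 :: nat"
abbreviation "vI \<equiv> 42 :: nat"
abbreviation "vJ \<equiv> 43 :: nat"
abbreviation "vS \<equiv> 44 :: nat"

definition emit_c :: "aexp \<Rightarrow> com" where
  "emit_c e = Assign 1 (Var vO) e ;; Incr vO"

text \<open>\<open>vO\<close> is the next free index; index 0 of array 1 is reserved for the length,
  which is written last.\<close>

definition out_rep :: "memory \<Rightarrow> nat list \<Rightarrow> bool" where
  "out_rep s ys \<longleftrightarrow> s vO 0 = Suc (length ys) \<and> (\<forall>i<length ys. s 1 (Suc i) = ys ! i)"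

lemma out_rep_upd [simp]: "x \<notin> {1, 41} \<Longrightarrow> out_rep (s(x := f)) ys \<longleftrightarrow> out_rep s ys"
  by (simp add: out_rep_def)

lemma wp_emit:
  assumes "out_rep s ys" "aval e s = a"
  shows "wp X (emit_c e) (\<lambda>s'. out_rep s' (ys @ [a])) s"
  unfolding emit_c_def
  by (rule vc_wp) (use assms in \<open>auto simp: out_rep_def nth_append less_Suc_eq\<close>)

lemma writes_emit [simp]: "writes (emit_c e) = {1, vO}"
  by (auto simp: emit_c_def)

definition print_path_c :: com where
  "print_path_c =
    emit_c (Get vSL (Var vI)) ;;
    For vJ (Get vSL (Var vI)) (emit_c (Get vORD (Plus (Var vS) (Var vJ)))) ;;
    emit_c (Minus (Get vSL (Var vI)) (Num 1)) ;;
    For vJ (Minus (Get vSL (Var vI)) (Num 1))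
      (emit_c (Get vORD (Plus (Var vS) (Var vJ))) ;;
       emit_c (Get vORD (Plus (Var vS) (Plus (Var vJ) (Num 1))))) ;;
    vS ::= Plus (Var vS) (Get vSL (Var vI))"

definition print_c :: com where
  "print_c = vO ::= Num 1 ;; emit_c (Var vCNT) ;; vS ::= Num 0 ;;
    For vI (Var vCNT) print_path_c ;; Assign 1 (Num 0) (Minus (Var vO) (Num 1))"

lemma path_edges_map: "path_edges xs = map (\<lambda>j. (xs ! j, xs ! Suc j)) [0..<length xs - 1]"
  by (rule nth_equalityI) (auto simp: path_edges_def nth_tl)

definition path_tree :: "nat list \<Rightarrow> tree_repr" where
  "path_tree xs = (xs, path_edges xs)"

lemma encode_path_tree:
  "encode_tree (path_tree xs) =
    length xs # xs @ (length xs - 1) # concat (map (\<lambda>j. [xs ! j, xs ! Suc j]) [0..<length xs - 1])"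
  by (simp add: encode_tree_def path_tree_def path_edges_map comp_def)

lemma writes_print_path: "writes print_path_c = {1, 41, 43, 44}"
  by (auto simp: print_path_c_def)

lemma wp_print_path:
  assumes out: "out_rep s ys" and i: "s vI 0 = i" and S: "s vS 0 = b" and len: "s vSL i = length xs"
    and ord: "\<And>j. j < length xs \<Longrightarrow> s vORD (b + j) = xs ! j" and X: "length xs \<le> X"
  shows "wp X print_path_c (\<lambda>s'. out_rep s' (ys @ encode_tree (path_tree xs)) \<and> s' vS 0 = b + length xs) s"
proof -
  let ?e1 = "emit_c (Get vORD (Plus (Var vS) (Var vJ)))"
  let ?e3 = "emit_c (Get vORD (Plus (Var vS) (Plus (Var vJ) (Num 1))))"
  let ?e2 = "?e1 ;; ?e3"
  let ?E = "\<lambda>j. concat (map (\<lambda>j. [xs ! j, xs ! Suc j]) [0..<j])"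
  \<comment> \<open>What printing one path must leave intact until \<open>vS\<close> is
    advanced.\<close>
  define fr where "fr s' \<longleftrightarrow> s' vI = s vI \<and> s' vS = s vS \<and> s' vSL = s vSL \<and> s' vORD = s vORD" for s' :: memory
  have fr0: "fr s" by (simp add: fr_def)
  have loop1: "wp X (For vJ (Get vSL (Var vI)) ?e1) (\<lambda>s'. out_rep s' (zs @ xs) \<and> fr s') t"
    if t: "out_rep t zs" "fr t" for t zs
  proof (rule wp_ForI[where I = "\<lambda>j s'. out_rep s' (zs @ take j xs)" and m = "length xs"])
    show "out_rep (upd t vJ 0) (zs @ take 0 xs)"
      using t by simp
    show "aval (Get vSL (Var vI)) s' = length xs"
      if "\<And>a. a \<noteq> vJ \<Longrightarrow> a \<notin> writes ?e1 \<Longrightarrow> s' a = t a" for s'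
      using that[of vSL] that[of vI] t(2) i len by (simp add: fr_def)
    show "out_rep s' (zs @ xs) \<and> fr s'" if "out_rep s' (zs @ take (length xs) xs)"
      "\<And>a. a \<noteq> vJ \<Longrightarrow> a \<notin> writes ?e1 \<Longrightarrow> s' a = t a" for s'
      using that t(2) by (simp add: fr_def)
  next
    fix j s' assume j: "j < length xs" "out_rep s' (zs @ take j xs)" "s' vJ 0 = j"
      and f: "\<And>a. a \<noteq> vJ \<Longrightarrow> a \<notin> writes ?e1 \<Longrightarrow> s' a = t a"
    have "aval (Get vORD (Plus (Var vS) (Var vJ))) s' = xs ! j"
      using f[of vORD] f[of vS] t(2) S ord[OF j(1)] j(3) by (simp add: fr_def)
    then have "wp X ?e1 (\<lambda>s''. out_rep s'' ((zs @ take j xs) @ [xs ! j])) s'" by (rule wp_emit[OF j(2)])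
    then show "wp X ?e1 (\<lambda>s''. s'' vJ 0 = j \<and> out_rep (upd s'' vJ (Suc j)) (zs @ take (Suc j) xs)) s'"
      by (rule wp_frame_mono) (use j in \<open>simp_all add: take_Suc_conv_app_nth\<close>)
  qed (rule X)
  have loop2: "wp X (For vJ (Minus (Get vSL (Var vI)) (Num 1)) ?e2)
      (\<lambda>s'. out_rep s' (zs @ ?E (length xs - 1)) \<and> fr s') t"
    if t: "out_rep t zs" "fr t" for t zs
  proof (rule wp_ForI[where I = "\<lambda>j s'. out_rep s' (zs @ ?E j)" and m = "length xs - 1"])
    show "out_rep (upd t vJ 0) (zs @ ?E 0)"
      using t by simp
    show "aval (Minus (Get vSL (Var vI)) (Num 1)) s' = length xs - 1"
      if "\<And>a. a \<noteq> vJ \<Longrightarrow> a \<notin> writes ?e2 \<Longrightarrow> s' a = t a" for s'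
      using that[of vSL] that[of vI] t(2) i len by (simp add: fr_def)
    show "out_rep s' (zs @ ?E (length xs - 1)) \<and> fr s'" if "out_rep s' (zs @ ?E (length xs - 1))"
      "\<And>a. a \<noteq> vJ \<Longrightarrow> a \<notin> writes ?e2 \<Longrightarrow> s' a = t a" for s'
      using that t(2) by (simp add: fr_def)
    show "length xs - 1 \<le> X" using X by simp
  next
    fix j s' assume j: "j < length xs - 1" "out_rep s' (zs @ ?E j)" "s' vJ 0 = j"
      and f: "\<And>a. a \<noteq> vJ \<Longrightarrow> a \<notin> writes ?e2 \<Longrightarrow> s' a = t a"
    have ar: "s' vORD = s vORD" "s' vS 0 = b" using f[of vORD] f[of vS] t(2) S by (simp_all add: fr_def)
    have "aval (Get vORD (Plus (Var vS) (Var vJ))) s' = xs ! j"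
      using ar ord[of j] j by simp
    then have "wp X ?e1 (\<lambda>s''. out_rep s'' ((zs @ ?E j) @ [xs ! j])) s'" by (rule wp_emit[OF j(2)])
    then show "wp X ?e2 (\<lambda>s''. s'' vJ 0 = j \<and> out_rep (upd s'' vJ (Suc j)) (zs @ ?E (Suc j))) s'"
    proof (intro wp_SeqI, rule wp_frame_mono)
      fix s'' assume *: "out_rep s'' ((zs @ ?E j) @ [xs ! j])" and f2: "\<And>a. a \<notin> writes ?e1 \<Longrightarrow> s'' a = s' a"
      have "s'' vORD = s' vORD" "s'' vS = s' vS" "s'' vJ = s' vJ" by (simp_all add: f2)
      then have "aval (Get vORD (Plus (Var vS) (Plus (Var vJ) (Num 1)))) s'' = xs ! Suc j"
        using ar ord[of "Suc j"] j by simp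
      then have "wp X ?e3
          (\<lambda>s''. out_rep s'' (((zs @ ?E j) @ [xs ! j]) @ [xs ! Suc j])) s''" by (rule wp_emit[OF *])
      then show "wp X ?e3
          (\<lambda>s''. s'' vJ 0 = j \<and> out_rep (upd s'' vJ (Suc j)) (zs @ ?E (Suc j))) s''"
        by (rule wp_frame_mono) (use f2[of vJ] j(3) in simp_all)
    qed
  qed
  have emit: "wp X (emit_c e) (\<lambda>s'. out_rep s' (zs @ [a]) \<and> fr s') t" if "out_rep t zs" "fr t" "aval e t = a" for e t zs a
    by (rule wp_frame_mono, rule wp_emit[OF that(1,3)]) (use that(2) in \<open>simp add: fr_def\<close>)
  have L: "aval (Get vSL (Var vI)) t = length xs" if "fr t" for t using that i len by (simp add: fr_def)
  let ?Q = "\<lambda>s'. out_rep s' (ys @ encode_tree (path_tree xs)) \<and> s' vS 0 = b + length xs"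
  let ?c4 = "vS ::= Plus (Var vS) (Get vSL (Var vI))"
  let ?c3 = "For vJ (Minus (Get vSL (Var vI)) (Num 1)) ?e2 ;; ?c4"
  let ?c2 = "emit_c (Minus (Get vSL (Var vI)) (Num 1)) ;; ?c3"
  let ?c1 = "For vJ (Get vSL (Var vI)) ?e1 ;; ?c2"
  let ?zs = "(((ys @ [length xs]) @ xs) @ [length xs - 1])"
  have c4: "wp X ?c4 ?Q t" if t: "out_rep t (?zs @ ?E (length xs - 1))" "fr t" for t
  proof -
    have "out_rep (upd t vS (b + length xs)) (ys @ encode_tree (path_tree xs))"
      using t(1) by (simp add: encode_path_tree)
    then show ?thesis using L[OF t(2)] t(2) S by (simp add: fr_def)
  qed
  have c3: "wp X ?c3 ?Q t" if "out_rep t ?zs" "fr t" for t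
    by (rule wp_SeqI, rule wp_mono[OF loop2[OF that]], rule c4) auto
  have c2: "wp X ?c2 ?Q t" if t: "out_rep t ((ys @ [length xs]) @ xs)" "fr t" for t
  proof (rule wp_SeqI, rule wp_mono[OF emit[OF t, of _ "length xs - 1"]])
    show "aval (Minus (Get vSL (Var vI)) (Num 1)) t = length xs - 1" using L[OF t(2)] by simp
  qed (rule c3; simp)
  have c1: "wp X ?c1 ?Q t" if "out_rep t (ys @ [length xs])" "fr t" for t
    by (rule wp_SeqI, rule wp_mono[OF loop1[OF that]], rule c2) auto
  show ?thesis
    unfolding print_path_c_def
    by (rule wp_SeqI, rule wp_mono[OF emit[OF out fr0 L[OF fr0]]], rule c1) auto
qed

lemma wp_print:
  assumes rep: "chop_rep s (ps, nb)" and X: "length ps \<le> X" "\<And>xs. xs \<in> set ps \<Longrightarrow> length xs \<le> X"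
  shows "wp X print_c (\<lambda>s'. output_of s' = encode_trees (map path_tree ps)) s"
proof -
  define O' where "O' i = length ps # concat (map (\<lambda>xs. encode_tree (path_tree xs)) (take i ps))" for i
  \<comment> \<open>The start of the \<open>i\<close>-th path in \<open>vORD\<close>.\<close>
  define b where "b i = length (concat (take i ps))" for i
  have SL: "s vSL i = length (ps ! i)" if "i < length ps" for i using rep that by (simp add: chop_rep_def)
  have ORD: "s vORD (b i + j) = ps ! i ! j" if "i < length ps" "j < length (ps ! i)" for i j
  proof -
    have c: "concat ps = concat (take i ps) @ ps ! i @ concat (drop (Suc i) ps)"
      using id_take_nth_drop[OF that(1)] by (metis concat.simps(2) concat_append)
    have "b i + j < length (concat ps)" using that(2) by (subst c) (simp add: b_def)
    then have "s vORD (b i + j) = concat ps ! (b i + j)" using rep by (simp add: chop_rep_def)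
    also have "\<dots> = ps ! i ! j" using that(2) by (subst c) (simp add: b_def nth_append)
    finally show ?thesis .
  qed
  let ?t = "\<lambda>s. upd s vS 0"
  have loop: "wp X (For vI (Var vCNT) print_path_c) (\<lambda>s'. out_rep s' (O' (length ps))) (?t t)"
    if t: "out_rep t [length ps]" "t vCNT = s vCNT" "t vSL = s vSL" "t vORD = s vORD" for t
  proof (rule wp_ForI[where I = "\<lambda>i s'. out_rep s' (O' i) \<and> s' vS 0 = b i" and m = "length ps"])
    have "out_rep ((?t t)(vI := (?t t vI)(0 := 0))) [length ps]"
      using t(1) by simp
    then show "out_rep ((?t t)(vI := (?t t vI)(0 := 0))) (O' 0) \<and> ((?t t)(vI := (?t t vI)(0 := 0))) vS 0 = b 0"
      by (simp add: O'_def b_def)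
    show "aval (Var vCNT) s' = length ps" if "\<And>a. a \<noteq> vI \<Longrightarrow> a \<notin> writes print_path_c \<Longrightarrow> s' a = ?t t a" for s'
      using that[of vCNT] t(2) rep by (simp add: writes_print_path chop_rep_def)
  next
    fix i s' assume i: "i < length ps" "out_rep s' (O' i) \<and> s' vS 0 = b i" "s' vI 0 = i"
      and f: "\<And>a. a \<noteq> vI \<Longrightarrow> a \<notin> writes print_path_c \<Longrightarrow> s' a = ?t t a"
    have eq: "s' vSL = s vSL" "s' vORD = s vORD" using t by (simp_all add: f writes_print_path)
    have "wp X print_path_c (\<lambda>s''. out_rep s'' (O' i @ encode_tree (path_tree (ps ! i))) \<and>
        s'' vS 0 = b i + length (ps ! i)) s'"
      by (rule wp_print_path) (use i eq SL ORD X in auto)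
    moreover have O: "O' (Suc i) = O' i @ encode_tree (path_tree (ps ! i))" "b (Suc i) = b i + length (ps ! i)"
      using i(1) by (simp_all add: O'_def b_def take_Suc_conv_app_nth)
    ultimately have "wp X print_path_c (\<lambda>s''. out_rep s'' (O' (Suc i)) \<and> s'' vS 0 = b (Suc i)) s'" by simp
    then show "wp X print_path_c (\<lambda>s''. s'' vI 0 = i \<and> out_rep (upd s'' vI (Suc i)) (O' (Suc i)) \<and>
        (upd s'' vI (Suc i)) vS 0 = b (Suc i)) s'"
      by (rule wp_frame_mono) (use i(3) in \<open>simp_all add: writes_print_path\<close>)
  qed (use X in simp_all)
  have final: "output_of (u(1 := (u 1)(0 := u vO 0 - 1))) = encode_trees (map path_tree ps)"
    if "out_rep u (O' (length ps))" for u
  proof -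
    have O: "O' (length ps) = encode_trees (map path_tree ps)"
      by (simp add: O'_def encode_trees_def comp_def)
    have "output_of (u(1 := (u 1)(0 := u vO 0 - 1))) = map (u 1) [1..<Suc (length (O' (length ps)))]"
      using that by (auto simp: output_of_def out_rep_def)
    also have "\<dots> = O' (length ps)"
      using that by (intro nth_equalityI) (auto simp: out_rep_def simp del: upt_Suc)
    finally show ?thesis using O by simp
  qed
  have CNT: "s vCNT 0 = length ps" using rep by (simp add: chop_rep_def)
  show ?thesis
    unfolding print_c_def
  proof (rule wp_AssignI, rule wp_SeqI, rule wp_frame_mono, rule wp_emit)
    show "out_rep (s(vO := (s vO)(aval (Num 0) s := aval (Num 1) s))) []" by (simp add: out_rep_def)
    show "aval (Var vCNT) (s(vO := (s vO)(aval (Num 0) s := aval (Num 1) s))) = length ps" using CNT by simp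
  next
    fix t assume t: "out_rep t ([] @ [length ps])"
      and f: "\<And>a. a \<notin> writes (emit_c (Var vCNT)) \<Longrightarrow> t a = (s(vO := (s vO)(aval (Num 0) s := aval (Num 1) s))) a"
    have "wp X (For vI (Var vCNT) print_path_c) (\<lambda>s'. out_rep s' (O' (length ps))) (?t t)"
      by (rule loop) (use t in \<open>simp_all add: f\<close>)
    then show "wp X (vS ::= Num 0 ;; For vI (Var vCNT) print_path_c ;; Assign 1 (Num 0) (Minus (Var vO) (Num 1)))
        (\<lambda>s'. output_of s' = encode_trees (map path_tree ps)) t"
      by (intro wp_AssignI wp_SeqI) (simp, erule wp_mono, use final in simp)
  qed
qed

section \<open>Input\<close>

abbreviation "vP \<equiv> 34 :: nat"
abbreviation "vQ \<equiv> 35 :: nat"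
abbreviation "vACC \<equiv> 36 :: nat"
abbreviation "vYY \<equiv> 37 :: nat"
abbreviation "vPA \<equiv> 38 :: nat"
abbreviation "vQA \<equiv> 39 :: nat"
abbreviation "vTT \<equiv> 40 :: nat"

section \<open>Multiplication by repeated doubling\<close>

definition double_c :: com where
  "double_c = While (Minus (Plus (Var vYY) (Num 1)) (Get vPA (Var vTT)))
    (Assign vPA (Plus (Var vTT) (Num 1)) (Plus (Get vPA (Var vTT)) (Get vPA (Var vTT))) ;;
     Assign vQA (Plus (Var vTT) (Num 1)) (Plus (Get vQA (Var vTT)) (Get vQA (Var vTT))) ;;
     Incr vTT)"

definition add_up_c :: com where
  "add_up_c = While (Var vTT)
    (vTT ::= Minus (Var vTT) (Num 1) ;;
     Cond (Minus (Plus (Var vYY) (Num 1)) (Get vPA (Var vTT)))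
       (vYY ::= Minus (Var vYY) (Get vPA (Var vTT)) ;; vACC ::= Plus (Var vACC) (Get vQA (Var vTT)))
       Skip)"

definition mul_c :: com where
  "mul_c = Assign vPA (Num 0) (Num 1) ;; Assign vQA (Num 0) (Var vACC) ;; vTT ::= Num 0 ;;
    double_c ;; vACC ::= Num 0 ;; add_up_c"

text \<open>The values \<open>2 ^ i\<close> and \<open>2 ^ i * a\<close> are tabulated until
  \<open>2 ^ i\<close> exceeds \<open>y\<close>; then the binary digits of \<open>y\<close> are
  removed from the top. The number of rounds is governed by the bit length of \<open>y\<close>, not
  by its size.\<close>

lemma wp_mul:
  assumes a: "s vACC 0 = a" and y: "s vYY 0 = y" and X: "floorlog 2 y \<le> X"
  shows "wp X mul_c (\<lambda>s'. s' vACC 0 = a * y) s"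
proof -
  define tab where "tab T s' \<longleftrightarrow> (\<forall>i\<le>T. s' vPA i = 2 ^ i \<and> s' vQA i = 2 ^ i * a)" for T and s' :: memory
  define D where "D s' \<longleftrightarrow> tab (s' vTT 0) s' \<and> s' vYY 0 = y \<and> s' vTT 0 \<le> floorlog 2 y" for s'
  \<comment> \<open>\<open>vYY\<close> is the part of \<open>y\<close> still to be multiplied; only
    powers below \<open>2 ^ vTT\<close> can occur in it.\<close>
  define U where "U s' \<longleftrightarrow> tab (s' vTT 0) s' \<and> s' vTT 0 \<le> floorlog 2 y \<and> s' vYY 0 < 2 ^ s' vTT 0 \<and>
    s' vACC 0 + a * s' vYY 0 = a * y" for s'
  have double: "wp X double_c (\<lambda>s'. D s' \<and> y < 2 ^ s' vTT 0) t" if "D t" for t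
    unfolding double_c_def
  proof (rule wp_WhileI_frame[where I = D and V = "\<lambda>s'. floorlog 2 y - s' vTT 0"])
    show "D t" by fact
    show "floorlog 2 y - t vTT 0 \<le> X" using X by simp
  next
    fix s' assume D: "D s'" and "aval (Minus (Plus (Var vYY) (Num 1)) (Get vPA (Var vTT))) s' \<noteq> 0"
    then have "2 ^ s' vTT 0 \<le> y" by (simp add: D_def tab_def)
    then have "s' vTT 0 < floorlog 2 y" using floorlog_leD[of 2 y "s' vTT 0"] by (meson not_le one_less_numeral_iff semiring_norm(76))
    then show "wp X (Assign vPA (Plus (Var vTT) (Num 1)) (Plus (Get vPA (Var vTT)) (Get vPA (Var vTT))) ;;
     Assign vQA (Plus (Var vTT) (Num 1)) (Plus (Get vQA (Var vTT)) (Get vQA (Var vTT))) ;;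
     Incr vTT) (\<lambda>s''. D s'' \<and> floorlog 2 y - s'' vTT 0 < floorlog 2 y - s' vTT 0) s'"
      by (intro vc_wp) (use D in \<open>auto simp: D_def tab_def le_Suc_eq\<close>)
  next
    fix s' assume "D s'" "aval (Minus (Plus (Var vYY) (Num 1)) (Get vPA (Var vTT))) s' = 0"
    then show "D s' \<and> y < 2 ^ s' vTT 0" by (simp add: D_def tab_def)
  qed
  have up: "wp X add_up_c (\<lambda>s'. s' vACC 0 = a * y) t" if "U t" for t
    unfolding add_up_c_def
  proof (rule wp_WhileI_frame[where I = U and V = "\<lambda>s'. s' vTT 0"])
    show "U t" by fact
    show "t vTT 0 \<le> X" using X \<open>U t\<close> by (simp add: U_def)
  next
    fix s' assume U: "U s'" and "aval (Var vTT) s' \<noteq> 0"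
    then obtain T where T: "s' vTT 0 = Suc T" using not0_implies_Suc by auto
    have tab: "s' vPA T = 2 ^ T" "s' vQA T = 2 ^ T * a" "\<And>i. i \<le> T \<Longrightarrow> s' vPA i = 2 ^ i \<and> s' vQA i = 2 ^ i * a"
      using U T by (auto simp: U_def tab_def)
    have acc: "s' vACC 0 + 2 ^ T * a + a * (s' vYY 0 - 2 ^ T) = a * y" if "2 ^ T \<le> s' vYY 0"
    proof -
      have "2 ^ T * a + a * (s' vYY 0 - 2 ^ T) = a * (2 ^ T + (s' vYY 0 - 2 ^ T))"
        by (simp add: distrib_left)
      then show ?thesis using that U by (simp add: U_def)
    qed
    show "wp X (vTT ::= Minus (Var vTT) (Num 1) ;;
     Cond (Minus (Plus (Var vYY) (Num 1)) (Get vPA (Var vTT)))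
       (vYY ::= Minus (Var vYY) (Get vPA (Var vTT)) ;; vACC ::= Plus (Var vACC) (Get vQA (Var vTT)))
       Skip) (\<lambda>s''. U s'' \<and> s'' vTT 0 < s' vTT 0) s'"
      by (rule vc_wp) (use U T tab acc in \<open>auto simp: U_def tab_def\<close>)
  next
    fix s' assume "U s'" "aval (Var vTT) s' = 0"
    then show "s' vACC 0 = a * y" by (auto simp: U_def)
  qed
  let ?t = "s(vPA := (s vPA)(0 := 1), vQA := (s vQA)(0 := a), vTT := (s vTT)(0 := 0))"
  have "D ?t" using y by (simp add: D_def tab_def)
  have "wp X (double_c ;; vACC ::= Num 0 ;; add_up_c) (\<lambda>s'. s' vACC 0 = a * y) ?t"
  proof (rule wp_SeqI, rule wp_mono[OF double[OF \<open>D ?t\<close>]])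
    fix u assume u: "D u \<and> y < 2 ^ u vTT 0"
    have "U (upd u vACC 0)" using u by (simp add: U_def D_def tab_def)
    then show "wp X (vACC ::= Num 0 ;; add_up_c) (\<lambda>s'. s' vACC 0 = a * y) u"
      using up by (intro wp_AssignI) simp
  qed
  then show ?thesis unfolding mul_c_def by (intro wp_AssignI) (simp add: a)
qed

lemma writes_mul: "writes mul_c = {36, 37, 38, 39, 40}"
  by (auto simp: mul_c_def double_c_def add_up_c_def)

section \<open>Clearing the denominators\<close>

definition scale_c :: com where
  "scale_c = For vP (Var vM)
    (vACC ::= Get 0 (Plus (Num 3) (Plus (Var vP) (Var vP))) ;;
     For vQ (Var vM) (Cond (Neq (Var vP) (Var vQ))
       (vYY ::= Get 0 (Plus (Num 4) (Plus (Var vQ) (Var vQ))) ;; mul_c) Skip) ;;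
     Assign vW (Var vP) (Var vACC))"

lemma prod_skip_Suc:
  fixes b :: "nat \<Rightarrow> nat"
  shows "(\<Prod>q\<in>{..<Suc j} - {p}. b q) = (\<Prod>q\<in>{..<j} - {p}. b q) * (if j = p then 1 else b j)"
proof (cases "j = p")
  case True
  then have "{..<Suc j} - {p} = {..<j} - {p}" by auto
  then show ?thesis using True by simp
next
  case False
  then have "{..<Suc j} - {p} = insert j ({..<j} - {p})" by auto
  then show ?thesis using False by (simp add: mult.commute)
qed

text \<open>Every multiplier is a single denominator of the input, so \<open>X\<close> bounds the
  rounds of each multiplication although the accumulated product may be far longer.\<close>

lemma wp_scale:
  fixes a b :: "nat \<Rightarrow> nat"
  assumes M: "s vM 0 = m" "m \<le> X" and a: "\<And>p. p < m \<Longrightarrow> s 0 (3 + (p + p)) = a p"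
    and b: "\<And>p. p < m \<Longrightarrow> s 0 (4 + (p + p)) = b p" "\<And>p. p < m \<Longrightarrow> floorlog 2 (b p) \<le> X"
  shows "wp X scale_c (\<lambda>s'. \<forall>p<m. s' vW p = a p * (\<Prod>q\<in>{..<m} - {p}. b q)) s"
proof -
  let ?body = "Cond (Neq (Var vP) (Var vQ))
       (vYY ::= Get 0 (Plus (Num 4) (Plus (Var vQ) (Var vQ))) ;; mul_c) Skip"
  let ?in = "For vQ (Var vM) ?body"
  let ?c = "vACC ::= Get 0 (Plus (Num 3) (Plus (Var vP) (Var vP))) ;; ?in ;; Assign vW (Var vP) (Var vACC)"
  define g where "g p = a p * (\<Prod>q\<in>{..<m} - {p}. b q)" for p
  have inner: "wp X ?in (\<lambda>s'. s' vACC 0 = g p) t"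
    if t: "t 0 = s 0" "t vM = s vM" "t vP 0 = p" "t vACC 0 = a p" for t p
  proof (rule wp_ForI[where I = "\<lambda>j s'. s' vACC 0 = a p * (\<Prod>q\<in>{..<j} - {p}. b q)" and m = m])
    show "aval (Var vM) s' = m" if "\<And>a. a \<noteq> vQ \<Longrightarrow> a \<notin> writes ?body \<Longrightarrow> s' a = t a" for s'
      using that[of vM] t M by (simp add: writes_mul)
  next
    fix j s' assume j: "j < m" "s' vACC 0 = a p * (\<Prod>q\<in>{..<j} - {p}. b q)" "s' vQ 0 = j"
      and f: "\<And>a. a \<noteq> vQ \<Longrightarrow> a \<notin> writes ?body \<Longrightarrow> s' a = t a"
    have eq: "s' 0 = s 0" "s' vP 0 = p" using t by (simp_all add: f writes_mul)
    show "wp X ?body (\<lambda>s''. s'' vQ 0 = j \<and>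
      (upd s'' vQ (Suc j)) vACC 0 = a p * (\<Prod>q\<in>{..<Suc j} - {p}. b q)) s'"
    proof (rule wp_CondI)
      assume "aval (Neq (Var vP) (Var vQ)) s' \<noteq> 0"
      then have "j \<noteq> p" using eq j(3) by auto
      let ?s' = "upd s' vYY (b j)"
      have "wp X mul_c (\<lambda>u. u vACC 0 = s' vACC 0 * b j) ?s'"
        by (rule wp_mul) (use b(2) j(1) in simp_all)
      then have "wp X mul_c (\<lambda>s''. s'' vQ 0 = j \<and>
        (upd s'' vQ (Suc j)) vACC 0 = a p * (\<Prod>q\<in>{..<Suc j} - {p}. b q)) ?s'"
        by (rule wp_frame_mono)
          (use j \<open>j \<noteq> p\<close> in \<open>simp_all add: writes_mul prod_skip_Suc mult.assoc\<close>)
      then show "wp X (vYY ::= Get 0 (Plus (Num 4) (Plus (Var vQ) (Var vQ))) ;; mul_c) (\<lambda>s''. s'' vQ 0 = j \<and>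
        (upd s'' vQ (Suc j)) vACC 0 = a p * (\<Prod>q\<in>{..<Suc j} - {p}. b q)) s'"
        using eq j b(1)[of j] by (intro wp_AssignI) simp
    next
      assume "aval (Neq (Var vP) (Var vQ)) s' = 0"
      then have "j = p" using eq j(3) by simp
      then show "wp X Skip (\<lambda>s''. s'' vQ 0 = j \<and>
        (upd s'' vQ (Suc j)) vACC 0 = a p * (\<Prod>q\<in>{..<Suc j} - {p}. b q)) s'"
        using j by (simp add: prod_skip_Suc)
    qed
  qed (use t M in \<open>simp_all add: g_def\<close>)
  show ?thesis
    unfolding scale_c_def g_def[symmetric]
  proof (rule wp_ForI[where I = "\<lambda>p s'. \<forall>q<p. s' vW q = g q" and m = m])
    show "aval (Var vM) s' = m" if "\<And>a. a \<noteq> vP \<Longrightarrow> a \<notin> writes ?c \<Longrightarrow> s' a = s a" for s'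
      using that[of vM] M by (simp add: writes_mul)
  next
    fix p s' assume p: "p < m" "\<forall>q<p. s' vW q = g q" "s' vP 0 = p"
      and f: "\<And>a. a \<noteq> vP \<Longrightarrow> a \<notin> writes ?c \<Longrightarrow> s' a = s a"
    have eq: "s' 0 = s 0" "s' vM = s vM" by (simp_all add: f writes_mul)
    let ?s' = "upd s' vACC (a p)"
    have "wp X ?in (\<lambda>u. u vACC 0 = g p) ?s'" by (rule inner) (use eq p in simp_all)
    then have "wp X (?in ;; Assign vW (Var vP) (Var vACC)) (\<lambda>s''. s'' vP 0 = p \<and>
        (\<forall>q<Suc p. (upd s'' vP (Suc p)) vW q = g q)) ?s'"
      by (intro wp_SeqI, elim wp_frame_mono) (use p in \<open>simp add: writes_mul less_Suc_eq\<close>)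
    then show "wp X ?c (\<lambda>s''. s'' vP 0 = p \<and>
        (\<forall>q<Suc p. (upd s'' vP (Suc p)) vW q = g q)) s'"
      using eq p a[of p] by (intro wp_AssignI) simp
  qed (use M in simp_all)
qed

lemma writes_scale: "writes scale_c = {6, 34, 35, 36, 37, 38, 39, 40}"
  by (auto simp: scale_c_def writes_mul)

definition init_c :: com where
  "init_c = vN ::= Get 0 (Num 1) ;; vK ::= Get 0 (Num 2) ;;
    For vX (Var vN) (Assign vOFF (Var vX) (Var vM) ;; vM ::= Plus (Var vM) (Var vN) ;;
      Assign vLAB (Var vX) (Var vX) ;; Assign vNX (Var vX) (Var vX))"

definition init_rep :: "nat \<Rightarrow> nat \<Rightarrow> memory \<Rightarrow> bool" where
  "init_rep n j s \<longleftrightarrow> (\<forall>u<j. s vOFF u = u * n \<and> s vLAB u = u \<and> s vNX u = u)"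

lemma wp_init:
  assumes n: "s 0 1 = n" and k: "s 0 2 = k" and M: "s vM 0 = 0" and "n \<le> X"
  shows "wp X init_c (\<lambda>s'. s' vN 0 = n \<and> s' vK 0 = k \<and> s' vM 0 = n * n \<and>
    init_rep n n s') s"
proof -
  let ?c = "Assign vOFF (Var vX) (Var vM) ;; vM ::= Plus (Var vM) (Var vN) ;;
      Assign vLAB (Var vX) (Var vX) ;; Assign vNX (Var vX) (Var vX)"
  let ?s = "s(vN := (s vN)(0 := n), vK := (s vK)(0 := k))"
  have "wp X (For vX (Var vN) ?c) (\<lambda>s'. s' vN 0 = n \<and> s' vK 0 = k \<and> s' vM 0 = n * n \<and>
    init_rep n n s') ?s"
  proof (rule wp_ForI[where m = n and I = "\<lambda>j s'. s' vM 0 = j * n \<and>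
      init_rep n j s'"])
    show "aval (Var vN) s' = n" if "\<And>a. a \<noteq> vX \<Longrightarrow> a \<notin> writes ?c \<Longrightarrow> s' a = ?s a" for s'
      using that[of vN] by simp
  next
    fix j s' assume j: "j < n" "s' vM 0 = j * n \<and> init_rep n j s'"
      "s' vX 0 = j" and f: "\<And>a. a \<noteq> vX \<Longrightarrow> a \<notin> writes ?c \<Longrightarrow> s' a = ?s a"
    have "s' vN 0 = n" by (simp add: f)
    then show "wp X ?c (\<lambda>s''. s'' vX 0 = j \<and> (upd s'' vX (Suc j)) vM 0 = Suc j * n \<and>
      init_rep n (Suc j) (upd s'' vX (Suc j))) s'"
      by (intro vc_wp) (use j in \<open>auto simp: init_rep_def less_Suc_eq\<close>)
  next
    fix s' assume I: "s' vM 0 = n * n \<and> init_rep n n s'"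
      and f: "\<And>a. a \<noteq> vX \<Longrightarrow> a \<notin> writes ?c \<Longrightarrow> s' a = ?s a"
    then show "s' vN 0 = n \<and> s' vK 0 = k \<and> s' vM 0 = n * n \<and>
      init_rep n n s'" by simp
  qed (use M \<open>n \<le> X\<close> in \<open>simp_all add: init_rep_def\<close>)
  then show ?thesis unfolding init_c_def using n k by (intro wp_AssignI) simp
qed

lemma writes_init: "writes init_c = {2, 3, 4, 5, 7, 8, 27}"
  by (auto simp: init_c_def)

definition tree_cover_c :: com where
  "tree_cover_c = init_c ;; scale_c ;; loop_c ;; print_c"


section \<open>Encoded instances and the length of the output\<close>

lemma nth_concat_uniform:
  assumes "\<And>i. i < m \<Longrightarrow> length (f i) = l" "i < m" "j < l"
  shows "concat (map f [0..<m]) ! (i * l + j) = f i ! j"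
  using assms
proof (induction m)
  case (Suc m)
  have len: "length (concat (map f [0..<m'])) = m' * l" if "m' \<le> Suc m" for m'
    using that
  proof (induction m')
    case (Suc m')
    then show ?case using Suc.prems \<open>\<And>i. i < Suc m \<Longrightarrow> length (f i) = l\<close> by simp
  qed simp
  show ?case
  proof (cases "i = m")
    case True
    then show ?thesis using len[of m] Suc.prems by (simp add: nth_append)
  next
    case False
    then have "i < m" using Suc.prems by simp
    then have "i * l + j < m * l"
      using \<open>j < l\<close> mult_le_mono1[of "Suc i" m l] by simp
    then show ?thesis using len[of m] Suc.prems Suc.IH \<open>i < m\<close> by (simp add: nth_append)
  qed
qed simp

lemma length_concat_uniform:
  "(\<And>i. i < m \<Longrightarrow> length (f i) = l) \<Longrightarrow> length (concat (map f [0..<m])) = m * l"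
  by (induction m) auto

definition numer :: "rat \<Rightarrow> nat" where
  "numer r = nat (fst (quotient_of r))"

definition denom :: "rat \<Rightarrow> nat" where
  "denom r = nat (snd (quotient_of r))"

lemma encode_rat_alt: "encode_rat r = [numer r, denom r]"
  by (simp add: encode_rat_def numer_def denom_def split: prod.split)

lemma denom_pos: "0 < denom r"
  using quotient_of_denom_pos'[of r] by (simp add: denom_def)

lemma of_rat_numer_denom:
  assumes "0 \<le> r"
  shows "real_of_rat r = numer r / denom r"
proof -
  obtain a b where q: "quotient_of r = (a, b)" by (metis surj_pair)
  have b: "0 < b" using quotient_of_denom_pos[OF q] .
  have r: "r = of_int a / of_int b" using quotient_of_div[OF q] .
  have "0 \<le> a" using assms b unfolding r by (simp add: zero_le_divide_iff)
  then have "real (numer r) = of_int a" "real (denom r) = of_int b"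
    using b by (simp_all add: numer_def denom_def q)
  then show ?thesis by (simp add: r of_rat_divide)
qed

lemma encode_instance_props:
  shows "length (encode_instance n d k) = 2 + 2 * n * n"
    and "u < n \<Longrightarrow> v < n \<Longrightarrow> encode_instance n d k ! (2 + 2 * (u * n + v)) = numer (d u v)"
    and "u < n \<Longrightarrow> v < n \<Longrightarrow> encode_instance n d k ! (3 + 2 * (u * n + v)) = denom (d u v)"
proof -
  let ?f = "\<lambda>u. concat (map (\<lambda>v. encode_rat (d u v)) [0..<n])"
  have e: "encode_instance n d k = n # k # concat (map ?f [0..<n])" by (simp add: encode_instance_def)
  have l: "length (?f u) = n * 2" for u
    by (rule length_concat_uniform) (simp add: encode_rat_alt)
  show "length (encode_instance n d k) = 2 + 2 * n * n"
    using length_concat_uniform[of n ?f "n * 2"] l by (simp add: e)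
  have *: "concat (map ?f [0..<n]) ! (u * (n * 2) + (v * 2 + j)) = encode_rat (d u v) ! j"
    if "u < n" "v < n" "j < 2" for u v j
  proof -
    have "v * 2 + j < n * 2" using that by linarith
    then have "concat (map ?f [0..<n]) ! (u * (n * 2) + (v * 2 + j)) = ?f u ! (v * 2 + j)"
      using l that(1) by (intro nth_concat_uniform) auto
    also have "\<dots> = encode_rat (d u v) ! j"
      using that by (intro nth_concat_uniform) (auto simp: encode_rat_alt)
    finally show ?thesis .
  qed
  show "encode_instance n d k ! (2 + 2 * (u * n + v)) = numer (d u v)" if "u < n" "v < n"
    using *[OF that, of 0] by (simp add: e encode_rat_alt algebra_simps)
  show "encode_instance n d k ! (3 + 2 * (u * n + v)) = denom (d u v)" if "u < n" "v < n"
    using *[OF that, of 1] by (simp add: e encode_rat_alt algebra_simps eval_nat_numeral)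
qed

lemma bit_size_ge:
  "length xs \<le> bit_size xs" "x \<in> set xs \<Longrightarrow> floorlog 2 x \<le> bit_size xs"
  by (induction xs) (auto simp: bit_size_def)

text \<open>An inequality suffices: passing from the list of steps to a set of unordered pairs can
  only drop nonnegative terms.\<close>

lemma tree_weight_path:
  assumes d: "\<And>u v. u \<in> set xs \<Longrightarrow> v \<in> set xs \<Longrightarrow> 0 \<le> d u v \<and> d u v = d v u"
  shows "tree_weight d (tree_of (path_tree xs)) \<le> path_weight d xs"
    and "0 \<le> tree_weight d (tree_of (path_tree xs))"
proof -
  have in_xs: "u \<in> set xs" "v \<in> set xs" if "(u, v) \<in> set (path_edges xs)" for u v
    using that by (auto simp: set_path_edges)
  have edge: "d (Min {u, v}) (Max {u, v}) = d u v" if "(u, v) \<in> set (path_edges xs)" for u v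
    using d[OF in_xs(1,2)[OF that]] by (auto simp: min_def max_def)
  let ?E = "set (path_edges xs)"
  have eq: "tree_weight d (tree_of (path_tree xs)) = (\<Sum>e\<in>(\<lambda>(u, v). {u, v}) ` ?E. d (Min e) (Max e))"
    by (simp add: tree_weight_def tree_of_def path_tree_def)
  have pos: "0 \<le> d (Min e) (Max e)" if e: "e \<in> (\<lambda>(u, v). {u, v}) ` ?E" for e
  proof -
    obtain u v where "e = {u, v}" "(u, v) \<in> ?E" using e by auto
    then show ?thesis using edge[of u v] d[OF in_xs[of u v]] by simp
  qed
  show "0 \<le> tree_weight d (tree_of (path_tree xs))" unfolding eq using pos by (rule sum_nonneg)
  have "(\<Sum>e\<in>(\<lambda>(u, v). {u, v}) ` ?E. d (Min e) (Max e)) \<le>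
      sum (edge_weight d \<circ> (\<lambda>(u, v). {u, v})) ?E"
    by (rule sum_image_le) (use pos in auto)
  also have "\<dots> = (\<Sum>(u, v)\<in>?E. d u v)"
    using edge by (intro sum.cong) auto
  also have "\<dots> \<le> (\<Sum>(u, v)\<leftarrow>path_edges xs. d u v)"
  proof -
    have *: "(\<Sum>a\<in>set L. f a) \<le> sum_list (map f L)" if "\<And>a. a \<in> set L \<Longrightarrow> 0 \<le> f a" for L and f :: "nat \<times> nat \<Rightarrow> real"
      using that
    proof (induction L)
      case (Cons a L)
      then show ?case by (cases "a \<in> set L") (auto simp: insert_absorb add_increasing)
    qed simp
    show ?thesis by (rule *) (use d in_xs in auto)
  qed
  finally show "tree_weight d (tree_of (path_tree xs)) \<le> path_weight d xs"
    unfolding eq by (simp add: path_weight_def)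
qed

lemma length_encode_path_trees:
  "length (encode_trees (map path_tree ps)) \<le> 1 + 2 * length ps + 3 * length (concat ps)"
proof -
  have "length (encode_tree (path_tree xs)) \<le> 2 + 3 * length xs" for xs
  proof -
    have "length (concat (map (\<lambda>j. [xs ! j, xs ! Suc j]) [0..<m])) = m * 2" for m
      by (rule length_concat_uniform) simp
    then show ?thesis by (simp add: encode_path_tree)
  qed
  note len = this
  have "length (concat (map (\<lambda>xs. encode_tree (path_tree xs)) ps)) \<le> 2 * length ps + 3 * length (concat ps)"
  proof (induction ps)
    case (Cons xs ps)
    then show ?case using len[of xs] by simp
  qed simp
  then show ?thesis by (simp add: encode_trees_def comp_def)
qed


text \<open>The paths are nonempty and disjoint, so there are at most \<open>n\<close> of them; this
  bounds the printing loops and the length of the output.\<close>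

lemma (in nat_weights) solution_facts:
  assumes "solution ps"
  shows "distinct (concat ps)" "set (concat ps) = {..<n}" "[] \<notin> set ps"
    and "length (concat ps) = n" "length ps \<le> n"
proof -
  obtain lab nx B nb where *: "loop_inv lab nx B" "chop w B (tour n lab nx) = (ps, nb)"
    using assms unfolding solution_def by blast
  note res = chop_result[OF *]
  show "distinct (concat ps)" "set (concat ps) = {..<n}" "[] \<notin> set ps" by (fact res(1-3))+
  show len: "length (concat ps) = n" using distinct_card[OF res(1)] res(2) by simp
  have "length qs \<le> length (concat qs)" if "[] \<notin> set qs" for qs :: "nat list list"
    using that
  proof (induction qs)
    case (Cons q qs)
    then show ?case by (cases q) auto
  qed simp
  from this[OF res(3)] show "length ps \<le> n" using len by simp
qed

lemma wp_tree_cover: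
  fixes d :: "nat \<Rightarrow> nat \<Rightarrow> rat" and n k :: nat
  defines "w \<equiv> \<lambda>u v. numer (d u v) * (\<Prod>q\<in>{..<n * n} - {u * n + v}. denom (d (q div n) (q mod n)))"
  assumes w: "nat_weights n k w"
    and X: "n * n \<le> X" "n * ((n + 1)\<^sup>2 + 1) + (n + 1)\<^sup>2 + 1 \<le> X" "bit_size (encode_instance n d k) \<le> X"
  shows "wp X tree_cover_c (\<lambda>s'. \<exists>ps. nat_weights.solution n k w ps \<and> output_of s' = encode_trees (map path_tree ps))
    (input_memory (encode_instance n d k))"
proof -
  interpret nat_weights n k w by (rule w)
  let ?xs = "encode_instance n d k"
  let ?s = "input_memory ?xs"
  let ?a = "\<lambda>p. numer (d (p div n) (p mod n))" and ?b = "\<lambda>p. denom (d (p div n) (p mod n))"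
  note ei = encode_instance_props(1)[of n d k] encode_instance_props(2,3)[of _ n _ d k]
  have "n \<le> n * n" by (cases n) auto
  then have nX: "n \<le> X" using X(1) by (rule order_trans)
  have pq: "p div n < n" "p mod n < n" "p div n * n + p mod n = p" if "p < n * n" for p
  proof -
    have "0 < n" using that by (cases n) auto
    then show "p div n < n" "p mod n < n" using that by (simp_all add: less_mult_imp_div_less)
    show "p div n * n + p mod n = p" by simp
  qed
  have s0: "?s 0 i = (length ?xs # ?xs) ! i" if "i \<le> length ?xs" for i
    using that by (simp add: input_memory_def)
  have in_a: "?s 0 (3 + (p + p)) = ?a p" and in_b: "?s 0 (4 + (p + p)) = ?b p" and b_X: "floorlog 2 (?b p) \<le> X"
    if p: "p < n * n" for p
  proof -
    have l: "3 + (p + p) \<le> length ?xs" "4 + (p + p) \<le> length ?xs" using p by (simp_all add: ei(1))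
    \<comment> \<open>The fractions are preceded by \<open>n\<close> and \<open>k\<close>, and in
      memory also by the length of the list, which shifts all indices by one.\<close>
    have "3 + (p + p) = Suc (2 + 2 * p)" "4 + (p + p) = Suc (3 + 2 * p)" by simp_all
    then have "?s 0 (3 + (p + p)) = ?xs ! (2 + 2 * p)" "?s 0 (4 + (p + p)) = ?xs ! (3 + 2 * p)"
      using s0[OF l(1)] s0[OF l(2)] by (metis nth_Cons_Suc)+
    moreover have "?xs ! (2 + 2 * p) = ?a p" "?xs ! (3 + 2 * p) = ?b p"
      using ei(2,3)[OF pq(1,2)[OF p]] unfolding pq(3)[OF p] by auto
    ultimately show "?s 0 (3 + (p + p)) = ?a p" "?s 0 (4 + (p + p)) = ?b p" by auto
    have "3 + 2 * p < length ?xs" using l(2) by simp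
    then have "?b p \<in> set ?xs" using \<open>?xs ! (3 + 2 * p) = ?b p\<close> nth_mem by metis
    then show "floorlog 2 (?b p) \<le> X" using bit_size_ge(2) X(3) order_trans by blast
  qed
  have zero: "?s a i = 0" if "a \<noteq> 0" for a i using that by (simp add: input_memory_def)
  have len2: "2 \<le> length ?xs" by (simp add: ei(1))
  have "?s 0 1 = n" "?s 0 2 = k" using s0[of 1] s0[of 2] len2 by (simp_all add: encode_instance_def eval_nat_numeral)
  then have init: "wp X init_c (\<lambda>s'. s' vN 0 = n \<and> s' vK 0 = k \<and> s' vM 0 = n * n \<and>
    init_rep n n s') ?s"
    using wp_init[of ?s n k X] zero nX by simp
  show ?thesis
    unfolding tree_cover_c_def
  proof (rule wp_SeqI, rule wp_frame_mono[OF init])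
    fix s1 assume i: "s1 vN 0 = n \<and> s1 vK 0 = k \<and> s1 vM 0 = n * n \<and>
      init_rep n n s1"
      and f1: "\<And>a. a \<notin> writes init_c \<Longrightarrow> s1 a = ?s a"
    have in1: "s1 0 = ?s 0" "s1 vB 0 = 0" using zero by (simp_all add: f1 writes_init)
    have scale: "wp X scale_c (\<lambda>s'. \<forall>p<n * n. s' vW p = ?a p * (\<Prod>q\<in>{..<n * n} - {p}. ?b q)) s1"
      by (rule wp_scale) (use i X(1) in1 in_a in_b b_X in auto)
    show "wp X (scale_c ;; loop_c ;; print_c) (\<lambda>s'. \<exists>ps. solution ps \<and> output_of s' = encode_trees (map path_tree ps)) s1"
    proof (rule wp_SeqI, rule wp_frame_mono[OF scale])
      fix s2 assume W: "\<forall>p<n * n. s2 vW p = ?a p * (\<Prod>q\<in>{..<n * n} - {p}. ?b q)"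
        and f2: "\<And>a. a \<notin> writes scale_c \<Longrightarrow> s2 a = s1 a"
      have eq: "s2 vN = s1 vN" "s2 vK = s1 vK" "s2 vOFF = s1 vOFF" "s2 vLAB = s1 vLAB" "s2 vNX = s1 vNX" "s2 vB = s1 vB"
        by (simp_all add: f2 writes_scale)
      have "s2 vW (u * n + v) = w u v" if "u < n" "v < n" for u v
      proof -
        have "u * n + v < n * n" using that mult_le_mono1[of "Suc u" n n] by simp
        then show ?thesis using W that by (simp add: w_def)
      qed
      then have data: "graph_data n k w s2" using i eq by (simp add: graph_data_def init_rep_def)
      have loop: "wp X loop_c (\<lambda>s'. \<exists>ps nb. solution ps \<and> chop_rep s' (ps, nb)) s2"
        by (rule wp_loop[OF data nX X(2)]) (use i eq in1 in \<open>simp_all add: init_rep_def\<close>)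
      show "wp X (loop_c ;; print_c) (\<lambda>s'. \<exists>ps. solution ps \<and> output_of s' = encode_trees (map path_tree ps)) s2"
      proof (rule wp_SeqI, rule wp_mono[OF loop], elim exE conjE)
        fix s3 ps nb
        assume *: "solution ps" "chop_rep s3 (ps, nb)"
        note res = solution_facts[OF *(1)]
        have "length xs \<le> length (concat ps)" if "xs \<in> set ps" for xs
          using that by (induction ps) auto
        then have "wp X print_c (\<lambda>s'. output_of s' = encode_trees (map path_tree ps)) s3"
          using wp_print[OF *(2)] res(4,5) nX by (metis order_trans)
        then show "wp X print_c (\<lambda>s'. \<exists>ps. solution ps \<and> output_of s' = encode_trees (map path_tree ps)) s3"
          by (rule wp_mono) (use * in blast)
      qed
    qed
  qed
qed

section \<open>The approximation guarantee of the program\<close>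

lemma path_weight_scale:
  "path_weight (\<lambda>u v. c * f u v) xs = (c :: real) * path_weight f xs"
  by (induction xs rule: induct_list012) (simp_all add: distrib_left)

lemma tree_weight_scale:
  assumes T: "is_tree T" "fst T \<subseteq> {..<n}" and g: "\<And>u v. u < n \<Longrightarrow> v < n \<Longrightarrow> g u v = c * f u v"
  shows "tree_weight g T = c * tree_weight f T"
proof -
  have "edge_weight g e = c * edge_weight f e" if "e \<in> snd T" for e
    using tree_edge(1,3,4)[OF T(1) that] T(2) by (intro g) auto
  then show ?thesis by (simp add: tree_weight_def sum_distrib_left)
qed

text \<open>Multiplying a numerator by all the other denominators scales the distance by the product
  \<open>D\<close> of all denominators. The guarantee is homogeneous, so no least common denominator
  has to be computed.\<close>

lemma common_denominator:
  fixes d :: "nat \<Rightarrow> nat \<Rightarrow> rat" and n :: nat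
  defines "D \<equiv> \<Prod>q<n * n. denom (d (q div n) (q mod n))"
  assumes "u < n" "v < n" "0 \<le> d u v"
  shows "real (numer (d u v) * (\<Prod>q\<in>{..<n * n} - {u * n + v}. denom (d (q div n) (q mod n)))) =
    real D * real_of_rat (d u v)"
proof -
  have p: "u * n + v < n * n" using assms(2,3) mult_le_mono1[of "Suc u" n n] by simp
  have "D = denom (d u v) * (\<Prod>q\<in>{..<n * n} - {u * n + v}. denom (d (q div n) (q mod n)))"
    unfolding D_def using assms(3) p by (subst prod.remove[of _ "u * n + v"]) auto
  then show ?thesis using denom_pos[of "d u v"] of_rat_numer_denom[OF assms(4)] by simp
qed

theorem theorem6:
  shows "\<exists>(c :: com) (q :: nat poly). \<forall>(n :: nat) (d :: nat \<Rightarrow> nat \<Rightarrow> rat) (k :: nat).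
    Metric_space {..<n} (\<lambda>u v. real_of_rat (d u v)) \<longrightarrow> 1 \<le> k \<longrightarrow>
    (\<exists>Ts :: tree_repr list.
      computes_within c (encode_instance n d k) (encode_trees Ts)
        (poly q (bit_size (encode_instance n d k))) \<and>
      tree_cover {..<n} (tree_of ` set Ts) \<and>
      card (tree_of ` set Ts) \<le> k \<and>
      (\<forall>(p :: real) (Us :: (nat set \<times> nat set set) list).
        1 \<le> p \<longrightarrow> length Us = k \<longrightarrow> tree_cover {..<n} (set Us) \<longrightarrow>
        (\<Sum>T\<in>tree_of ` set Ts. tree_weight (\<lambda>u v. real_of_rat (d u v)) T powr p) powr (1 / p)
        \<le> 9 * (\<Sum>i<k. tree_weight (\<lambda>u v. real_of_rat (d u v)) (Us ! i) powr p) powr (1 / p)))"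
proof -
  obtain qt :: "nat poly" where qt: "\<forall>X. tbound X tree_cover_c = poly qt X" using tbound_poly by blast
  let ?x = "[:0, 1:] :: nat poly"
  \<comment> \<open>Bounds every loop count: the initial measure of the main loop with
    \<open>n\<close> replaced by the input size, plus the input size for the remaining
    loops.\<close>
  define qX :: "nat poly" where "qX = ?x * ((?x + 1)\<^sup>2 + 1) + (?x + 1)\<^sup>2 + 1 + ?x"
  have qX: "poly qX N = N * ((N + 1)\<^sup>2 + 1) + (N + 1)\<^sup>2 + 1 + N" for N by (simp add: qX_def)
  \<comment> \<open>The affine summand pays for the length of the output, which
    \<open>computes_within\<close> charges as well.\<close>
  define q where "q = pcompose qt qX + [:1, 5:]"
  have q: "poly q N = poly qt (poly qX N) + (1 + 5 * N)" for N by (simp add: q_def poly_pcompose)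
  show ?thesis
  proof (rule exI[of _ tree_cover_c], rule exI[of _ q], intro allI impI)
    fix n :: nat and d :: "nat \<Rightarrow> nat \<Rightarrow> rat" and k :: nat
    assume metric: "Metric_space {..<n} (\<lambda>u v. real_of_rat (d u v))" and k: "1 \<le> k"
    let ?d = "\<lambda>u v. real_of_rat (d u v)"
    define D where "D = (\<Prod>q<n * n. denom (d (q div n) (q mod n)))"
    define w where "w u v = numer (d u v) * (\<Prod>q\<in>{..<n * n} - {u * n + v}. denom (d (q div n) (q mod n)))" for u v
    interpret M: Metric_space "{..<n}" ?d by (rule metric)
    have D: "0 < D" unfolding D_def using denom_pos by (intro prod_pos) auto
    have d_nonneg: "0 \<le> d u v" for u v using M.nonneg[of u v] by simp
    have w: "real (w u v) = real D * ?d u v" if "u < n" "v < n" for u v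
      unfolding w_def D_def by (rule common_denominator[OF that d_nonneg])
    interpret nat_weights n k w
    proof
      fix u v z assume uvz: "u < n" "v < n" "z < n"
      have "real (w u z) \<le> real (w u v) + real (w v z)"
        using M.triangle[of u v z] uvz D by (simp add: w flip: distrib_left)
      then show "w u z \<le> w u v + w v z" by linarith
    next
      fix u v assume uv: "u < n" "v < n"
      have "real (w u v) = real (w v u)" using M.commute[of u v] uv by (simp add: w)
      then show "w u v = w v u" by simp
    next
      fix u assume u: "u < n"
      have "real (w u u) = 0" using M.mdist_zero[of u] u by (simp add: w)
      then show "w u u = 0" by simp
    qed (rule k)
    let ?xs = "encode_instance n d k"
    let ?N = "bit_size ?xs"
    let ?X = "poly qX ?N"
    have "2 + 2 * n * n \<le> ?N" using bit_size_ge(1)[of ?xs] by (simp add: encode_instance_props(1))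
    then have nN: "n * n \<le> ?N" by simp
    have "n \<le> n * n" by (cases n) auto
    then have nN': "n \<le> ?N" using nN by (rule order_trans)
    have X: "n * n \<le> ?X" "n * ((n + 1)\<^sup>2 + 1) + (n + 1)\<^sup>2 + 1 \<le> ?X" "?N \<le> ?X"
    proof -
      have "n * ((n + 1)\<^sup>2 + 1) + (n + 1)\<^sup>2 + 1 \<le> ?N * ((?N + 1)\<^sup>2 + 1) + (?N + 1)\<^sup>2 + 1"
        using nN' by (intro add_mono mult_mono power_mono) auto
      then show "n * ((n + 1)\<^sup>2 + 1) + (n + 1)\<^sup>2 + 1 \<le> ?X" unfolding qX by (rule trans_le_add1)
      show "?N \<le> ?X" unfolding qX by simp
      then show "n * n \<le> ?X" using nN by (rule order_trans[rotated])
    qed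
    have "wp ?X tree_cover_c (\<lambda>s'. \<exists>ps. solution ps \<and> output_of s' = encode_trees (map path_tree ps))
      (input_memory ?xs)"
      using wp_tree_cover[of n k d, OF _ X] nat_weights_axioms unfolding w_def .
    then obtain t s' lab nx B ps nb where run: "exec tree_cover_c (input_memory ?xs) t s'" "t \<le> tbound ?X tree_cover_c"
      and inv: "loop_inv lab nx B" and ch: "chop w B (tour n lab nx) = (ps, nb)" and len: "length ps \<le> k"
      and out: "output_of s' = encode_trees (map path_tree ps)"
      unfolding wp_def solution_def by blast
    note res = chop_result[OF inv ch]
    let ?Ts = "map path_tree ps"
    have "solution ps" unfolding solution_def using inv ch len by blast
    then have "length (encode_trees ?Ts) \<le> 1 + 5 * ?N"
      using length_encode_path_trees[of ps] solution_facts(4,5)[of ps] nN' by simp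
    then have comp: "computes_within tree_cover_c ?xs (encode_trees ?Ts) (poly q ?N)"
      unfolding computes_within_def using run out qt by (intro exI[of _ t] exI[of _ s']) (simp add: q)
    have sub: "set xs \<subseteq> {..<n}" if "xs \<in> set ps" for xs
      using res(2) that by auto
    have cover: "tree_cover {..<n} (tree_of ` set ?Ts)"
      unfolding tree_cover_def
    proof (intro conjI ballI)
      fix T assume "T \<in> tree_of ` set ?Ts"
      then obtain xs where xs: "xs \<in> set ps" "T = tree_of (path_tree xs)" by auto
      have "xs \<noteq> []" "distinct xs" using res(1,3) xs(1) by (auto simp: distinct_concat_iff)
      then show "is_tree T" using path_is_tree[of xs] xs(2) by (simp add: path_tree_def)
      show "fst T \<subseteq> {..<n}" using sub[OF xs(1)] by (simp add: xs(2) tree_of_def path_tree_def)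
    next
      have "(\<Union>T\<in>tree_of ` set ?Ts. fst T) = set (concat ps)"
        by (auto simp: tree_of_def path_tree_def)
      then show "(\<Union>T\<in>tree_of ` set ?Ts. fst T) = {..<n}" using res(2) by simp
    qed
    have card: "card (tree_of ` set ?Ts) \<le> k"
      using card_image_le[of "set ?Ts" tree_of] card_length[of ?Ts] len by simp
    have bound: "(\<Sum>T\<in>tree_of ` set ?Ts. tree_weight ?d T powr p) powr (1 / p)
        \<le> 9 * (\<Sum>i<k. tree_weight ?d (Us ! i) powr p) powr (1 / p)"
      if p: "1 \<le> p" and Us: "length Us = k" "tree_cover {..<n} (set Us)" for p :: real and Us
    proof -
      let ?y = "\<lambda>i. tree_weight ?d (Us ! i)"
      have y: "0 \<le> ?y i" for i unfolding tree_weight_def using d_nonneg by (intro sum_nonneg) simp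
      have pw0: "0 \<le> path_weight ?d xs" for xs
        by (induction xs rule: induct_list012) (simp_all add: d_nonneg)
      have sc: "real (path_weight w xs) = real D * path_weight ?d xs" if "xs \<in> set ps" for xs
      proof -
        have "path_weight (\<lambda>u v. real (w u v)) xs = path_weight (\<lambda>u v. real D * ?d u v) xs"
          using sub[OF that] w by (intro path_weight_cong) auto
        then show ?thesis by (simp add: of_nat_path_weight path_weight_scale)
      qed
      have scU: "tree_weight (\<lambda>u v. real (w u v)) (Us ! i) = real D * ?y i" if "i < k" for i
        using Us that by (intro tree_weight_scale[of _ n]) (auto simp: tree_cover_def w)
      \<comment> \<open>Both sides of the guarantee for \<open>w\<close> carry the factor
        \<open>real D powr p\<close>, which cancels.\<close>
      have "real D powr p * (\<Sum>q<length ps. path_weight ?d (ps ! q) powr p) =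
          (\<Sum>q<length ps. real (path_weight w (ps ! q)) powr p)"
        using pw0 by (simp add: sc sum_distrib_left powr_mult)
      also have "\<dots> \<le> (\<Sum>i<k. (9 * tree_weight (\<lambda>u v. real (w u v)) (Us ! i)) powr p)"
        by (rule res(4)[OF len Us p])
      also have "\<dots> = real D powr p * (9 powr p * (\<Sum>i<k. ?y i powr p))"
        using y by (simp add: scU sum_distrib_left powr_mult mult_ac)
      finally have main: "(\<Sum>q<length ps. path_weight ?d (ps ! q) powr p) \<le> 9 powr p * (\<Sum>i<k. ?y i powr p)"
        using D by simp
      have "(\<Sum>T\<in>tree_of ` set ?Ts. tree_weight ?d T powr p)
          = (\<Sum>T\<in>(\<lambda>q. tree_of (path_tree (ps ! q))) ` {..<length ps}. tree_weight ?d T powr p)"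
      proof -
        have "tree_of ` set ?Ts = (\<lambda>q. tree_of (path_tree (ps ! q))) ` {..<length ps}"
          by (force simp: in_set_conv_nth)
        then show ?thesis by simp
      qed
      \<comment> \<open>If two paths gave the same tree, the set would count it once, which can only
        lower the sum.\<close>
      also have "\<dots> \<le> sum ((\<lambda>T. tree_weight ?d T powr p) \<circ> (\<lambda>q. tree_of (path_tree (ps ! q)))) {..<length ps}"
        by (rule sum_image_le) auto
      also have "\<dots> \<le> (\<Sum>q<length ps. path_weight ?d (ps ! q) powr p)"
        unfolding comp_def
      proof (intro sum_mono powr_mono2)
        fix q
        have "0 \<le> ?d u v \<and> ?d u v = ?d v u" for u v using M.nonneg M.commute by auto
        then show "0 \<le> tree_weight ?d (tree_of (path_tree (ps ! q)))"
          "tree_weight ?d (tree_of (path_tree (ps ! q))) \<le> path_weight ?d (ps ! q)"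
          using tree_weight_path[of "ps ! q" ?d] by blast+
      qed (use p in simp)
      also note main
      finally have "(\<Sum>T\<in>tree_of ` set ?Ts. tree_weight ?d T powr p) powr (1 / p)
          \<le> (9 powr p * (\<Sum>i<k. ?y i powr p)) powr (1 / p)"
        using p by (intro powr_mono2 sum_nonneg) auto
      also have "\<dots> = 9 * (\<Sum>i<k. ?y i powr p) powr (1 / p)"
        using p by (simp add: powr_mult powr_powr sum_nonneg)
      finally show ?thesis .
    qed
    show "\<exists>Ts :: tree_repr list.
      computes_within tree_cover_c ?xs (encode_trees Ts) (poly q ?N) \<and>
      tree_cover {..<n} (tree_of ` set Ts) \<and> card (tree_of ` set Ts) \<le> k \<and>
      (\<forall>(p :: real) (Us :: (nat set \<times> nat set set) list).
        1 \<le> p \<longrightarrow> length Us = k \<longrightarrow> tree_cover {..<n} (set Us) \<longrightarrow>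
        (\<Sum>T\<in>tree_of ` set Ts. tree_weight ?d T powr p) powr (1 / p)
        \<le> 9 * (\<Sum>i<k. tree_weight ?d (Us ! i) powr p) powr (1 / p))"
      using comp cover card bound by blast
  qed
qed

end
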